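(* Let $\Omega\subset\mathbb{R}^d$ be a bounded domain with irreducible isometry group, $0<\alpha\le2$ and $n\ge1$. For invertible real $d\times d$ matrices $T$ let $$Q(T)=\Big(\sum_{j=1}^n\lambda_j(\alpha,T(\Omega))\Big)^{2/\alpha}V(T(\Omega))^{2/d}\cdot\frac{V(T^{-1}(\Omega))^{1+2/d}}{I_2(T^{-1}(\Omega))}.$$ Then $Q$ is maximal when $T$ is a scalar multiple of an orthogonal matrix; i.e. $Q(T)\le Q(I)$ for every invertible $T$, and $Q(T)=Q(I)$ whenever $T$ is a nonzero scalar multiple of an orthogonal matrix.
   Context: $G_\Omega=\{U\in O(d):U(\Omega)=\Omega\}$; irreducible means the only $G_\Omega$-invariant subspaces of $\mathbb{R}^d$ are $\{0\}$ and $\mathbb{R}^d$. $V(D)$ is volume, $I_2(D)=\int_D|x|^2dx$. With $\widehat u(\xi)=\int u(x)e^{-2\pi i x\cdot\xi}dx$, the fractional Laplacian $(-\Delta)^{\alpha/2}$ on a bounded domain $D$ (with zero exterior condition) is the self-adjoint operator associated with the quadratic form $\int_{\mathbb{R}^d}(2\pi|\xi|)^{\alpha}|\widehat u(\xi)|^2d\xi$ on the closure of $C_c^\infty(D)$ in $H^{\alpha/2}(\mathbb{R}^d)$; $\lambda_1(\alpha,D)\le\lambda_2(\alpha,D)\le\dots$ are its eigenvalues with multiplicity. For $\alpha=2$ this is the Dirichlet Laplacian. *)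

theory Defs
  imports "HOL-Analysis.Analysis"
begin

fun iter_partials :: "'n::finite list \<Rightarrow> (real^'n \<Rightarrow> real) \<Rightarrow> real^'n \<Rightarrow> real" where
  "iter_partials [] f = f"
| "iter_partials (i # is) f =
     (\<lambda>x. frechet_derivative (iter_partials is f) (at x) (axis i 1))"

definition smooth_fun :: "(real^'n::finite \<Rightarrow> real) \<Rightarrow> bool" where
  "smooth_fun f \<longleftrightarrow> (\<forall>is x. iter_partials is f differentiable (at x))"

definition test_fun :: "(real^'n::finite) set \<Rightarrow> (real^'n \<Rightarrow> real) set" where
  "test_fun D = {\<phi>. smooth_fun \<phi> \<and> compact (closure {x. \<phi> x \<noteq> 0})
                    \<and> closure {x. \<phi> x \<noteq> 0} \<subseteq> D}"

definition fourier :: "(real^'n::finite \<Rightarrow> real) \<Rightarrow> real^'n \<Rightarrow> complex" where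
  "fourier u \<xi> = (LINT x|lebesgue. complex_of_real (u x) * cis (- 2 * pi * (x \<bullet> \<xi>)))"

text \<open>u lies in L^1 and L^2 and in H^s (via the Fourier side).  Membership in L^1 is harmless
  for the form domain below, since its elements vanish a.e. outside a bounded set.\<close>
definition in_H :: "real \<Rightarrow> (real^'n::finite \<Rightarrow> real) \<Rightarrow> bool" where
  "in_H s u \<longleftrightarrow> integrable lebesgue u \<and> integrable lebesgue (\<lambda>x. (u x)\<^sup>2)
      \<and> integrable lebesgue (\<lambda>\<xi>. (1 + (2 * pi * norm \<xi>)\<^sup>2) powr s * (cmod (fourier u \<xi>))\<^sup>2)"

definition H_norm2 :: "real \<Rightarrow> (real^'n::finite \<Rightarrow> real) \<Rightarrow> real" where
  "H_norm2 s u = (LINT \<xi>|lebesgue. (1 + (2 * pi * norm \<xi>)\<^sup>2) powr s * (cmod (fourier u \<xi>))\<^sup>2)"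

definition form_domain :: "real \<Rightarrow> (real^'n::finite) set \<Rightarrow> (real^'n \<Rightarrow> real) set" where
  "form_domain \<alpha> D = {u. in_H (\<alpha>/2) u \<and>
      (\<exists>\<phi>::nat \<Rightarrow> real^'n \<Rightarrow> real. (\<forall>k. \<phi> k \<in> test_fun D) \<and>
          (\<lambda>k. H_norm2 (\<alpha>/2) (\<lambda>x. \<phi> k x - u x)) \<longlonglongrightarrow> 0)}"

definition frac_form :: "real \<Rightarrow> (real^'n::finite \<Rightarrow> real) \<Rightarrow> (real^'n \<Rightarrow> real) \<Rightarrow> real" where
  "frac_form \<alpha> u v = Re (LINT \<xi>|lebesgue.
      complex_of_real ((2 * pi * norm \<xi>) powr \<alpha>) * (fourier u \<xi> * cnj (fourier v \<xi>)))"

text \<open>u is an eigenfunction with eigenvalue lam of the self-adjoint operator associated with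
  the form: u is in the form domain and q(u,v) = lam <u,v> for all v in the form domain.\<close>
definition frac_eigenfun :: "real \<Rightarrow> (real^'n::finite) set \<Rightarrow> real \<Rightarrow> (real^'n \<Rightarrow> real) \<Rightarrow> bool" where
  "frac_eigenfun \<alpha> D lam u \<longleftrightarrow> u \<in> form_domain \<alpha> D \<and>
      (\<forall>v \<in> form_domain \<alpha> D. frac_form \<alpha> u v = lam * (LINT x|lebesgue. u x * v x))"

text \<open>lambda_j(alpha,D), j >= 1, counted with multiplicity: the least lam such that there are
  j L^2-orthonormal eigenfunctions with eigenvalues at most lam.\<close>
definition frac_eigenvalue :: "real \<Rightarrow> (real^'n::finite) set \<Rightarrow> nat \<Rightarrow> real" where
  "frac_eigenvalue \<alpha> D j = Inf {lam. \<exists>(f::nat \<Rightarrow> real^'n \<Rightarrow> real) (\<mu>::nat \<Rightarrow> real).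
      (\<forall>i<j. frac_eigenfun \<alpha> D (\<mu> i) (f i) \<and> \<mu> i \<le> lam) \<and>
      (\<forall>i<j. \<forall>k<j. (LINT x|lebesgue. f i x * f k x) = (if i = k then 1 else 0))}"

definition vol :: "(real^'n::finite) set \<Rightarrow> real" where
  "vol D = measure lebesgue D"

definition I2 :: "(real^'n::finite) set \<Rightarrow> real" where
  "I2 D = (LINT x:D|lebesgue. (norm x)\<^sup>2)"

definition isometry_group :: "(real^'n::finite) set \<Rightarrow> (real^'n^'n) set" where
  "isometry_group \<Omega> = {U. orthogonal_matrix U \<and> (\<lambda>x. U *v x) ` \<Omega> = \<Omega>}"

definition irreducible_group :: "(real^'n::finite^'n) set \<Rightarrow> bool" where
  "irreducible_group G \<longleftrightarrow> (\<forall>S. subspace S \<and> (\<forall>U\<in>G. (\<lambda>x. U *v x) ` S \<subseteq> S)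
       \<longrightarrow> S = {0} \<or> S = UNIV)"

definition domain :: "(real^'n::finite) set \<Rightarrow> bool" where
  "domain \<Omega> \<longleftrightarrow> open \<Omega> \<and> connected \<Omega> \<and> \<Omega> \<noteq> {}"

definition Qfun :: "real \<Rightarrow> nat \<Rightarrow> (real^'n::finite) set \<Rightarrow> real^'n^'n \<Rightarrow> real" where
  "Qfun \<alpha> n \<Omega> T =
     (\<Sum>j=1..n. frac_eigenvalue \<alpha> ((\<lambda>x. T *v x) ` \<Omega>) j) powr (2 / \<alpha>)
     * vol ((\<lambda>x. T *v x) ` \<Omega>) powr (2 / real CARD('n))
     * (vol ((\<lambda>x. matrix_inv T *v x) ` \<Omega>) powr (1 + 2 / real CARD('n))
        / I2 ((\<lambda>x. matrix_inv T *v x) ` \<Omega>))"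

end

(*
  Rayleigh's principle for sums of eigenvalues: the sum of the first n eigenvalues of a form is at most
  the sum of the values of the form on any n orthonormal functions of the form domain, with equality for
  suitable eigenfunctions. Transplant orthonormal eigenfunctions u_1, ..., u_n of the domain Omega to
  T(Omega) along T U, where U is an isometry of Omega. On the Fourier side this gives, with
  N = T^(-1) and A = N N^T,

    sum_j lambda_j(T(Omega)) <= int (2 pi)^alpha (eta . (U^T A U) eta)^(alpha/2) sum_i |u_i^(eta)|^2 d eta.

  The tangent line of the concave function t^(alpha/2) makes the right-hand side affine in U^T A U, so
  U^T A U may be replaced by its average over the group, which by irreducibility is the scalar matrix
  kappa = |N|^2 / d. Hence the sum over T(Omega) is at most kappa^(alpha/2) times the sum over Omega.
  Irreducibility also turns the second moment of N(Omega) into |det N| kappa I_2(Omega), and the powers of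
  the volume cancel the determinants. For a multiple of an orthogonal matrix both sides scale exactly.
*)
theory Submission
  imports Defs "HOL-Probability.Characteristic_Functions" "HOL-Complex_Analysis.Great_Picard"
    "HOL-Real_Asymp.Real_Asymp"
begin

unbundle no fps_syntax

section \<open>Forms with compact resolvent\<close>

text \<open>An eigenvalue is defined here as an infimum over orthonormal families of eigenfunctions,
  which says nothing until such families are known to exist. Most of the development therefore
  builds the spectral theory itself: Plancherel's identity, completeness and compactness of the form
  domain, eigenfunctions by minimization. Elements of the form domain are functions rather than
  classes, so the forms are only semidefinite and every argument must do without definiteness.

  The isometry U enters through the map TU, not through the eigenfunctions: TU(Omega) = T(Omega), so
  the left side stays fixed while the matrix on the right runs over the orbit of A. A bound that is
  linear in the matrix survives the passage to the closed convex hull of the orbit; this is what the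
  tangent is for. It is taken at the averaged value kappa |eta|^2, because there the coefficients 1
  - alpha/2 and alpha/2 recombine to 1 and nothing is lost. |N|^2 is the trace of A, which averaging
  preserves.\<close>

locale psd_form =
  fixes V :: "('a \<Rightarrow> real) set" and f :: "('a \<Rightarrow> real) \<Rightarrow> ('a \<Rightarrow> real) \<Rightarrow> real"
  assumes lincomb: "u \<in> V \<Longrightarrow> v \<in> V \<Longrightarrow> (\<lambda>x. a * u x + c * v x) \<in> V"
    and sym: "u \<in> V \<Longrightarrow> v \<in> V \<Longrightarrow> f u v = f v u"
    and lin: "u \<in> V \<Longrightarrow> v \<in> V \<Longrightarrow> w \<in> V \<Longrightarrow>
      f (\<lambda>x. a * u x + c * v x) w = a * f u w + c * f v w"
    and nonneg: "u \<in> V \<Longrightarrow> 0 \<le> f u u"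
begin

lemma lin_right: "u \<in> V \<Longrightarrow> v \<in> V \<Longrightarrow> w \<in> V \<Longrightarrow>
      f w (\<lambda>x. a * u x + c * v x) = a * f w u + c * f w v"
  using lin[of u v w a c] sym[of w "\<lambda>x. a * u x + c * v x"] sym[of w u] sym[of w v] lincomb by simp

lemma quadratic: assumes "u \<in> V" "v \<in> V"
  shows "f (\<lambda>x. a * u x + c * v x) (\<lambda>x. a * u x + c * v x) = a\<^sup>2 * f u u + 2 * a * c * f u v + c\<^sup>2 * f v v"
  using assms by (simp add: lin lin_right lincomb sym[of v u] algebra_simps power2_eq_square)

lemma diff_mem: "u \<in> V \<Longrightarrow> v \<in> V \<Longrightarrow> (\<lambda>x. u x - v x) \<in> V"
  using lincomb[of u v 1 "-1"] by simp

lemma scale_mem: "u \<in> V \<Longrightarrow> (\<lambda>x. c * u x) \<in> V"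
  using lincomb[of u u c 0] by simp

lemma diff_left: "u \<in> V \<Longrightarrow> v \<in> V \<Longrightarrow> w \<in> V \<Longrightarrow> f (\<lambda>x. u x - v x) w = f u w - f v w"
  using lin[of u v w 1 "-1"] by simp

lemma diff_quadratic: assumes "u \<in> V" "v \<in> V"
  shows "f (\<lambda>x. u x - v x) (\<lambda>x. u x - v x) = f u u - 2 * f u v + f v v"
  using quadratic[OF assms, of 1 "-1"] by simp

lemma add_quadratic: assumes "u \<in> V" "v \<in> V"
  shows "f (\<lambda>x. u x + v x) (\<lambda>x. u x + v x) = f u u + 2 * f u v + f v v"
  using quadratic[OF assms, of 1 "1"] by simp

lemma scale_quadratic: assumes "u \<in> V"
  shows "f (\<lambda>x. c * u x) (\<lambda>x. c * u x) = c\<^sup>2 * f u u"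
  using quadratic[OF assms assms, of c 0] by simp

lemma Cauchy_Schwarz: assumes "u \<in> V" "v \<in> V" shows "(f u v)\<^sup>2 \<le> f u u * f v v"
proof (cases "f v v = 0")
  case True
  have "f u v = 0"
  proof (rule ccontr)
    assume n: "f u v \<noteq> 0"
    \<comment> \<open>Without definiteness \<open>v\<close> may be a null vector. The value of the
      form at \<open>u + c v\<close> is then affine in \<open>c\<close>, and this \<open>c\<close>
      makes it -1.\<close>
    let ?c = "- (f u u + 1) / (2 * f u v)"
    have "0 \<le> f (\<lambda>x. 1 * u x + ?c * v x) (\<lambda>x. 1 * u x + ?c * v x)"
      by (intro nonneg lincomb assms)
    also have "\<dots> = f u u + 2 * ?c * f u v" using quadratic[OF assms, of 1 ?c] True by simp
    also have "\<dots> = -1" using n by (simp add: field_simps)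
    finally show False by simp
  qed
  then show ?thesis using True by simp
next
  case False
  then have p: "f v v > 0" using nonneg[OF assms(2)] by simp
  have "0 \<le> f (\<lambda>x. f v v * u x + (- f u v) * v x) (\<lambda>x. f v v * u x + (- f u v) * v x)"
    by (intro nonneg lincomb assms)
  also have "\<dots> = f v v * (f u u * f v v - (f u v)\<^sup>2)"
    using quadratic[OF assms, of "f v v" "- f u v"] by (simp add: algebra_simps power2_eq_square)
  finally show ?thesis using p by (simp add: zero_le_mult_iff)
qed

text \<open>Stands in for the first variation: a minimizer of a Rayleigh quotient is a null vector
  of a nonnegative form, and by Cauchy-Schwarz null vectors are orthogonal to everything.\<close>

lemma null_left: assumes "u \<in> V" "v \<in> V" "f u u = 0" shows "f u v = 0"
  using Cauchy_Schwarz[OF assms(1,2)] assms(3) by simp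

text \<open>\<open>V\<close> is not assumed nonempty, so for \<open>n = 0\<close> the member
  \<open>z\<close> is what provides the zero function.\<close>

lemma sum_mem: assumes "\<forall>i<n::nat. u i \<in> V" "z \<in> V"
  shows "(\<lambda>x. \<Sum>i<n. c i * u i x) \<in> V"
  using assms(1)
proof (induct n)
  case 0 then show ?case using lincomb[OF assms(2) assms(2), of 0 0] by simp
next
  case (Suc n)
  then show ?case using lincomb[of "\<lambda>x. \<Sum>i<n. c i * u i x" "u n" 1 "c n"] by simp
qed

lemma sum_left: assumes "\<forall>i<n::nat. u i \<in> V" "w \<in> V"
  shows "f (\<lambda>x. \<Sum>i<n. c i * u i x) w = (\<Sum>i<n. c i * f (u i) w)"
  using assms(1)
proof (induct n)
  case 0 then show ?case using lin[OF assms(2) assms(2) assms(2), of 0 0] by simp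
next
  case (Suc n)
  then show ?case
    using lin[of "\<lambda>x. \<Sum>i<n. c i * u i x" "u n" w 1 "c n"] sum_mem[of n u w] assms(2) by simp
qed

lemma tendsto_left: assumes "\<And>m. v m \<in> V" "u \<in> V" "w \<in> V"
    "(\<lambda>m. f (\<lambda>x. v m x - u x) (\<lambda>x. v m x - u x)) \<longlonglongrightarrow> 0"
  shows "(\<lambda>m. f (v m) w) \<longlonglongrightarrow> f u w"
proof -
  have "(\<lambda>m. sqrt (f (\<lambda>x. v m x - u x) (\<lambda>x. v m x - u x) * f w w)) \<longlonglongrightarrow> sqrt (0 * f w w)"
    by (intro tendsto_intros assms)
  then have l: "(\<lambda>m. sqrt (f (\<lambda>x. v m x - u x) (\<lambda>x. v m x - u x) * f w w)) \<longlonglongrightarrow> 0" by simp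
  have "norm (f (v m) w - f u w) \<le> sqrt (f (\<lambda>x. v m x - u x) (\<lambda>x. v m x - u x) * f w w)" for m
  proof -
    have "(f (v m) w - f u w)\<^sup>2 \<le> f (\<lambda>x. v m x - u x) (\<lambda>x. v m x - u x) * f w w"
      using Cauchy_Schwarz[of "\<lambda>x. v m x - u x" w] assms by (simp add: diff_mem diff_left)
    from real_sqrt_le_mono[OF this] show ?thesis by simp
  qed
  then have "(\<lambda>m. f (v m) w - f u w) \<longlonglongrightarrow> 0"
    by (intro Lim_null_comparison[OF _ l]) auto
  then show ?thesis by (simp add: LIM_zero_iff)
qed

lemma tendsto_quadratic: assumes "\<And>m. v m \<in> V" "u \<in> V"
    "(\<lambda>m. f (\<lambda>x. v m x - u x) (\<lambda>x. v m x - u x)) \<longlonglongrightarrow> 0"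
  shows "(\<lambda>m. f (v m) (v m)) \<longlonglongrightarrow> f u u"
proof -
  have "(\<lambda>m. f (\<lambda>x. v m x - u x) (\<lambda>x. v m x - u x) + 2 * f (v m) u - f u u) \<longlonglongrightarrow> 0 + 2 * f u u - f u u"
    by (intro tendsto_intros assms tendsto_left)
  then show ?thesis using assms by (simp add: diff_quadratic)
qed

end

text \<open>An abstract self-adjoint operator with compact resolvent, given by its form \<open>q\<close> on the form
  domain \<open>V\<close>, in an inner product \<open>b\<close> that need not separate points.\<close>

locale spectral_form = b: psd_form V b + q: psd_form V q
  for V :: "('a \<Rightarrow> real) set" and b q :: "('a \<Rightarrow> real) \<Rightarrow> ('a \<Rightarrow> real) \<Rightarrow> real" +
  assumes null: "u \<in> V \<Longrightarrow> b u u = 0 \<Longrightarrow> q u u = 0"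
    and compact: "(\<And>m::nat. v m \<in> V) \<Longrightarrow> (\<And>m. b (v m) (v m) + q (v m) (v m) \<le> C) \<Longrightarrow>
      \<exists>r. strict_mono r \<and> (\<forall>e>0. \<exists>N::nat. \<forall>m\<ge>N. \<forall>l\<ge>N.
         b (\<lambda>x. v (r m) x - v (r l) x) (\<lambda>x. v (r m) x - v (r l) x) < e)"
    and complete: "(\<And>m::nat. v m \<in> V) \<Longrightarrow> (\<forall>e>0. \<exists>N. \<forall>m\<ge>N. \<forall>l\<ge>N.
         b (\<lambda>x. v m x - v l x) (\<lambda>x. v m x - v l x) + q (\<lambda>x. v m x - v l x) (\<lambda>x. v m x - v l x) < e) \<Longrightarrow>
      \<exists>u\<in>V. (\<lambda>m. b (\<lambda>x. v m x - u x) (\<lambda>x. v m x - u x)) \<longlonglongrightarrow> 0 \<and>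
            (\<lambda>m. q (\<lambda>x. v m x - u x) (\<lambda>x. v m x - u x)) \<longlonglongrightarrow> 0"
    and infinite_dim: "\<exists>u. (\<forall>i<n::nat. u i \<in> V) \<and> (\<forall>i<n. \<forall>k<n. b (u i) (u k) = (if i = k then 1 else 0))"
begin

definition ON :: "nat \<Rightarrow> (nat \<Rightarrow> 'a \<Rightarrow> real) \<Rightarrow> bool" where
  "ON n u \<longleftrightarrow> (\<forall>i<n. u i \<in> V) \<and> (\<forall>i<n. \<forall>k<n. b (u i) (u k) = (if i = k then 1 else 0))"

definition eigen :: "('a \<Rightarrow> real) \<Rightarrow> real \<Rightarrow> bool" where
  "eigen u m \<longleftrightarrow> u \<in> V \<and> (\<forall>v\<in>V. q u v = m * b u v)"

definition proj :: "nat \<Rightarrow> (nat \<Rightarrow> 'a \<Rightarrow> real) \<Rightarrow> ('a \<Rightarrow> real) \<Rightarrow> 'a \<Rightarrow> real" where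
  "proj n u v = (\<lambda>x. \<Sum>i<n. b v (u i) * u i x)"

lemma ON_mono: "ON n u \<Longrightarrow> k \<le> n \<Longrightarrow> ON k u" by (auto simp: ON_def)

lemma ON_mem: "ON n u \<Longrightarrow> i < n \<Longrightarrow> u i \<in> V" by (auto simp: ON_def)

lemma proj_mem: "ON n u \<Longrightarrow> v \<in> V \<Longrightarrow> proj n u v \<in> V"
  unfolding proj_def ON_def by (intro b.sum_mem[of _ _ v]) auto

lemma b_proj: assumes "ON n u" "v \<in> V" "w \<in> V"
  shows "b (proj n u v) w = (\<Sum>i<n. b v (u i) * b w (u i))"
  using assms b.sym[of _ w] unfolding proj_def ON_def
  by (subst b.sum_left) (auto intro!: sum.cong)

lemma proj_orth: assumes "ON n u" "v \<in> V" "k < n"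
  shows "b (\<lambda>x. v x - proj n u v x) (u k) = 0"
proof -
  have "b (proj n u v) (u k) = (\<Sum>i<n. b v (u i) * b (u k) (u i))"
    using assms by (intro b_proj) (auto simp: ON_def)
  also have "\<dots> = (\<Sum>i<n. if i = k then b v (u i) else 0)"
    using assms by (intro sum.cong) (auto simp: ON_def)
  also have "\<dots> = b v (u k)" using assms by simp
  finally show ?thesis using assms by (subst b.diff_left) (auto simp: proj_mem ON_mem)
qed

lemma proj_diff_norm: assumes "ON n u" "v \<in> V"
  shows "b (\<lambda>x. v x - proj n u v x) (\<lambda>x. v x - proj n u v x) = b v v - (\<Sum>i<n. (b v (u i))\<^sup>2)"
proof -
  let ?p = "proj n u v"
  have p: "?p \<in> V" using assms proj_mem by auto
  have 1: "b ?p v = (\<Sum>i<n. (b v (u i))\<^sup>2)" using b_proj[OF assms assms(2)] by (simp add: power2_eq_square)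
  have "b ?p (\<lambda>x. v x - ?p x) = (\<Sum>i<n. b v (u i) * b (\<lambda>x. v x - ?p x) (u i))"
    using assms p by (intro b_proj) (auto intro: b.diff_mem)
  also have "\<dots> = 0" using proj_orth[OF assms] by (intro sum.neutral) auto
  finally have "b ?p v = b ?p ?p" using assms p b.diff_left[of v ?p ?p] b.sym[of ?p v] b.sym[of ?p "\<lambda>x. v x - ?p x"] b.diff_mem
    by simp
  then show ?thesis using b.diff_quadratic[OF assms(2) p] 1 b.sym[OF p assms(2)] by simp
qed

lemma Bessel: assumes "ON n u" "v \<in> V" shows "(\<Sum>i<n. (b v (u i))\<^sup>2) \<le> b v v"
  using proj_diff_norm[OF assms] b.nonneg[OF b.diff_mem[OF assms(2) proj_mem[OF assms]]] by simp

text \<open>Counting the double sum of squared Fourier coefficients in two ways replaces every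
  dimension argument.\<close>

lemma ON_family_not_in_span: assumes "ON n u" "ON (Suc n) v"
  shows "\<exists>i<Suc n. b (\<lambda>x. v i x - proj n u (v i) x) (\<lambda>x. v i x - proj n u (v i) x) > 0"
proof (rule ccontr)
  assume c: "\<not> ?thesis"
  have "(\<Sum>k<n. (b (v i) (u k))\<^sup>2) = 1" if "i < Suc n" for i
  proof -
    have vi: "v i \<in> V" "b (v i) (v i) = 1" using that assms by (auto simp: ON_def)
    have "b (\<lambda>x. v i x - proj n u (v i) x) (\<lambda>x. v i x - proj n u (v i) x) = 0"
      using c that b.nonneg[OF b.diff_mem[OF vi(1) proj_mem[OF assms(1) vi(1)]]] by force
    then show ?thesis using proj_diff_norm[OF assms(1) vi(1)] vi by simp
  qed
  then have "real (Suc n) = (\<Sum>i<Suc n. \<Sum>k<n. (b (v i) (u k))\<^sup>2)" by simp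
  also have "\<dots> = (\<Sum>k<n. \<Sum>i<Suc n. (b (u k) (v i))\<^sup>2)"
    by (subst sum.swap) (intro sum.cong refl, metis ON_mem assms b.sym lessThan_iff)
  also have "\<dots> \<le> (\<Sum>k<n. 1)"
  proof (intro sum_mono)
    fix k assume "k \<in> {..<n}"
    then show "(\<Sum>i<Suc n. (b (u k) (v i))\<^sup>2) \<le> 1"
      using Bessel[OF assms(2) ON_mem[OF assms(1)], of k] assms(1)
      by (auto simp: ON_def simp del: sum.lessThan_Suc)
  qed
  finally show False by simp
qed

section \<open>Eigenfunctions by successive minimization of the Rayleigh quotient\<close>

definition minimizing :: "nat \<Rightarrow> (nat \<Rightarrow> 'a \<Rightarrow> real) \<Rightarrow> (nat \<Rightarrow> real) \<Rightarrow> bool" where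
  "minimizing n u \<mu> \<longleftrightarrow> ON n u \<and> (\<forall>k<n. eigen (u k) (\<mu> k)) \<and>
     (\<forall>k<n. \<forall>v\<in>V. (\<forall>i<k. b v (u i) = 0) \<longrightarrow> \<mu> k * b v v \<le> q v v)"

text \<open>Direct method. A minimizing sequence of unit vectors is bounded for
  \<open>b + q\<close>, so a subsequence is \<open>b\<close>-Cauchy by \<open>compact\<close>; the
  parallelogram identity makes it \<open>q\<close>-Cauchy, and \<open>complete\<close> supplies a
  limit, to which the constraints and both quadratic values pass by continuity.\<close>

lemma minimizer_exists:
  assumes "ON n u"
  shows "\<exists>w\<in>V. \<exists>m. (\<forall>i<n. b w (u i) = 0) \<and> b w w = 1 \<and> q w w = m \<and>
     (\<forall>v\<in>V. (\<forall>i<n. b v (u i) = 0) \<longrightarrow> m * b v v \<le> q v v)"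
proof -
  define W where "W = {v\<in>V. \<forall>i<n. b v (u i) = 0}"
  have Wlin: "(\<lambda>x. a * v x + c * w x) \<in> W" if "v \<in> W" "w \<in> W" for v w a c
    using that assms unfolding W_def by (auto simp: b.lincomb b.lin ON_mem)
  have WV: "v \<in> V" if "v \<in> W" for v using that W_def by auto
  define A where "A = {q v v | v. v \<in> W \<and> b v v = 1}"
  have normalize: "(\<lambda>x. (1 / sqrt (b v v)) * v x) \<in> W \<and> 
      b (\<lambda>x. (1 / sqrt (b v v)) * v x) (\<lambda>x. (1 / sqrt (b v v)) * v x) = 1 \<and>
      q (\<lambda>x. (1 / sqrt (b v v)) * v x) (\<lambda>x. (1 / sqrt (b v v)) * v x) = q v v / b v v"
    if "v \<in> W" "b v v > 0" for v
    using that Wlin[of v v "1 / sqrt (b v v)" 0] WV[of v]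
      b.scale_quadratic[of v "1 / sqrt (b v v)"] q.scale_quadratic[of v "1 / sqrt (b v v)"]
    by (simp add: power_divide)
  \<comment> \<open>The constrained set contains a unit vector: among \<open>n + 1\<close>
    orthonormal functions one has a nonzero residual after projection, and the residual can be
    normalized.\<close>
  obtain v0 where v0: "ON (Suc n) v0" using infinite_dim[of "Suc n"] unfolding ON_def by auto
  obtain i where i: "i < Suc n" "b (\<lambda>x. v0 i x - proj n u (v0 i) x) (\<lambda>x. v0 i x - proj n u (v0 i) x) > 0"
    using ON_family_not_in_span[OF assms v0] by auto
  have "(\<lambda>x. v0 i x - proj n u (v0 i) x) \<in> W"
    using proj_orth[OF assms ON_mem[OF v0 i(1)]] proj_mem[OF assms ON_mem[OF v0 i(1)]] b.diff_mem ON_mem[OF v0 i(1)]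
    by (simp add: W_def)
  from normalize[OF this i(2)] have Ane: "A \<noteq> {}" unfolding A_def by blast
  have Abd: "bdd_below A" unfolding A_def by (rule bdd_belowI[of _ 0]) (auto intro: q.nonneg WV)
  define m where "m = Inf A"
  have min: "m * b v v \<le> q v v" if v: "v \<in> W" for v
  proof (cases "b v v = 0")
    case True then show ?thesis using q.nonneg[OF WV[OF v]] by simp
  next
    case False
    then have p: "b v v > 0" using b.nonneg[OF WV[OF v]] by simp
    have "m \<le> q v v / b v v" unfolding m_def
      by (rule cInf_lower[OF _ Abd]) (use normalize[OF v p] in \<open>force simp: A_def\<close>)
    then show ?thesis using p by (simp add: field_simps)
  qed
  have m0: "0 \<le> m" unfolding m_def by (rule cInf_greatest[OF Ane]) (auto simp: A_def intro: q.nonneg WV)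
  have "\<exists>v. v \<in> W \<and> b v v = 1 \<and> q v v < m + 1 / real (Suc k)" for k
    using cInf_lessD[OF Ane, of "m + 1 / real (Suc k)"] unfolding m_def A_def by auto
  then obtain s where s: "\<And>k. s k \<in> W" "\<And>k. b (s k) (s k) = 1" "\<And>k. q (s k) (s k) < m + 1 / real (Suc k)"
    by metis
  have sV: "s k \<in> V" for k using WV s by auto
  have "b (s k) (s k) + q (s k) (s k) \<le> m + 2" for k
  proof -
    have "1 / real (Suc k) \<le> 1" by simp
    then show ?thesis using s(2,3)[of k] by linarith
  qed
  from compact[of s, OF sV this] obtain r where r: "strict_mono r"
    "\<forall>e>0. \<exists>N::nat. \<forall>j\<ge>N. \<forall>l\<ge>N. b (\<lambda>x. s (r j) x - s (r l) x) (\<lambda>x. s (r j) x - s (r l) x) < e"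
    by auto
  define t where "t = (\<lambda>j. s (r j))"
  have t: "t j \<in> W" "t j \<in> V" "b (t j) (t j) = 1" for j using s sV t_def by auto
  have tq: "q (t j) (t j) < m + 1 / real (Suc j)" for j
  proof -
    have "1 / real (Suc (r j)) \<le> 1 / real (Suc j)" using seq_suble[OF r(1), of j] by (simp add: field_simps)
    then show ?thesis using s(3)[of "r j"] t_def by force
  qed
  \<comment> \<open>Parallelogram identity: the sum of the two functions lies in \<open>W\<close>,
    so \<open>q\<close> of it is at least \<open>m\<close> times \<open>b\<close> of it, and
    \<open>b\<close> of the sum is 4 minus \<open>b\<close> of the difference.\<close>
  have par: "q (\<lambda>x. t j x - t l x) (\<lambda>x. t j x - t l x)
      \<le> 2 / real (Suc j) + 2 / real (Suc l) + m * b (\<lambda>x. t j x - t l x) (\<lambda>x. t j x - t l x)" for j l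
  proof -
    have "m * b (\<lambda>x. t j x + t l x) (\<lambda>x. t j x + t l x) \<le> q (\<lambda>x. t j x + t l x) (\<lambda>x. t j x + t l x)"
      using min[of "\<lambda>x. t j x + t l x"] Wlin[of "t j" "t l" 1 1] t by simp
    then show ?thesis using tq[of j] tq[of l] t
      by (simp add: b.add_quadratic b.diff_quadratic q.add_quadratic q.diff_quadratic algebra_simps)
  qed
  have "\<exists>N. \<forall>j\<ge>N. \<forall>l\<ge>N. b (\<lambda>x. t j x - t l x) (\<lambda>x. t j x - t l x) + q (\<lambda>x. t j x - t l x) (\<lambda>x. t j x - t l x) < e"
    if e: "e > 0" for e
  proof -
    \<comment> \<open>By \<open>par\<close> the quantity to be bounded is at most
      \<open>m + 1\<close> times the \<open>b\<close>-term plus two reciprocal terms; the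
      \<open>b\<close>-term and the reciprocals get half of \<open>e\<close> each.\<close>
    have "e / (2 * (m + 1)) > 0" using e m0 by simp
    then obtain N1 where N1: "\<And>j l. j \<ge> N1 \<Longrightarrow> l \<ge> N1 \<Longrightarrow> b (\<lambda>x. t j x - t l x) (\<lambda>x. t j x - t l x) < e / (2 * (m + 1))"
      using r(2) unfolding t_def by meson
    obtain N2 where N2: "1 / real (Suc N2) < e / 8" using e nat_approx_posE[of "e/8"] by auto
    have "b (\<lambda>x. t j x - t l x) (\<lambda>x. t j x - t l x) + q (\<lambda>x. t j x - t l x) (\<lambda>x. t j x - t l x) < e"
      if "j \<ge> max N1 N2" "l \<ge> max N1 N2" for j l
    proof -
      let ?B = "b (\<lambda>x. t j x - t l x) (\<lambda>x. t j x - t l x)"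
      have "1 / real (Suc i) < e / 8" if "i \<ge> N2" for i
        using N2 that by (smt (verit) frac_le of_nat_0_less_iff of_nat_mono Suc_le_mono zero_less_Suc)
      then have "1 / real (Suc j) < e / 8" "1 / real (Suc l) < e / 8" using that by auto
      moreover have "(m + 1) * ?B < e / 2"
        using N1[of j l] that m0 by (simp add: field_simps)
      ultimately show ?thesis using par[of j l] by (simp add: algebra_simps)
    qed
    then show ?thesis by blast
  qed
  from complete[of t, OF t(2)] this obtain w where w: "w \<in> V"
     "(\<lambda>m. b (\<lambda>x. t m x - w x) (\<lambda>x. t m x - w x)) \<longlonglongrightarrow> 0"
     "(\<lambda>m. q (\<lambda>x. t m x - w x) (\<lambda>x. t m x - w x)) \<longlonglongrightarrow> 0"
    by blast
  have "b w (u i) = 0" if "i < n" for i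
  proof -
    have "(\<lambda>j. b (t j) (u i)) \<longlonglongrightarrow> b w (u i)"
      by (intro b.tendsto_left t w ON_mem[OF assms that])
    moreover have "b (t j) (u i) = 0" for j using t(1)[of j] that by (simp add: W_def)
    ultimately show ?thesis by (simp add: LIMSEQ_const_iff)
  qed
  moreover have bw: "b w w = 1"
    using b.tendsto_quadratic[of t w, OF t(2) w(1,2)] t(3) by (simp add: LIMSEQ_const_iff)
  ultimately have wW: "w \<in> W" using w by (simp add: W_def)
  have "(\<lambda>j. q (t j) (t j)) \<longlonglongrightarrow> q w w" using q.tendsto_quadratic[of t w, OF t(2) w(1,3)] .
  moreover have "(\<lambda>j. m + 1 / real (Suc j)) \<longlonglongrightarrow> m + 0"
    by (intro tendsto_intros LIMSEQ_Suc lim_1_over_n)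
  ultimately have "q w w \<le> m + 0"
    using tq by (intro LIMSEQ_le[of "\<lambda>j. q (t j) (t j)" _ "\<lambda>j. m + 1 / real (Suc j)"]) (auto intro: less_imp_le)
  moreover have "m \<le> q w w" using min[OF wW] bw by simp
  ultimately have "q w w = m" by simp
  then show ?thesis using w(1) wW bw min by (intro bexI[of _ w] exI[of _ m]) (auto simp: W_def)
qed

text \<open>The form \<open>q - m b\<close> is nonnegative on the orthogonal complement of the
  earlier functions and vanishes at the minimizer \<open>w\<close>, so \<open>null_left\<close>
  gives the eigenvalue equation there. It extends to all of \<open>V\<close> because projections
  onto the earlier eigenfunctions are orthogonal to \<open>w\<close> both in \<open>b\<close> and in
  \<open>q\<close>.\<close>

lemma minimizing_Suc:
  assumes "minimizing n u \<mu>"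
  shows "\<exists>u' \<mu>'. minimizing (Suc n) u' \<mu>'"
proof -
  have on: "ON n u" and eig: "\<And>k. k < n \<Longrightarrow> eigen (u k) (\<mu> k)"
    and mi: "\<And>k v. k < n \<Longrightarrow> v \<in> V \<Longrightarrow> (\<forall>i<k. b v (u i) = 0) \<Longrightarrow> \<mu> k * b v v \<le> q v v"
    using assms unfolding minimizing_def by auto
  obtain w m where w: "w \<in> V" "\<forall>i<n. b w (u i) = 0" "b w w = 1" "q w w = m"
     and min: "\<And>v. v \<in> V \<Longrightarrow> (\<forall>i<n. b v (u i) = 0) \<Longrightarrow> m * b v v \<le> q v v"
    using minimizer_exists[OF on] by metis
  define W where "W = {v\<in>V. \<forall>i<n. b v (u i) = 0}"
  interpret p: psd_form W "\<lambda>x y. q x y - m * b x y"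
  proof
    show "(\<lambda>x. a * v x + c * w x) \<in> W" if "v \<in> W" "w \<in> W" for v w a c
      using that on unfolding W_def by (auto simp: b.lincomb b.lin ON_mem)
  qed (auto simp: W_def b.sym q.sym b.lin q.lin min algebra_simps)
  have wW: "w \<in> W" using w by (simp add: W_def)
  have orth: "q w v = m * b w v" if "v \<in> W" for v
    using p.null_left[OF wW that] w by simp
  have "q w v = m * b w v" if v: "v \<in> V" for v
  proof -
    let ?p = "proj n u v"
    have pV: "?p \<in> V" using proj_mem[OF on v] .
    have dW: "(\<lambda>x. v x - ?p x) \<in> W" using b.diff_mem[OF v pV] proj_orth[OF on v] by (simp add: W_def)
    have "q ?p w = (\<Sum>i<n. b v (u i) * q (u i) w)"
      unfolding proj_def using on w(1) by (intro q.sum_left) (auto simp: ON_mem)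
    also have "\<dots> = 0"
      using eig w(1) w(2) b.sym[of w] on by (intro sum.neutral) (auto simp: eigen_def ON_mem)
    finally have 1: "q w ?p = 0" using q.sym[OF w(1) pV] by simp
    have 2: "b w ?p = 0" using b_proj[OF on v w(1)] w(2) b.sym[OF w(1) pV] by simp
    have "q w v - q w ?p = m * (b w v - b w ?p)"
      using orth[OF dW] q.lin_right[OF v pV w(1), of 1 "-1"] b.lin_right[OF v pV w(1), of 1 "-1"] by simp
    then show ?thesis using 1 2 by simp
  qed
  then have ew: "eigen w m" using w(1) by (auto simp: eigen_def)
  have wu: "b (u i) w = 0" if "i < n" for i using w that b.sym[OF w(1) ON_mem[OF on that]] by simp
  have "minimizing (Suc n) (u(n := w)) (\<mu>(n := m))"
    unfolding minimizing_def
  proof (intro conjI allI impI ballI)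
    show "ON (Suc n) (u(n := w))"
      using on w wu unfolding ON_def by (auto simp: less_Suc_eq)
    show "eigen ((u(n := w)) k) ((\<mu>(n := m)) k)" if "k < Suc n" for k
      using that eig ew by (auto simp: less_Suc_eq)
    show "(\<mu>(n := m)) k * b v v \<le> q v v" if "k < Suc n" "v \<in> V" "\<forall>i<k. b v ((u(n := w)) i) = 0" for k v
    proof (cases "k = n")
      case True then show ?thesis using that min[of v] by auto
    next
      case False
      then show ?thesis using that mi[of k v] by auto
    qed
  qed
  then show ?thesis by blast
qed

lemma minimizing_exists: "\<exists>u \<mu>. minimizing n u \<mu>"
proof (induction n)
  case 0 then show ?case by (simp add: minimizing_def ON_def)
next
  case (Suc n) then show ?case using minimizing_Suc by blast
qed

lemma eigen_quadratic: "eigen u m \<Longrightarrow> b u u = 1 \<Longrightarrow> q u u = m"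
  by (simp add: eigen_def)

lemma minimizing_mono: assumes "minimizing n u \<mu>" "i \<le> k" "k < n" shows "\<mu> i \<le> \<mu> k"
proof -
  have on: "ON n u" using assms by (simp add: minimizing_def)
  then have bk: "b (u k) (u k) = 1" "u k \<in> V" using assms by (auto simp: ON_def)
  have "\<mu> i * b (u k) (u k) \<le> q (u k) (u k)"
  proof -
    have "\<forall>l<i. b (u k) (u l) = 0" using on assms unfolding ON_def by auto
    moreover have "i < n" using assms by simp
    ultimately show ?thesis using assms(1) bk(2) unfolding minimizing_def by blast
  qed
  then show ?thesis using assms eigen_quadratic[of "u k" "\<mu> k"] bk by (simp add: minimizing_def)
qed

text \<open>With \<open>M\<close> the largest \<open>\<mu> k\<close>, splitting off the projection
  bounds \<open>q w w\<close> below by the sum of \<open>(\<mu> k - M) * (b w (u k))\<^sup>2\<close>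
  plus \<open>M * b w w\<close>. After summation over the \<open>v i\<close>, each nonpositive
  coefficient \<open>\<mu> k - M\<close> carries a weight that Bessel's inequality bounds by
  1.\<close>

lemma trace_inequality: assumes "minimizing n u \<mu>" "ON n v"
  shows "(\<Sum>i<n. \<mu> i) \<le> (\<Sum>i<n. q (v i) (v i))"
proof (cases n)
  case 0 then show ?thesis by simp
next
  case (Suc p)
  have on: "ON n u" using assms by (simp add: minimizing_def)
  define M where "M = \<mu> p"
  have le: "\<mu> k \<le> M" if "k < n" for k unfolding M_def using minimizing_mono[OF assms(1), of k p] that Suc by simp
  have low: "(\<Sum>k<n. (\<mu> k - M) * (b w (u k))\<^sup>2) + M * b w w \<le> q w w" if w: "w \<in> V" for w
  proof -
    let ?p = "proj n u w" let ?d = "\<lambda>x. w x - proj n u w x"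
    have pV: "?p \<in> V" and dV: "?d \<in> V" using proj_mem[OF on w] b.diff_mem[OF w] by auto
    have ei: "q (u k) y = \<mu> k * b (u k) y" if "k < n" "y \<in> V" for k y
      using assms that by (auto simp: minimizing_def eigen_def)
    have qp: "q ?p y = (\<Sum>k<n. \<mu> k * b w (u k) * b y (u k))" if "y \<in> V" for y
    proof -
      have "q ?p y = (\<Sum>i<n. b w (u i) * q (u i) y)"
        unfolding proj_def using on that by (intro q.sum_left) (auto simp: ON_mem)
      also have "\<dots> = (\<Sum>k<n. \<mu> k * b w (u k) * b y (u k))"
        using that on b.sym[OF that] by (intro sum.cong) (auto simp: ei ON_mem)
      finally show ?thesis .
    qed
    have "q ?p ?d = 0" using qp[OF dV] proj_orth[OF on w] by simp
    moreover have "q ?p w = (\<Sum>k<n. \<mu> k * (b w (u k))\<^sup>2)" using qp[OF w] by (simp add: power2_eq_square mult.assoc)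
    moreover have "q ?p ?d = q ?p w - q ?p ?p" using q.lin_right[OF w pV pV, of 1 "-1"] by simp
    ultimately have "q ?d ?d = q w w - (\<Sum>k<n. \<mu> k * (b w (u k))\<^sup>2)"
      using q.diff_quadratic[OF w pV] q.sym[OF w pV] by simp
    \<comment> \<open>The residual is orthogonal to all \<open>n\<close> functions, in particular to
      the first \<open>p\<close>, so minimality at the last index \<open>p\<close> applies.\<close>
    moreover have "M * b ?d ?d \<le> q ?d ?d"
      using assms(1) Suc dV proj_orth[OF on w] unfolding minimizing_def M_def by auto
    ultimately show ?thesis
      using proj_diff_norm[OF on w] by (simp add: algebra_simps sum_subtractf sum_distrib_left)
  qed
  have vV: "v i \<in> V" "b (v i) (v i) = 1" if "i < n" for i using assms(2) that by (auto simp: ON_def)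
  have "(\<Sum>i<n. \<mu> i) = (\<Sum>k<n. (\<mu> k - M) * 1) + (\<Sum>i<n. M)"
    by (simp add: sum_subtractf)
  also have "\<dots> \<le> (\<Sum>k<n. (\<mu> k - M) * (\<Sum>i<n. (b (v i) (u k))\<^sup>2)) + (\<Sum>i<n. M)"
  proof (intro add_mono order_refl sum_mono mult_left_mono_neg)
    fix k assume k: "k \<in> {..<n}"
    have "(\<Sum>i<n. (b (v i) (u k))\<^sup>2) = (\<Sum>i<n. (b (u k) (v i))\<^sup>2)"
      using k on vV by (intro sum.cong) (auto simp: ON_mem b.sym)
    also have "\<dots> \<le> b (u k) (u k)" using Bessel[OF assms(2) ON_mem[OF on]] k by auto
    finally show "(\<Sum>i<n. (b (v i) (u k))\<^sup>2) \<le> 1" using on k by (simp add: ON_def)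
    show "\<mu> k - M \<le> 0" using le k by simp
  qed
  also have "\<dots> = (\<Sum>i<n. (\<Sum>k<n. (\<mu> k - M) * (b (v i) (u k))\<^sup>2) + M * b (v i) (v i))"
    using vV by (subst sum.distrib, subst sum.swap) (simp add: sum_distrib_left)
  also have "\<dots> \<le> (\<Sum>i<n. q (v i) (v i))"
  proof (intro sum_mono)
    fix i assume "i \<in> {..<n}"
    then show "(\<Sum>k<n. (\<mu> k - M) * (b (v i) (u k))\<^sup>2) + M * b (v i) (v i) \<le> q (v i) (v i)"
      using low[of "v i"] vV by simp
  qed
  finally show ?thesis .
qed

text \<open>Shaped so that unfolding turns \<open>frac_eigenvalue\<close> into it literally. The
  index \<open>j\<close> counts from 1, whereas minimizing families are indexed from 0.\<close>

definition ev :: "nat \<Rightarrow> real" where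
  "ev j = Inf {lam. \<exists>f \<mu>. (\<forall>i<j. eigen (f i) (\<mu> i) \<and> \<mu> i \<le> lam) \<and>
      (\<forall>i<j. \<forall>k<j. b (f i) (f k) = (if i = k then 1 else 0))}"

text \<open>The minimizing family shows that \<open>\<mu> k\<close> is admissible. Conversely, among
  \<open>k + 1\<close> orthonormal eigenfunctions one has a nonzero residual after projection onto
  the first \<open>k\<close> functions \<open>u i\<close>; the Rayleigh quotient of this residual is
  still its eigenvalue, and minimality bounds it below by \<open>\<mu> k\<close>.\<close>

lemma ev_eq: assumes "minimizing n u \<mu>" "k < n" shows "ev (Suc k) = \<mu> k"
proof -
  have on: "ON n u" and eig: "\<And>i. i < n \<Longrightarrow> eigen (u i) (\<mu> i)" using assms by (auto simp: minimizing_def)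
  have on': "ON k u" using ON_mono[OF on] assms(2) by simp
  define L where "L = {lam. \<exists>f \<mu>. (\<forall>i<Suc k. eigen (f i) (\<mu> i) \<and> \<mu> i \<le> lam) \<and>
      (\<forall>i<Suc k. \<forall>l<Suc k. b (f i) (f l) = (if i = l then 1 else 0))}"
  have mem: "\<mu> k \<in> L" unfolding L_def
    using on assms(2) eig minimizing_mono[OF assms(1), of _ k]
    by (intro CollectI exI[of _ u] exI[of _ \<mu>]) (auto simp: ON_def)
  have low: "\<mu> k \<le> lam" if lam: "lam \<in> L" for lam
  proof (rule ccontr)
    assume "\<not> \<mu> k \<le> lam"
    then have less: "lam < \<mu> k" by simp
    obtain f \<nu> where f: "\<And>i. i < Suc k \<Longrightarrow> eigen (f i) (\<nu> i)" "\<And>i. i < Suc k \<Longrightarrow> \<nu> i \<le> lam"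
      "\<forall>i<Suc k. \<forall>l<Suc k. b (f i) (f l) = (if i = l then 1 else 0)"
      using lam unfolding L_def by blast
    have fON: "ON (Suc k) f" using f by (auto simp: ON_def eigen_def)
    then obtain i where i: "i < Suc k" and
      pos: "b (\<lambda>x. f i x - proj k u (f i) x) (\<lambda>x. f i x - proj k u (f i) x) > 0"
      using ON_family_not_in_span[OF on'] by auto
    let ?p = "proj k u (f i)" let ?d = "\<lambda>x. f i x - proj k u (f i) x"
    have fi: "f i \<in> V" using ON_mem[OF fON i] .
    have pV: "?p \<in> V" and dV: "?d \<in> V" using proj_mem[OF on' fi] b.diff_mem[OF fi] by auto
    have "q ?p ?d = (\<Sum>j<k. b (f i) (u j) * q (u j) ?d)"
      unfolding proj_def[of k u "f i", symmetric] using on' dV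
      by (subst proj_def, intro q.sum_left) (auto simp: ON_mem)
    also have "\<dots> = 0"
      using eig dV proj_orth[OF on' fi] assms(2) b.sym[OF dV ON_mem[OF on']]
      by (intro sum.neutral) (auto simp: eigen_def)
    finally have a: "q ?p ?d = 0" .
    have "b ?p ?d = 0" using b_proj[OF on' fi dV] proj_orth[OF on' fi] by simp
    then have "b ?d ?d = b (f i) ?d" using b.diff_left[OF fi pV dV] by simp
    moreover have "q ?d ?d = q (f i) ?d" using q.diff_left[OF fi pV dV] a by simp
    ultimately have "q ?d ?d = \<nu> i * b ?d ?d" using f(1)[OF i] dV by (simp add: eigen_def)
    moreover have "\<mu> k * b ?d ?d \<le> q ?d ?d"
      using assms dV proj_orth[OF on' fi] unfolding minimizing_def by auto
    ultimately have "\<mu> k \<le> \<nu> i" using pos by simp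
    then show False using f(2)[OF i] less by simp
  qed
  have "Inf L = \<mu> k" by (rule cInf_eq_minimum[OF mem low])
  then show ?thesis unfolding ev_def L_def .
qed

theorem eigenvalue_sum_attained:
  "\<exists>u. ON n u \<and> (\<Sum>j=1..n. ev j) = (\<Sum>i<n. q (u i) (u i))"
proof -
  obtain u \<mu> where m: "minimizing n u \<mu>" using minimizing_exists by blast
  then have on: "ON n u" by (simp add: minimizing_def)
  have "(\<Sum>j=1..n. ev j) = (\<Sum>i<n. ev (Suc i))" by (simp add: sum.atLeast1_atMost_eq)
  also have "\<dots> = (\<Sum>i<n. q (u i) (u i))"
    using m on ev_eq[OF m] by (intro sum.cong) (auto simp: minimizing_def ON_def intro!: eigen_quadratic[symmetric])
  finally show ?thesis using on by blast
qed

theorem eigenvalue_sum_le: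
  assumes "ON n v" shows "(\<Sum>j=1..n. ev j) \<le> (\<Sum>i<n. q (v i) (v i))"
proof -
  obtain u \<mu> where m: "minimizing n u \<mu>" using minimizing_exists by blast
  have "(\<Sum>j=1..n. ev j) = (\<Sum>i<n. ev (Suc i))" by (simp add: sum.atLeast1_atMost_eq)
  also have "\<dots> = (\<Sum>i<n. \<mu> i)" using ev_eq[OF m] by simp
  finally show ?thesis using trace_inequality[OF m assms] by simp
qed

end

section \<open>Linear changes of variables\<close>

lemma nn_integral_lborel_shift:
  fixes f :: "'a::euclidean_space \<Rightarrow> ennreal"
  assumes [measurable]: "f \<in> borel_measurable borel"
  shows "(\<integral>\<^sup>+x. f (t + x) \<partial>lborel) = (\<integral>\<^sup>+x. f x \<partial>lborel)"
proof -
  have "(\<integral>\<^sup>+x. f x \<partial>lborel) = (\<integral>\<^sup>+x. f x \<partial>distr lborel borel ((+) t))" by (simp add: lborel_distr_plus)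
  also have "\<dots> = (\<integral>\<^sup>+x. f (t + x) \<partial>lborel)" by (subst nn_integral_distr) auto
  finally show ?thesis by simp
qed

lemma nn_integral_lborel_scale:
  fixes f :: "'a::euclidean_space \<Rightarrow> ennreal"
  assumes [measurable]: "f \<in> borel_measurable borel" and "c \<noteq> 0"
  shows "(\<integral>\<^sup>+x. f x \<partial>lborel) = ennreal (\<bar>c\<bar> ^ DIM('a)) * (\<integral>\<^sup>+x. f (c *\<^sub>R x) \<partial>lborel)"
  using assms(2)
  by (subst lborel_affine[of c 0]) (simp_all add: nn_integral_density nn_integral_distr nn_integral_cmult ennreal_power)

text \<open>Uniqueness of Haar measure: by Tonelli and translation invariance,
  \<open>\<integral>f(Lx)dx \<integral>g = \<integral>f \<integral>g(Lx)dx\<close>; the constant is read off from the unit box \<open>g\<close>.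
  The determinant never enters.\<close>

lemma nn_integral_lborel_linear:
  fixes L :: "'a::euclidean_space \<Rightarrow> 'a"
  assumes "linear L" "bij L"
  shows "\<exists>c>0. \<forall>f\<in>borel_measurable borel. (\<integral>\<^sup>+x. f (L x) \<partial>lborel) = ennreal c * (\<integral>\<^sup>+x. f x \<partial>lborel)"
proof -
  define K where "K = inv L"
  have K: "linear K" "\<And>x. L (K x) = x" "\<And>x. K (L x) = x"
    unfolding K_def using assms inj_linear_imp_inv_linear[of L]
    by (auto simp: bij_is_surj surj_f_inv_f bij_is_inj)
  have [measurable]: "L \<in> borel_measurable borel" "K \<in> borel_measurable borel"
    using assms(1) K(1) by (auto intro!: borel_measurable_continuous_onI linear_continuous_on simp: linear_conv_bounded_linear)
  have eq: "(\<integral>\<^sup>+x. f (L x) \<partial>lborel) * (\<integral>\<^sup>+x. g x \<partial>lborel) = (\<integral>\<^sup>+x. f x \<partial>lborel) * (\<integral>\<^sup>+x. g (L x) \<partial>lborel)"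
    if [measurable]: "f \<in> borel_measurable borel" "g \<in> borel_measurable borel" for f g :: "'a \<Rightarrow> ennreal"
  proof -
    have "(\<integral>\<^sup>+x. f (L x) \<partial>lborel) * (\<integral>\<^sup>+x. g x \<partial>lborel) = (\<integral>\<^sup>+x. f (L x) * (\<integral>\<^sup>+y. g (L x + y) \<partial>lborel) \<partial>lborel)"
      by (simp add: nn_integral_lborel_shift nn_integral_multc)
    also have "\<dots> = (\<integral>\<^sup>+x. \<integral>\<^sup>+y. f (L x) * g (L x + y) \<partial>lborel \<partial>lborel)"
      by (simp add: nn_integral_cmult)
    also have "\<dots> = (\<integral>\<^sup>+y. \<integral>\<^sup>+x. f (L x) * g (L x + y) \<partial>lborel \<partial>lborel)"
      by (rule lborel_pair.Fubini') simp
    also have "\<dots> = (\<integral>\<^sup>+y. \<integral>\<^sup>+x. f (L x + (-1) *\<^sub>R y) * g (L x) \<partial>lborel \<partial>lborel)"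
    proof (rule nn_integral_cong)
      \<comment> \<open>Translating \<open>x\<close> by \<open>- K y\<close> replaces
        \<open>L x\<close> by \<open>L x - y\<close> and \<open>L x + y\<close> by
        \<open>L x\<close>.\<close>
      fix y :: 'a
      have "(\<integral>\<^sup>+x. f (L x) * g (L x + y) \<partial>lborel) = (\<integral>\<^sup>+x. f (L (- K y + x)) * g (L (- K y + x) + y) \<partial>lborel)"
        by (rule nn_integral_lborel_shift[symmetric]) simp
      then show "(\<integral>\<^sup>+x. f (L x) * g (L x + y) \<partial>lborel) = (\<integral>\<^sup>+x. f (L x + (-1) *\<^sub>R y) * g (L x) \<partial>lborel)"
        using assms(1) K by (simp add: linear_add linear_neg linear_diff algebra_simps)
    qed
    also have "\<dots> = (\<integral>\<^sup>+x. \<integral>\<^sup>+y. f (L x + (-1) *\<^sub>R y) * g (L x) \<partial>lborel \<partial>lborel)"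
      by (rule lborel_pair.Fubini') simp
    also have "\<dots> = (\<integral>\<^sup>+x. (\<integral>\<^sup>+y. f (L x + y) \<partial>lborel) * g (L x) \<partial>lborel)"
      using nn_integral_lborel_scale[of "\<lambda>y. f (L _ + y)" "-1"] by (simp add: nn_integral_multc)
    also have "\<dots> = (\<integral>\<^sup>+x. f x \<partial>lborel) * (\<integral>\<^sup>+x. g (L x) \<partial>lborel)"
      by (simp add: nn_integral_lborel_shift nn_integral_cmult)
    finally show ?thesis .
  qed
  define B :: "'a set" where "B = box 0 One"
  have [measurable]: "B \<in> sets borel" by (simp add: B_def)
  have B1: "(\<integral>\<^sup>+x. indicator B x \<partial>lborel) = 1"
    by (simp add: B_def emeasure_lborel_box_eq)
  define C where "C = (\<integral>\<^sup>+x. indicator B (L x) \<partial>lborel)"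
  have Ceq: "(\<integral>\<^sup>+x. f (L x) \<partial>lborel) = C * (\<integral>\<^sup>+x. f x \<partial>lborel)" if [measurable]: "f \<in> borel_measurable borel" for f
    using eq[of f "indicator B"] B1 by (simp add: C_def mult.commute)
  have "C = (\<integral>\<^sup>+x. indicator (K ` B) x \<partial>lborel)"
    unfolding C_def by (rule nn_integral_cong) (metis K(2,3) image_iff indicator_simps)
  also have "\<dots> = emeasure lborel (K ` B)"
  proof (rule nn_integral_indicator)
    have "K ` B = L -` B" using K by (auto simp: image_iff) metis
    also have "L -` B \<in> sets borel" using measurable_sets[of L borel borel B] by simp
    finally show "K ` B \<in> sets lborel" by simp
  qed
  also have "\<dots> < \<infinity>" unfolding B_def using K(1)
    by (intro emeasure_bounded_finite bounded_linear_image) (auto simp: linear_conv_bounded_linear)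
  finally have fin: "C < \<infinity>" .
  \<comment> \<open>For the constant function 1 the identity would otherwise read infinity =
    0.\<close>
  have "C \<noteq> 0"
  proof
    assume "C = 0"
    then show False using Ceq[of "\<lambda>_. 1"] by simp
  qed
  then show ?thesis using fin Ceq
    by (intro exI[of _ "enn2real C"]) (auto simp: enn2real_positive_iff less_top zero_less_iff_neq_zero)
qed

section \<open>Linear substitutions for the completed Lebesgue measure\<close>

lemma integrable_scaleR_iff:
  fixes f :: "'a \<Rightarrow> 'b::{banach, second_countable_topology}"
  assumes "c \<noteq> 0" shows "integrable M (\<lambda>x. c *\<^sub>R f x) \<longleftrightarrow> integrable M f"
  using assms integrable_scaleR_right[of "1 / c" M "\<lambda>x. c *\<^sub>R f x"] by auto

text \<open>Borel measurability of \<open>L\<close> is not enough on the completed sigma-algebra: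
  preimages of null sets have to be null. This follows from the Borel identity with
  \<open>c > 0\<close>, after which the two completions can be compared.\<close>

lemma distr_lebesgue_linear:
  fixes L :: "'a::euclidean_space \<Rightarrow> 'a"
  assumes "linear L" "bij L"
  shows "L \<in> lebesgue \<rightarrow>\<^sub>M lebesgue"
    and "\<exists>c>0. distr lebesgue lebesgue L = density lebesgue (\<lambda>_. ennreal c)"
proof -
  obtain c where c: "c > 0" and
    nn: "\<And>f. f\<in>borel_measurable borel \<Longrightarrow> (\<integral>\<^sup>+x. f (L x) \<partial>lborel) = ennreal c * (\<integral>\<^sup>+x. f x \<partial>lborel)"
    using nn_integral_lborel_linear[OF assms] by auto
  have [measurable]: "L \<in> borel_measurable borel"
    using assms(1) by (auto intro!: borel_measurable_continuous_onI linear_continuous_on simp: linear_conv_bounded_linear)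
  have Ll[measurable]: "L \<in> lebesgue \<rightarrow>\<^sub>M borel" by (rule measurable_completion) simp
  have d: "distr lborel lborel L = density lborel (\<lambda>_. ennreal c)"
  proof (rule measure_eqI)
    fix A :: "'a set" assume "A \<in> sets (distr lborel lborel L)"
    then have [measurable]: "A \<in> sets borel" by simp
    have "emeasure (distr lborel lborel L) A = (\<integral>\<^sup>+x. indicator A x \<partial>distr lborel lborel L)" by simp
    also have "\<dots> = (\<integral>\<^sup>+x. indicator A (L x) \<partial>lborel)" by (subst nn_integral_distr) auto
    also have "\<dots> = ennreal c * emeasure lborel A" by (subst nn) auto
    finally show "emeasure (distr lborel lborel L) A = emeasure (density lborel (\<lambda>_. ennreal c)) A"
      by (simp add: emeasure_density_const)
  qed simp
  have dl: "distr lebesgue lborel L = density lborel (\<lambda>_. ennreal c)"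
    by (subst distr_completion) (auto simp: d)
  have eq: "null_sets lborel = null_sets (distr lebesgue lborel L)"
    using c unfolding dl by (auto simp: null_sets_def emeasure_density_const)
  show "L \<in> lebesgue \<rightarrow>\<^sub>M lebesgue"
    by (simp add: completion.measurable_completion2 eq measurable_completion)
  have "density lebesgue (\<lambda>_. ennreal c) = completion (density lborel (\<lambda>_. ennreal c))"
    using c by (intro completion_density_eq[symmetric]) auto
  also have "\<dots> = completion (distr lebesgue lborel L)" by (simp add: dl)
  also have "\<dots> = distr lebesgue lebesgue L"
    by (subst completion.completion_distr_eq) (auto simp: eq measurable_completion)
  finally show "\<exists>c>0. distr lebesgue lebesgue L = density lebesgue (\<lambda>_. ennreal c)"
    using c by (intro exI[of _ c]) auto
qed

text \<open>The factor in \<integral> f(Lx) dx = \<open>jac L\<close> \<integral> f(x) dx, that is 1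
  / |det L|. Selecting it by choice keeps determinants out of all computations.\<close>

definition jac :: "('a::euclidean_space \<Rightarrow> 'a) \<Rightarrow> real" where
  "jac L = (SOME c. c > 0 \<and> distr lebesgue lebesgue L = density lebesgue (\<lambda>_. ennreal c))"

context
  fixes L :: "'a::euclidean_space \<Rightarrow> 'a"
  assumes L: "linear L" "bij L"
begin

lemma jac: "jac L > 0" "distr lebesgue lebesgue L = density lebesgue (\<lambda>_. ennreal (jac L))"
  using someI_ex[OF distr_lebesgue_linear(2)[OF L]] unfolding jac_def by auto

lemma integrable_lebesgue_linear:
  fixes f :: "'a \<Rightarrow> 'b::{banach, second_countable_topology}"
  assumes "f \<in> borel_measurable lebesgue"
  shows "integrable lebesgue (\<lambda>x. f (L x)) \<longleftrightarrow> integrable lebesgue f"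
proof -
  have "integrable lebesgue (\<lambda>x. f (L x)) \<longleftrightarrow> integrable (distr lebesgue lebesgue L) f"
    using assms distr_lebesgue_linear(1)[OF L] by (subst integrable_distr_eq) auto
  also have "\<dots> \<longleftrightarrow> integrable lebesgue f"
    unfolding jac(2) using assms jac(1)
      integrable_scaleR_iff[of "jac L" lebesgue f]
    by (subst integrable_density) auto
  finally show ?thesis .
qed

lemma integral_lebesgue_linear:
  fixes f :: "'a \<Rightarrow> 'b::{banach, second_countable_topology}"
  assumes "f \<in> borel_measurable lebesgue"
  shows "(LINT x|lebesgue. f (L x)) = jac L *\<^sub>R (LINT x|lebesgue. f x)"
proof -
  have "(LINT x|lebesgue. f (L x)) = (LINT x|distr lebesgue lebesgue L. f x)"
    using assms distr_lebesgue_linear(1)[OF L] by (subst integral_distr) auto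
  also have "\<dots> = jac L *\<^sub>R (LINT x|lebesgue. f x)"
    unfolding jac(2) using assms jac(1) by (subst integral_density) auto
  finally show ?thesis .
qed

end

section \<open>Translations, dilations, and continuity of translation in L1\<close>

lemma integral_lborel_shift:
  fixes f :: "'a::euclidean_space \<Rightarrow> 'b::{banach, second_countable_topology}"
  assumes [measurable]: "f \<in> borel_measurable borel"
  shows "integrable lborel (\<lambda>x. f (x + t)) \<longleftrightarrow> integrable lborel f"
    and "(LINT x|lborel. f (x + t)) = (LINT x|lborel. f x)"
proof -
  have "integrable lborel f \<longleftrightarrow> integrable (distr lborel borel ((+) t)) f" by (simp add: lborel_distr_plus)
  then show "integrable lborel (\<lambda>x. f (x + t)) \<longleftrightarrow> integrable lborel f"
    by (subst (asm) integrable_distr_eq) (auto simp: add.commute)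
  have "integral\<^sup>L lborel f = integral\<^sup>L (distr lborel borel ((+) t)) f" by (simp add: lborel_distr_plus)
  then show "(LINT x|lborel. f (x + t)) = (LINT x|lborel. f x)"
    by (subst (asm) integral_distr) (auto simp: add.commute)
qed

lemma integral_lborel_scale:
  fixes f :: "'a::euclidean_space \<Rightarrow> 'b::{banach, second_countable_topology}"
  assumes [measurable]: "f \<in> borel_measurable borel" and c: "c \<noteq> 0"
  shows "integrable lborel (\<lambda>x. f (c *\<^sub>R x)) \<longleftrightarrow> integrable lborel f"
    and "(LINT x|lborel. f (c *\<^sub>R x)) = (1 / \<bar>c\<bar> ^ DIM('a)) *\<^sub>R (LINT x|lborel. f x)"
proof -
  have eq: "(lborel :: 'a measure) = density (distr lborel borel (\<lambda>x. c *\<^sub>R x)) (\<lambda>_. ennreal (\<bar>c\<bar>^DIM('a)))"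
    using lborel_affine[OF c, of "0::'a"] by (simp add: ennreal_power[symmetric])
  have "integrable lborel f \<longleftrightarrow> integrable (density (distr lborel borel (\<lambda>x. c *\<^sub>R x)) (\<lambda>_. ennreal (\<bar>c\<bar>^DIM('a)))) f"
    using eq by simp
  then show "integrable lborel (\<lambda>x. f (c *\<^sub>R x)) \<longleftrightarrow> integrable lborel f"
    using c by (simp add: integrable_density integrable_distr_eq integrable_scaleR_iff)
  have "integral\<^sup>L lborel f = integral\<^sup>L (density (distr lborel borel (\<lambda>x. c *\<^sub>R x)) (\<lambda>_. ennreal (\<bar>c\<bar>^DIM('a)))) f"
    using eq by simp
  also have "\<dots> = \<bar>c\<bar>^DIM('a) *\<^sub>R (LINT x|lborel. f (c *\<^sub>R x))"
    using c by (simp add: integral_density integral_distr)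
  finally show "(LINT x|lborel. f (c *\<^sub>R x)) = (1 / \<bar>c\<bar> ^ DIM('a)) *\<^sub>R (LINT x|lborel. f x)"
    using c by simp
qed

text \<open>Open sets suffice by outer regularity; for an open set \<open>U\<close>,
  \<open>1\<^sub>U(x + h k) \<longrightarrow> 1\<^sub>U(x)\<close> at every \<open>x \<in> U\<close>.\<close>

lemma L1_translation_continuous:
  fixes f :: "'a::euclidean_space \<Rightarrow> real"
  assumes f: "integrable lborel f" and h: "h \<longlonglongrightarrow> 0"
  shows "(\<lambda>k. LINT x|lborel. \<bar>f (x + h k) - f x\<bar>) \<longlonglongrightarrow> 0"
proof -
  define P where "P f \<longleftrightarrow> (\<lambda>k. LINT x|lborel. \<bar>f (x + h k) - f x\<bar>) \<longlonglongrightarrow> 0" for f :: "'a \<Rightarrow> real"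
  have tr: "integrable lborel (\<lambda>x. f (x + t))" if "integrable lborel f" for f :: "'a \<Rightarrow> real" and t
    using integral_lborel_shift(1)[of f t] that by simp
  \<comment> \<open>The class of functions with property \<open>P\<close> is closed in L1: a
    three-epsilon argument in which the translated error has the same integral as the error
    itself.\<close>
  have approx: "P f" if f: "integrable lborel f" and
     g: "\<And>e. e > 0 \<Longrightarrow> \<exists>g. integrable lborel g \<and> P g \<and> (LINT x|lborel. \<bar>f x - g x\<bar>) < e" for f
    unfolding P_def
  proof (rule LIMSEQ_I)
    fix e :: real assume e: "e > 0"
    obtain g where g: "integrable lborel g" "P g" "(LINT x|lborel. \<bar>f x - g x\<bar>) < e / 3"
      using g[of "e/3"] e by auto
    have [measurable]: "f \<in> borel_measurable borel" "g \<in> borel_measurable borel" using f g by auto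
    obtain N where N: "\<And>k. k \<ge> N \<Longrightarrow> norm ((LINT x|lborel. \<bar>g (x + h k) - g x\<bar>) - 0) < e / 3"
      using LIMSEQ_D[of _ 0 "e/3"] g(2) e unfolding P_def by (meson divide_pos_pos zero_less_numeral)
    have "norm ((LINT x|lborel. \<bar>f (x + h k) - f x\<bar>) - 0) < e" if k: "k \<ge> N" for k
    proof -
      have "(LINT x|lborel. \<bar>f (x + h k) - f x\<bar>) \<le>
          (LINT x|lborel. \<bar>f (x + h k) - g (x + h k)\<bar> + \<bar>g (x + h k) - g x\<bar> + \<bar>f x - g x\<bar>)"
        using f g by (intro integral_mono integrable_abs Bochner_Integration.integrable_add 
             Bochner_Integration.integrable_diff tr) auto
      also have "\<dots> = (LINT x|lborel. \<bar>f (x + h k) - g (x + h k)\<bar>) + (LINT x|lborel. \<bar>g (x + h k) - g x\<bar>)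
           + (LINT x|lborel. \<bar>f x - g x\<bar>)"
        using f g tr[of f "h k"] tr[of g "h k"] by simp
      also have "(LINT x|lborel. \<bar>f (x + h k) - g (x + h k)\<bar>) = (LINT x|lborel. \<bar>f x - g x\<bar>)"
        by (rule integral_lborel_shift(2)) simp
      finally show ?thesis using g(3) N[OF k] by simp
    qed
    then show "\<exists>N. \<forall>k\<ge>N. norm ((LINT x|lborel. \<bar>f (x + h k) - f x\<bar>) - 0) < e" by blast
  qed
  have op: "P (indicator U)" if U: "open U" "emeasure lborel U < \<infinity>" for U :: "'a set"
  proof -
    have [measurable]: "U \<in> sets borel" using U by simp
    have iU: "integrable lborel (indicator U :: 'a \<Rightarrow> real)" using U by simp
    have iUU: "integrable lborel (\<lambda>x. indicator U (x + h k) * indicator U x :: real)" for k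
      by (rule Bochner_Integration.integrable_bound[OF iU]) (auto simp: indicator_def)
    \<comment> \<open>The factor \<open>indicator U x\<close> confines the limit to points of
      \<open>U\<close>; on the boundary of \<open>U\<close> the translates alone need not
      converge.\<close>
    have "(\<lambda>k. LINT x|lborel. indicator U (x + h k) * indicator U x :: real) \<longlonglongrightarrow> (LINT x|lborel. indicator U x)"
    proof (rule integral_dominated_convergence[where w="indicator U"])
      have "(\<lambda>k. indicator U (x + h k) * indicator U x :: real) \<longlonglongrightarrow> indicator U x" for x
      proof (cases "x \<in> U")
        case True
        have "(\<lambda>k. x + h k) \<longlonglongrightarrow> x + 0" by (intro tendsto_intros h)
        then have "\<forall>\<^sub>F k in sequentially. x + h k \<in> U"
          using topological_tendstoD[OF _ U(1), of "\<lambda>k. x + h k" x sequentially] True by simp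
        then have "\<forall>\<^sub>F k in sequentially. indicator U (x + h k) * indicator U x = (indicator U x :: real)"
          by eventually_elim (use True in auto)
        then show ?thesis by (rule tendsto_eventually)
      qed simp
      then show "AE x in lborel. (\<lambda>k. indicator U (x + h k) * indicator U x :: real) \<longlonglongrightarrow> indicator U x" by simp
    qed (use iU in \<open>auto simp: indicator_def\<close>)
    then have "(\<lambda>k. 2 * (LINT x|lborel. indicator U x) - 2 * (LINT x|lborel. indicator U (x + h k) * indicator U x :: real))
        \<longlonglongrightarrow> 2 * (LINT x|lborel. indicator U x) - 2 * (LINT x|lborel. indicator U x)"
      by (intro tendsto_intros)
    moreover have "(LINT x|lborel. \<bar>indicator U (x + h k) - indicator U x :: real\<bar>) =
        2 * (LINT x|lborel. indicator U x) - 2 * (LINT x|lborel. indicator U (x + h k) * indicator U x)" for k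
    proof -
      have "(LINT x|lborel. \<bar>indicator U (x + h k) - indicator U x :: real\<bar>) = 
        (LINT x|lborel. indicator U (x + h k) + indicator U x - 2 * (indicator U (x + h k) * indicator U x :: real))"
        by (rule Bochner_Integration.integral_cong) (auto simp: indicator_def)
      also have "\<dots> = (LINT x|lborel. indicator U (x + h k)) + (LINT x|lborel. indicator U x)
         - 2 * (LINT x|lborel. indicator U (x + h k) * indicator U x :: real)"
        using iUU[of k] tr[OF iU, of "h k"] iU by simp
      also have "(LINT x|lborel. indicator U (x + h k)) = (LINT x|lborel. indicator U x :: real)"
        by (rule integral_lborel_shift(2)) simp
      finally show ?thesis by simp
    qed
    ultimately show ?thesis unfolding P_def by simp
  qed
  have ind: "P (indicator A)" if A: "A \<in> sets borel" "emeasure lborel A < \<infinity>" for A :: "'a set"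
  proof (rule approx)
    have [measurable]: "A \<in> sets borel" using A by simp
    show iA: "integrable lborel (indicator A :: 'a \<Rightarrow> real)" using A by simp
    fix e :: real assume e: "e > 0"
    obtain U where U: "open U" "A \<subseteq> U" "emeasure lborel (U - A) < e"
      using outer_regular_lborel[OF A(1) e] by blast
    have [measurable]: "U \<in> sets borel" using U by simp
    have UA: "emeasure lborel U = emeasure lborel A + emeasure lborel (U - A)"
      using U(2) by (subst plus_emeasure) (auto intro!: arg_cong2[of _ _ _ _ emeasure])
    have fin: "emeasure lborel (U - A) < \<infinity>" "emeasure lborel U < \<infinity>"
      using U(3) A(2) UA by (auto simp: less_top[symmetric] top_unique)
    have "(LINT x|lborel. \<bar>indicator A x - indicator U x :: real\<bar>) = (LINT x|lborel. indicator (U - A) x)"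
      using U(2) by (intro Bochner_Integration.integral_cong) (auto simp: indicator_def)
    also have "\<dots> = measure lborel (U - A)" by simp
    also have "\<dots> < e" using U(3) e fin(1) by (simp add: emeasure_eq_ennreal_measure less_top ennreal_less_iff)
    finally show "\<exists>g. integrable lborel g \<and> P g \<and> (LINT x|lborel. \<bar>indicator A x - g x\<bar>) < e"
      using op[OF U(1) fin(2)] fin(2) by (intro exI[of _ "indicator U"]) auto
  qed
  show ?thesis using f unfolding P_def[symmetric]
  proof (induction rule: integrable_induct)
    case (base A c)
    then have "(\<lambda>k. \<bar>c\<bar> * (LINT x|lborel. \<bar>indicator A (x + h k) - indicator A x :: real\<bar>)) \<longlonglongrightarrow> \<bar>c\<bar> * 0"
      using ind[of A] unfolding P_def by (intro tendsto_intros) auto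
    moreover have "\<bar>indicator A (x + h k) * c - indicator A x * c\<bar> = \<bar>c\<bar> * \<bar>indicator A (x + h k) - indicator A x :: real\<bar>" for k x
      by (simp add: abs_mult[symmetric] algebra_simps)
    ultimately show ?case unfolding P_def by simp
  next
    case (add f g)
    have l: "(\<lambda>k. (LINT x|lborel. \<bar>f (x + h k) - f x\<bar>) + (LINT x|lborel. \<bar>g (x + h k) - g x\<bar>)) \<longlonglongrightarrow> 0 + 0"
      using add unfolding P_def by (intro tendsto_intros)
    have "norm (LINT x|lborel. \<bar>(f (x + h k) + g (x + h k)) - (f x + g x)\<bar>) \<le> 
       (LINT x|lborel. \<bar>f (x + h k) - f x\<bar>) + (LINT x|lborel. \<bar>g (x + h k) - g x\<bar>)" for k
    proof -
      have "(LINT x|lborel. \<bar>(f (x + h k) + g (x + h k)) - (f x + g x)\<bar>) \<le> 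
        (LINT x|lborel. \<bar>f (x + h k) - f x\<bar> + \<bar>g (x + h k) - g x\<bar>)"
        using add by (intro integral_mono integrable_abs Bochner_Integration.integrable_add 
             Bochner_Integration.integrable_diff tr) auto
      also have "\<dots> = (LINT x|lborel. \<bar>f (x + h k) - f x\<bar>) + (LINT x|lborel. \<bar>g (x + h k) - g x\<bar>)"
        using add by (intro Bochner_Integration.integral_add integrable_abs Bochner_Integration.integrable_diff tr)
      finally show ?thesis by simp
    qed
    then show ?case unfolding P_def
      by (rule Lim_null_comparison[OF always_eventually[OF allI]]) (use l in simp)
  next
    case (lim f s)
    have [measurable]: "f \<in> borel_measurable borel" "\<And>i. s i \<in> borel_measurable borel" using lim by auto
    show ?case
    proof (rule approx[OF lim(4)])
      fix e :: real assume e: "e > 0"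
      have "(\<lambda>i. LINT x|lborel. \<bar>f x - s i x\<bar>) \<longlonglongrightarrow> (LINT x|(lborel :: 'a measure). 0)"
      proof (rule integral_dominated_convergence[where w="\<lambda>x. 3 * \<bar>f x\<bar>"])
        show "AE x in lborel. (\<lambda>i. \<bar>f x - s i x\<bar>) \<longlonglongrightarrow> 0"
        proof (rule AE_I2)
          fix x assume "x \<in> space (lborel :: 'a measure)"
          then have "(\<lambda>i. \<bar>f x - s i x\<bar>) \<longlonglongrightarrow> \<bar>f x - f x\<bar>" by (intro tendsto_intros lim(2))
          then show "(\<lambda>i. \<bar>f x - s i x\<bar>) \<longlonglongrightarrow> 0" by simp
        qed
        show "AE x in lborel. norm \<bar>f x - s i x\<bar> \<le> 3 * \<bar>f x\<bar>" for i
        proof (rule AE_I2)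
          fix x assume "x \<in> space (lborel :: 'a measure)"
          then show "norm \<bar>f x - s i x\<bar> \<le> 3 * \<bar>f x\<bar>" using lim(3)[of x i] by simp
        qed
      qed (use lim(4) in auto)
      then have "\<forall>\<^sub>F i in sequentially. (LINT x|lborel. \<bar>f x - s i x\<bar>) < e"
        using e by (intro order_tendstoD) auto
      then obtain i where "(LINT x|lborel. \<bar>f x - s i x\<bar>) < e"
        using eventually_happens'[OF sequentially_bot] by blast
      then show "\<exists>g. integrable lborel g \<and> P g \<and> (LINT x|lborel. \<bar>f x - g x\<bar>) < e"
        using lim by blast
    qed
  qed
qed

section \<open>Plancherel's identity\<close>

lemma lborel_integral_prod:
  fixes f :: "'a::euclidean_space \<Rightarrow> real \<Rightarrow> 'b::{real_normed_field,banach,second_countable_topology}"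
  assumes f: "\<And>b. b \<in> Basis \<Longrightarrow> integrable lborel (f b)"
  shows "integrable lborel (\<lambda>x::'a. \<Prod>b\<in>Basis. f b (x \<bullet> b))" (is ?I)
    and "(LINT x|(lborel :: 'a measure). (\<Prod>b\<in>Basis. f b (x \<bullet> b))) = (\<Prod>b\<in>Basis. LINT t|lborel. f b t)" (is ?E)
proof -
  interpret product_sigma_finite "\<lambda>_::'a. lborel :: real measure" ..
  have [measurable]: "\<And>b. b \<in> Basis \<Longrightarrow> f b \<in> borel_measurable borel" using f by auto
  have eq: "(\<Prod>b\<in>Basis. f b ((\<Sum>b\<in>Basis. x b *\<^sub>R b) \<bullet> b)) = (\<Prod>b\<in>Basis. f b (x b))" for x :: "'a \<Rightarrow> real"
    by (intro prod.cong refl) simp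
  have "integrable (\<Pi>\<^sub>M b\<in>Basis. lborel) (\<lambda>x. \<Prod>b\<in>(Basis::'a set). f b (x b))"
    by (rule product_integrable_prod) (use f in auto)
  then show ?I by (subst lborel_eq, subst integrable_distr_eq) (simp_all add: eq)
  have "(LINT x|(lborel :: 'a measure). (\<Prod>b\<in>Basis. f b (x \<bullet> b))) = (LINT x|(\<Pi>\<^sub>M b\<in>(Basis::'a set). lborel). (\<Prod>b\<in>Basis. f b (x b)))"
    by (subst lborel_eq, subst integral_distr) (simp_all add: eq)
  also have "\<dots> = (\<Prod>b\<in>Basis. LINT t|lborel. f b t)" by (rule product_integral_prod) (use f in auto)
  finally show ?E .
qed

section \<open>The Gaussian and its Fourier transform\<close>

lemma cis_measurable [measurable]: "cis \<in> borel_measurable borel"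
  by (intro borel_measurable_continuous_onI continuous_intros)

definition gau :: "'a::euclidean_space \<Rightarrow> real" where "gau x = exp (- (norm x)\<^sup>2 / 2)"

text \<open>Each factor is a centred normal density of standard deviation 1/(2 pi), so the product
  is (2 pi)^(d/2) exp(-2 pi^2 |x|^2). In this form positivity and total mass 1 come from the theory
  of normal densities.\<close>

definition gau_hat :: "'a::euclidean_space \<Rightarrow> real" where
  "gau_hat x = (\<Prod>b\<in>Basis. normal_density 0 (1 / (2 * pi)) (x \<bullet> b))"

lemma gau_measurable [measurable]: "gau \<in> borel_measurable borel"
  unfolding gau_def[abs_def] by measurable

lemma gau_hat_measurable [measurable]: "gau_hat \<in> borel_measurable borel"
  unfolding gau_hat_def[abs_def] by measurable

lemma gau_hat_nonneg: "0 \<le> gau_hat x" unfolding gau_hat_def by (intro prod_nonneg) auto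

lemma gau_prod: "gau (x::'a::euclidean_space) = (\<Prod>b\<in>Basis. exp (- (x \<bullet> b)\<^sup>2 / 2))"
proof -
  have "(norm x)\<^sup>2 = (\<Sum>b\<in>Basis. (x \<bullet> b)\<^sup>2)"
    by (subst power2_norm_eq_inner, subst euclidean_inner) (simp add: power2_eq_square)
  then show ?thesis unfolding gau_def
    by (simp add: exp_sum[symmetric] sum_negf sum_divide_distrib)
qed

lemma cis_inner: "cis (c * ((h::'a::euclidean_space) \<bullet> x)) = (\<Prod>b\<in>Basis. cis (c * (h \<bullet> b) * (x \<bullet> b)))"
proof -
  have "h \<bullet> x = (\<Sum>b\<in>Basis. (h \<bullet> b) * (x \<bullet> b))" by (rule euclidean_inner)
  then show ?thesis
    by (simp add: cis_conv_exp exp_sum[symmetric] sum_distrib_left mult.assoc)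
qed

text \<open>Up to the factor sqrt(2 pi) the integral is the characteristic function of the standard
  normal distribution at 2 pi t.\<close>

lemma gaussian_fourier_1:
  "integrable lborel (\<lambda>x. complex_of_real (exp (- x\<^sup>2 / 2)) * cis (2 * pi * t * x))" (is ?I)
  "(LINT x|lborel. complex_of_real (exp (- x\<^sup>2 / 2)) * cis (2 * pi * t * x))
     = complex_of_real (normal_density 0 (1 / (2 * pi)) t)" (is ?E)
proof -
  have d: "exp (- x\<^sup>2 / 2) = sqrt (2 * pi) * std_normal_density x" for x :: real
    by (simp add: std_normal_density_def)
  have i: "integrable lborel (\<lambda>x. std_normal_density x)" by simp
  have "integrable lborel (\<lambda>x. complex_of_real (exp (- x\<^sup>2 / 2)))"
    unfolding d using i by (intro integrable_of_real) simp
  then show ?I by (rule Bochner_Integration.integrable_bound) (auto simp: norm_mult)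
  have "(LINT x|lborel. complex_of_real (exp (- x\<^sup>2 / 2)) * cis (2 * pi * t * x)) =
     (LINT x|lborel. complex_of_real (sqrt (2 * pi)) * (std_normal_density x *\<^sub>R iexp (2 * pi * t * x)))"
    unfolding d by (intro Bochner_Integration.integral_cong) (auto simp: cis_conv_exp scaleR_conv_of_real)
  also have "\<dots> = complex_of_real (sqrt (2 * pi)) * (LINT x|lborel. (std_normal_density x *\<^sub>R iexp (2 * pi * t * x)))"
    by (rule integral_mult_right_zero)
  also have "(LINT x|lborel. (std_normal_density x *\<^sub>R iexp (2 * pi * t * x))) = char std_normal_distribution (2 * pi * t)"
    unfolding char_def by (subst integral_density) auto
  also have "\<dots> = complex_of_real (exp (- ((2 * pi * t)\<^sup>2) / 2))" by (simp add: char_std_normal_distribution)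
  also have "complex_of_real (sqrt (2 * pi)) * \<dots> = complex_of_real (normal_density 0 (1 / (2 * pi)) t)"
  proof -
    have "2 * pi * (1 / (2 * pi))\<^sup>2 = 1 / (2 * pi)" by (simp add: power2_eq_square)
    then have "1 / sqrt (2 * pi * (1 / (2 * pi))\<^sup>2) = sqrt (2 * pi)" by (simp add: real_sqrt_divide)
    moreover have "- (t - 0)\<^sup>2 / (2 * (1 / (2 * pi))\<^sup>2) = - ((2 * pi * t)\<^sup>2) / 2"
      by (simp add: power2_eq_square field_simps)
    ultimately show ?thesis unfolding normal_density_def by simp
  qed
  finally show ?E .
qed

lemma gaussian_fourier:
  fixes h :: "'a::euclidean_space"
  shows "integrable lborel (\<lambda>x. complex_of_real (gau x) * cis (2 * pi * (h \<bullet> x)))"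
    and "(LINT x|lborel. complex_of_real (gau x) * cis (2 * pi * (h \<bullet> x))) = complex_of_real (gau_hat h)"
proof -
  have eq: "complex_of_real (gau x) * cis (2 * pi * (h \<bullet> x)) =
      (\<Prod>b\<in>Basis. complex_of_real (exp (- (x \<bullet> b)\<^sup>2 / 2)) * cis (2 * pi * (h \<bullet> b) * (x \<bullet> b)))" for x
    by (subst cis_inner, subst gau_prod) (simp add: prod.distrib)
  show "integrable lborel (\<lambda>x. complex_of_real (gau x) * cis (2 * pi * (h \<bullet> x)))"
    unfolding eq by (rule lborel_integral_prod(1)) (rule gaussian_fourier_1)
  show "(LINT x|lborel. complex_of_real (gau x) * cis (2 * pi * (h \<bullet> x))) = complex_of_real (gau_hat h)"
    unfolding eq
    by (subst lborel_integral_prod(2)[OF gaussian_fourier_1(1)])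
       (simp only: gaussian_fourier_1(2) gau_hat_def of_real_prod)
qed

lemma gau_hat_integral:
  "integrable lborel (gau_hat :: 'a::euclidean_space \<Rightarrow> real)" "(LINT x|(lborel :: 'a measure). gau_hat x) = 1"
  unfolding gau_hat_def[abs_def]
  by (rule lborel_integral_prod(1), simp)
     (subst lborel_integral_prod(2), auto)

lemma gau_scale_integrable:
  assumes "e > 0" shows "integrable lborel (\<lambda>x::'a::euclidean_space. gau (e *\<^sub>R x))"
proof -
  have "integrable lborel (\<lambda>x::'a. complex_of_real (gau x))" using gaussian_fourier(1)[of 0] by simp
  then have "integrable lborel (gau :: 'a \<Rightarrow> real)" by (simp add: complex_of_real_integrable_eq)
  then show ?thesis using integral_lborel_scale(1)[of "gau :: 'a \<Rightarrow> real" e] assms by simp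
qed

text \<open>\<open>fourier\<close> with Borel-Lebesgue measure in place of its completion, because
  Fubini and product measurability are at hand for \<open>lborel\<close>;
  \<open>fourier_eq_ft\<close> carries the results back.\<close>

definition ft :: "('a::euclidean_space \<Rightarrow> real) \<Rightarrow> 'a \<Rightarrow> complex" where
  "ft u \<xi> = (LINT x|lborel. complex_of_real (u x) * cis (- 2 * pi * (x \<bullet> \<xi>)))"

lemma ft_integrable:
  assumes "integrable lborel u"
  shows "integrable lborel (\<lambda>x. complex_of_real (u x) * cis (c * (x \<bullet> \<xi>)))"
  by (rule Bochner_Integration.integrable_bound[OF assms]) (use assms in \<open>auto simp: norm_mult\<close>)

lemma ft_measurable [measurable]:
  assumes [measurable]: "u \<in> borel_measurable borel" shows "ft u \<in> borel_measurable borel"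
  unfolding ft_def[abs_def] by measurable

lemma cnj_ft: 
  assumes "integrable lborel u"
  shows "cnj (ft u \<xi>) = (LINT x|lborel. complex_of_real (u x) * cis (2 * pi * (x \<bullet> \<xi>)))"
proof -
  have "cnj (ft u \<xi>) = (LINT x|lborel. cnj (complex_of_real (u x) * cis (- 2 * pi * (x \<bullet> \<xi>))))"
    unfolding ft_def by (rule Bochner_Integration.integral_cnj[symmetric])
  then show ?thesis by (simp add: cis_cnj)
qed

lemma norm_ft_le: "norm (ft u \<xi>) \<le> (LINT x|lborel. \<bar>u x\<bar>)"
  unfolding ft_def by (rule order_trans[OF integral_norm_bound]) (simp add: norm_mult)

section \<open>Autocorrelation and Plancherel's identity for bounded functions\<close>

context
  fixes u :: "'a::euclidean_space \<Rightarrow> real" and B :: real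
  assumes u: "integrable lborel u" and B: "\<And>x. \<bar>u x\<bar> \<le> B"
begin

text \<open>The Fourier transform of \<open>autocorr\<close> is the squared modulus of
  \<open>ft u\<close>, and \<open>autocorr 0\<close> is the integral of the square of
  \<open>u\<close>. Plancherel's identity thus becomes Fourier inversion at the single point 0, for
  which continuity at 0 suffices.\<close>

definition autocorr :: "'a \<Rightarrow> real" where "autocorr h = (LINT x|lborel. u x * u (x + h))"

lemma bounded_integrable_measurable [measurable]: "u \<in> borel_measurable borel" using u by auto

lemma autocorr_measurable [measurable]: "autocorr \<in> borel_measurable borel"
  unfolding autocorr_def[abs_def] by measurable

lemma integrable_translate: "integrable lborel (\<lambda>x. u (x + h))" "integrable lborel (\<lambda>x. u (h + x))"
   "(LINT x|lborel. \<bar>u (h + x)\<bar>) = (LINT x|lborel. \<bar>u x\<bar>)"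
  using u integral_lborel_shift(1)[of u h] integral_lborel_shift(2)[of "\<lambda>x. \<bar>u x\<bar>" h] by (auto simp: add.commute)

lemma bound_nonneg: "0 \<le> B" using B[of 0] by simp

lemma autocorr_integrand_integrable: "integrable lborel (\<lambda>x. u x * u (x + h))"
proof (rule Bochner_Integration.integrable_bound)
  show "integrable lborel (\<lambda>x. u x * B)" using u by simp
  show "AE x in lborel. norm (u x * u (x + h)) \<le> norm (u x * B)"
    using B bound_nonneg by (auto simp: abs_mult intro!: mult_left_mono)
qed measurable

lemma autocorr_pair_integrable:
  "integrable (lborel \<Otimes>\<^sub>M lborel) (\<lambda>(x, h). complex_of_real (u x * u (x + h)) * cis (2 * pi * (h \<bullet> \<xi>)))"
proof (rule lborel_pair.Fubini_integrable)
  have "(LINT h|lborel. norm (complex_of_real (u x * u (x + h)) * cis (2 * pi * (h \<bullet> \<xi>)))) = \<bar>u x\<bar> * (LINT h|lborel. \<bar>u h\<bar>)" for x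
    using integrable_translate(3)[of x] by (simp add: norm_mult abs_mult)
  then show "integrable lborel (\<lambda>x. LINT y|lborel. norm (case (x, y) of (x, h) \<Rightarrow> complex_of_real (u x * u (x + h)) * cis (2 * pi * (h \<bullet> \<xi>))))"
    using u by simp
  have "integrable lborel (\<lambda>h. complex_of_real (u x * u (x + h)) * cis (2 * pi * (h \<bullet> \<xi>)))" for x
    by (rule Bochner_Integration.integrable_bound[of _ "\<lambda>h. u x * u (x + h)"]) (use integrable_translate in \<open>auto simp: norm_mult\<close>)
  then show "AE x in lborel. integrable lborel (\<lambda>y. case (x, y) of (x, h) \<Rightarrow> complex_of_real (u x * u (x + h)) * cis (2 * pi * (h \<bullet> \<xi>)))"
    by simp
qed measurable

text \<open>Fubini at frequency 0, where the phase factor is 1.\<close>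

lemma autocorr_integrable: "integrable lborel autocorr"
proof -
  have "integrable lborel (\<lambda>h. LINT x|lborel. complex_of_real (u x * u (x + h)) * cis (2 * pi * (h \<bullet> 0)))"
    using lborel_pair.integrable_snd[OF autocorr_pair_integrable[of 0]] by simp
  then have "integrable lborel (\<lambda>h. complex_of_real (autocorr h))"
    unfolding autocorr_def by (simp del: of_real_mult)
  then show ?thesis by (simp add: complex_of_real_integrable_eq)
qed

lemma autocorr_bound: "\<bar>autocorr h\<bar> \<le> B * (LINT x|lborel. \<bar>u x\<bar>)"
proof -
  have "\<bar>autocorr h\<bar> \<le> (LINT x|lborel. \<bar>u x * u (x + h)\<bar>)" unfolding autocorr_def by (rule integral_abs_bound)
  also have "\<dots> \<le> (LINT x|lborel. B * \<bar>u x\<bar>)"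
    using u autocorr_integrand_integrable[of h] B
    by (intro integral_mono integrable_abs) (auto simp: abs_mult mult.commute[of B] intro!: mult_left_mono)
  finally show ?thesis by simp
qed

text \<open>The difference is at most \<open>B\<close> times the L1 distance between
  \<open>u\<close> and its translate, which is why the bounded case comes first.\<close>

lemma autocorr_continuous:
  assumes "h \<longlonglongrightarrow> 0" shows "(\<lambda>k. autocorr (h k)) \<longlonglongrightarrow> autocorr 0"
proof -
  have l: "(\<lambda>k. B * (LINT x|lborel. \<bar>u (x + h k) - u x\<bar>)) \<longlonglongrightarrow> B * 0"
    by (intro tendsto_intros L1_translation_continuous u assms)
  have "norm (autocorr (h k) - autocorr 0) \<le> B * (LINT x|lborel. \<bar>u (x + h k) - u x\<bar>)" for k
  proof -
    have i1: "integrable lborel (\<lambda>x. u (x + h k) - u x)" using integrable_translate(1) u by auto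
    have "autocorr (h k) - autocorr 0 = (LINT x|lborel. u x * u (x + h k) - u x * u (x + 0))"
      unfolding autocorr_def using autocorr_integrand_integrable by (subst Bochner_Integration.integral_diff) blast+
    also have "\<dots> = (LINT x|lborel. u x * (u (x + h k) - u x))" by (simp add: algebra_simps)
    finally have "norm (autocorr (h k) - autocorr 0) \<le> (LINT x|lborel. \<bar>u x * (u (x + h k) - u x)\<bar>)"
      by (simp only: real_norm_def) (rule integral_abs_bound)
    also have "\<dots> \<le> (LINT x|lborel. B * \<bar>u (x + h k) - u x\<bar>)"
    proof (rule integral_mono)
      have "integrable lborel (\<lambda>x. u x * u (x + h k) - u x * u (x + 0))"
        using autocorr_integrand_integrable by (intro Bochner_Integration.integrable_diff)
      then show "integrable lborel (\<lambda>x. \<bar>u x * (u (x + h k) - u x)\<bar>)" by (simp add: algebra_simps)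
      show "integrable lborel (\<lambda>x. B * \<bar>u (x + h k) - u x\<bar>)" using i1 by simp
      show "\<bar>u x * (u (x + h k) - u x)\<bar> \<le> B * \<bar>u (x + h k) - u x\<bar>" for x
        using B by (simp add: abs_mult mult_right_mono)
    qed
    finally show ?thesis by simp
  qed
  then have "(\<lambda>k. autocorr (h k) - autocorr 0) \<longlonglongrightarrow> 0"
    by (rule Lim_null_comparison[OF always_eventually[OF allI]]) (use l in simp)
  then show ?thesis by (simp add: LIM_zero_iff)
qed

text \<open>Fubini, then translation invariance in \<open>h\<close> for fixed \<open>x\<close>: the
  phase splits into one factor at \<open>x\<close> and one at \<open>x + h\<close>, so the double
  integral factors.\<close>

lemma ft_square_autocorr:
  "complex_of_real ((norm (ft u \<xi>))\<^sup>2) = (LINT h|lborel. complex_of_real (autocorr h) * cis (2 * pi * (h \<bullet> \<xi>)))"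
proof -
  have "(LINT h|lborel. complex_of_real (autocorr h) * cis (2 * pi * (h \<bullet> \<xi>))) =
     (LINT h|lborel. LINT x|lborel. complex_of_real (u x * u (x + h)) * cis (2 * pi * (h \<bullet> \<xi>)))"
    unfolding autocorr_def by (simp del: of_real_mult)
  also have "\<dots> = (LINT x|lborel. LINT h|lborel. complex_of_real (u x * u (x + h)) * cis (2 * pi * (h \<bullet> \<xi>)))"
    by (rule lborel_pair.Fubini_integral[OF autocorr_pair_integrable])
  also have "\<dots> = (LINT x|lborel. (complex_of_real (u x) * cis (- 2 * pi * (x \<bullet> \<xi>))) * cnj (ft u \<xi>))"
  proof (rule Bochner_Integration.integral_cong[OF refl])
    fix x
    have "(LINT h|lborel. complex_of_real (u x * u (x + h)) * cis (2 * pi * (h \<bullet> \<xi>))) =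
      (LINT h|lborel. (complex_of_real (u x) * cis (- 2 * pi * (x \<bullet> \<xi>))) * 
           (complex_of_real (u (h + x)) * cis (2 * pi * ((h + x) \<bullet> \<xi>))))"
    proof (rule Bochner_Integration.integral_cong[OF refl])
      fix h
      have "cis (2 * pi * (h \<bullet> \<xi>)) = cis (- 2 * pi * (x \<bullet> \<xi>)) * cis (2 * pi * ((h + x) \<bullet> \<xi>))"
        by (simp add: cis_mult inner_add_left algebra_simps)
      then show "complex_of_real (u x * u (x + h)) * cis (2 * pi * (h \<bullet> \<xi>)) = (complex_of_real (u x) * cis (- 2 * pi * (x \<bullet> \<xi>))) * 
           (complex_of_real (u (h + x)) * cis (2 * pi * ((h + x) \<bullet> \<xi>)))"
        by (simp add: add.commute[of x h] del: cis_mult)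
    qed
    also have "\<dots> = (complex_of_real (u x) * cis (- 2 * pi * (x \<bullet> \<xi>))) * 
        (LINT h|lborel. complex_of_real (u (h + x)) * cis (2 * pi * ((h + x) \<bullet> \<xi>)))" by (rule integral_mult_right_zero)
    also have "(LINT h|lborel. complex_of_real (u (h + x)) * cis (2 * pi * ((h + x) \<bullet> \<xi>))) = cnj (ft u \<xi>)"
      unfolding cnj_ft[OF u] by (rule integral_lborel_shift(2)) measurable
    finally show "(LINT h|lborel. complex_of_real (u x * u (x + h)) * cis (2 * pi * (h \<bullet> \<xi>))) = 
       (complex_of_real (u x) * cis (- 2 * pi * (x \<bullet> \<xi>))) * cnj (ft u \<xi>)" .
  qed
  also have "\<dots> = ft u \<xi> * cnj (ft u \<xi>)" unfolding ft_def by (rule integral_mult_left_zero)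
  finally show ?thesis by (simp only: complex_norm_square)
qed

text \<open>The Gaussian cutoff makes the frequency integral absolutely convergent, so Fubini
  applies; on the other side the cutoff becomes an average of \<open>autocorr\<close> against
  \<open>gau_hat\<close> at scale \<open>e\<close>.\<close>

lemma gaussian_weighted:
  assumes e: "e > 0"
  shows "(LINT \<xi>|lborel. gau (e *\<^sub>R \<xi>) * (norm (ft u \<xi>))\<^sup>2) = (LINT z|lborel. autocorr (e *\<^sub>R z) * gau_hat z)"
proof -
  note gi = gau_scale_integrable[OF e]
  let ?K = "\<lambda>h \<xi>. complex_of_real (autocorr h) * (complex_of_real (gau (e *\<^sub>R \<xi>)) * cis (2 * pi * (h \<bullet> \<xi>)))"
  have pi: "integrable (lborel \<Otimes>\<^sub>M lborel) (\<lambda>(h, \<xi>). ?K h \<xi>)"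
  proof (rule lborel_pair.Fubini_integrable)
    show "integrable lborel (\<lambda>x. LINT y|lborel. norm (case (x, y) of (h, \<xi>) \<Rightarrow> ?K h \<xi>))"
      using autocorr_integrable by (simp add: norm_mult)
    have "integrable lborel (?K h)" for h
      by (rule Bochner_Integration.integrable_bound[of _ "\<lambda>\<xi>. autocorr h * gau (e *\<^sub>R \<xi>)"]) (use gi in \<open>auto simp: norm_mult\<close>)
    then show "AE x in lborel. integrable lborel (\<lambda>y. case (x, y) of (h, \<xi>) \<Rightarrow> ?K h \<xi>)" by simp
  qed measurable
  have "complex_of_real (LINT \<xi>|lborel. gau (e *\<^sub>R \<xi>) * (norm (ft u \<xi>))\<^sup>2) = 
     (LINT \<xi>|lborel. complex_of_real (gau (e *\<^sub>R \<xi>)) * complex_of_real ((norm (ft u \<xi>))\<^sup>2))"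
    by (simp flip: integral_complex_of_real)
  also have "\<dots> = (LINT \<xi>|lborel. LINT h|lborel. ?K h \<xi>)"
    unfolding ft_square_autocorr
    by (subst integral_mult_right_zero[symmetric]) (simp add: ac_simps)
  also have "\<dots> = (LINT h|lborel. LINT \<xi>|lborel. ?K h \<xi>)"
    by (rule lborel_pair.Fubini_integral[OF pi])
  also have "\<dots> = (LINT h|lborel. complex_of_real (autocorr h * ((1 / e ^ DIM('a)) * gau_hat ((1 / e) *\<^sub>R h))))"
  proof (rule Bochner_Integration.integral_cong[OF refl])
    fix h :: 'a
    have "(LINT \<xi>|lborel. complex_of_real (gau (e *\<^sub>R \<xi>)) * cis (2 * pi * (h \<bullet> \<xi>))) =
      (LINT \<xi>|lborel. complex_of_real (gau (e *\<^sub>R \<xi>)) * cis (2 * pi * (((1/e) *\<^sub>R h) \<bullet> (e *\<^sub>R \<xi>))))"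
      using e by simp
    also have "\<dots> = (1 / \<bar>e\<bar> ^ DIM('a)) *\<^sub>R (LINT \<xi>|lborel. complex_of_real (gau \<xi>) * cis (2 * pi * (((1/e) *\<^sub>R h) \<bullet> \<xi>)))"
      using e by (intro integral_lborel_scale(2)) auto
    also have "\<dots> = complex_of_real ((1 / e ^ DIM('a)) * gau_hat ((1 / e) *\<^sub>R h))"
      unfolding gaussian_fourier(2) using e by (simp add: scaleR_conv_of_real)
    finally show "(LINT \<xi>|lborel. ?K h \<xi>) = complex_of_real (autocorr h * ((1 / e ^ DIM('a)) * gau_hat ((1 / e) *\<^sub>R h)))"
      by simp
  qed
  also have "\<dots> = complex_of_real (LINT h|lborel. autocorr h * ((1 / e ^ DIM('a)) * gau_hat ((1 / e) *\<^sub>R h)))"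
    by (rule integral_complex_of_real)
  finally have "(LINT \<xi>|lborel. gau (e *\<^sub>R \<xi>) * (norm (ft u \<xi>))\<^sup>2) = 
      (LINT h|lborel. autocorr h * ((1 / e ^ DIM('a)) * gau_hat ((1 / e) *\<^sub>R h)))"
    unfolding of_real_eq_iff .
  also have "\<dots> = (1 / \<bar>e\<bar> ^ DIM('a)) *\<^sub>R (LINT h|lborel. autocorr h * gau_hat ((1 / e) *\<^sub>R h))"
    using e by (simp add: ac_simps)
  also have "\<dots> = (LINT z|lborel. autocorr (e *\<^sub>R z) * gau_hat ((1 / e) *\<^sub>R (e *\<^sub>R z)))"
    using e by (intro integral_lborel_scale(2)[symmetric]) auto
  finally show ?thesis using e by simp
qed

text \<open>Let the scale tend to 0 in \<open>gaussian_weighted\<close>. The right side tends to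
  \<open>autocorr 0\<close> by dominated convergence; the left side increases, so monotone
  convergence yields integrability and the value together.\<close>

lemma Plancherel_bounded:
  "integrable lborel (\<lambda>\<xi>. (norm (ft u \<xi>))\<^sup>2)" "(LINT \<xi>|lborel. (norm (ft u \<xi>))\<^sup>2) = (LINT x|lborel. (u x)\<^sup>2)"
proof -
  let ?e = "\<lambda>k. 1 / real (Suc k)"
  let ?f = "\<lambda>k \<xi>. gau (?e k *\<^sub>R \<xi>) * (norm (ft u \<xi>))\<^sup>2"
  have gi: "integrable lborel (\<lambda>\<xi>::'a. gau (?e k *\<^sub>R \<xi>))" for k by (rule gau_scale_integrable) simp
  have i: "integrable lborel (?f k)" for k
  proof (rule Bochner_Integration.integrable_bound)
    show "integrable lborel (\<lambda>\<xi>::'a. gau (?e k *\<^sub>R \<xi>) * (LINT x|lborel. \<bar>u x\<bar>)\<^sup>2)" using gi by simp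
    have "norm (?f k \<xi>) \<le> norm (gau (?e k *\<^sub>R \<xi>) * (LINT x|lborel. \<bar>u x\<bar>)\<^sup>2)" for \<xi>
    proof -
      have "(norm (ft u \<xi>))\<^sup>2 \<le> (LINT x|lborel. \<bar>u x\<bar>)\<^sup>2" by (rule power_mono[OF norm_ft_le]) simp
      then show ?thesis by (simp add: abs_mult mult_left_mono)
    qed
    then show "AE \<xi> in lborel. norm (?f k \<xi>) \<le> norm (gau (?e k *\<^sub>R \<xi>) * (LINT x|lborel. \<bar>u x\<bar>)\<^sup>2)" by simp
  qed measurable
  have m: "mono (\<lambda>k. ?f k \<xi>)" for \<xi>
  proof (rule monoI)
    fix k l :: nat assume kl: "k \<le> l"
    have "norm (?e l *\<^sub>R \<xi>) \<le> norm (?e k *\<^sub>R \<xi>)" using kl by (auto intro!: mult_right_mono simp: field_simps)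
    then have "(norm (?e l *\<^sub>R \<xi>))\<^sup>2 \<le> (norm (?e k *\<^sub>R \<xi>))\<^sup>2" by (intro power_mono) auto
    then show "?f k \<xi> \<le> ?f l \<xi>" unfolding gau_def by (intro mult_right_mono) auto
  qed
  have e0: "?e \<longlonglongrightarrow> 0" by (rule LIMSEQ_Suc[OF lim_1_over_n])
  have l: "(\<lambda>k. ?f k \<xi>) \<longlonglongrightarrow> (norm (ft u \<xi>))\<^sup>2" for \<xi>
  proof -
    have "(\<lambda>k. exp (- (norm (?e k *\<^sub>R \<xi>))\<^sup>2 / 2) * (norm (ft u \<xi>))\<^sup>2) \<longlonglongrightarrow> exp (- (norm (0 *\<^sub>R \<xi>))\<^sup>2 / 2) * (norm (ft u \<xi>))\<^sup>2"
      by (intro tendsto_intros e0) simp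
    then show ?thesis unfolding gau_def by simp
  qed
  have "(\<lambda>k. LINT z|lborel. autocorr (?e k *\<^sub>R z) * gau_hat z) \<longlonglongrightarrow> (LINT z|lborel. autocorr 0 * gau_hat (z::'a))"
  proof (rule integral_dominated_convergence[where w="\<lambda>z. (B * (LINT x|lborel. \<bar>u x\<bar>)) * gau_hat z"])
    show "integrable lborel (\<lambda>z::'a. (B * (LINT x|lborel. \<bar>u x\<bar>)) * gau_hat z)" by (simp add: gau_hat_integral(1))
    show "AE z in lborel. (\<lambda>k. autocorr (?e k *\<^sub>R z) * gau_hat z) \<longlonglongrightarrow> autocorr 0 * gau_hat z"
    proof (rule AE_I2)
      fix z :: 'a
      have "(\<lambda>k. ?e k *\<^sub>R z) \<longlonglongrightarrow> 0 *\<^sub>R z" by (intro tendsto_intros e0)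
      then show "(\<lambda>k. autocorr (?e k *\<^sub>R z) * gau_hat z) \<longlonglongrightarrow> autocorr 0 * gau_hat z"
        by (intro tendsto_intros autocorr_continuous) simp
    qed
    show "AE z in lborel. norm (autocorr (?e k *\<^sub>R z) * gau_hat z) \<le> (B * (LINT x|lborel. \<bar>u x\<bar>)) * gau_hat z" for k
      using autocorr_bound by (intro AE_I2) (simp add: abs_mult gau_hat_nonneg mult_right_mono)
  qed measurable
  also have "(LINT z|lborel. autocorr 0 * gau_hat (z::'a)) = (LINT x|lborel. (u x)\<^sup>2)"
    by (simp add: autocorr_def power2_eq_square gau_hat_integral(2))
  finally have lim: "(\<lambda>k. LINT \<xi>|lborel. ?f k \<xi>) \<longlonglongrightarrow> (LINT x|lborel. (u x)\<^sup>2)"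
    by (subst gaussian_weighted) auto
  note mc = integral_monotone_convergence_nonneg[where f="?f", OF i _ _ _ lim, of "\<lambda>\<xi>. (norm (ft u \<xi>))\<^sup>2"]
  show "integrable lborel (\<lambda>\<xi>. (norm (ft u \<xi>))\<^sup>2)" 
    by (rule mc(1)) (use m l in \<open>auto simp: gau_def\<close>)
  show "(LINT \<xi>|lborel. (norm (ft u \<xi>))\<^sup>2) = (LINT x|lborel. (u x)\<^sup>2)"
    by (rule mc(2)) (use m l in \<open>auto simp: gau_def\<close>)
qed

end

text \<open>Serves wherever only an upper bound on the integrals is known: the bound passes to an
  almost everywhere limit, and integrability of the limit comes with it.\<close>

lemma Fatou_bound:
  fixes s :: "nat \<Rightarrow> 'a \<Rightarrow> real"
  assumes s: "\<And>i. integrable M (s i)" and pos: "\<And>i x. 0 \<le> s i x"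
    and lim: "AE x in M. (\<lambda>i. s i x) \<longlonglongrightarrow> f x" and [measurable]: "f \<in> borel_measurable M"
    and bd: "\<forall>\<^sub>F i in sequentially. (\<integral>x. s i x \<partial>M) \<le> C"
  shows "integrable M f" and "(\<integral>x. f x \<partial>M) \<le> C"
proof -
  have fpos: "AE x in M. 0 \<le> f x"
    using lim by eventually_elim (use pos in \<open>auto intro: LIMSEQ_le_const\<close>)
  have [measurable]: "\<And>i. s i \<in> borel_measurable M" using s by auto
  obtain i where "(\<integral>x. s i x \<partial>M) \<le> C" using eventually_happens'[OF sequentially_bot bd] by blast
  moreover have "0 \<le> (\<integral>x. s i x \<partial>M)" by (simp add: pos)
  ultimately have C: "0 \<le> C" by simp
  have "(\<integral>\<^sup>+x. ennreal (f x) \<partial>M) = (\<integral>\<^sup>+x. liminf (\<lambda>i. ennreal (s i x)) \<partial>M)"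
  proof (rule nn_integral_cong_AE)
    show "AE x in M. ennreal (f x) = liminf (\<lambda>i. ennreal (s i x))"
      using lim
    proof eventually_elim
      case (elim x)
      then have "(\<lambda>i. ennreal (s i x)) \<longlonglongrightarrow> ennreal (f x)" by (rule tendsto_ennrealI)
      then show ?case using lim_imp_Liminf[OF sequentially_bot] by metis
    qed
  qed
  also have "\<dots> \<le> liminf (\<lambda>i. \<integral>\<^sup>+x. ennreal (s i x) \<partial>M)" by (rule nn_integral_liminf) simp
  also have "\<dots> = liminf (\<lambda>i. ennreal (\<integral>x. s i x \<partial>M))"
    using s pos by (subst nn_integral_eq_integral) auto
  also have "\<dots> \<le> ennreal C"
  proof (rule Liminf_le)
    show "\<forall>\<^sub>F i in sequentially. ennreal (\<integral>x. s i x \<partial>M) \<le> ennreal C"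
      using bd by eventually_elim (rule ennreal_leI)
  qed simp
  finally have le: "(\<integral>\<^sup>+x. ennreal (f x) \<partial>M) \<le> ennreal C" .
  show i: "integrable M f"
    by (rule integrableI_nonneg) (use fpos le in \<open>auto intro: order_le_less_trans simp: ennreal_less_top\<close>)
  have "ennreal (\<integral>x. f x \<partial>M) = (\<integral>\<^sup>+x. ennreal (f x) \<partial>M)" by (rule nn_integral_eq_integral[symmetric, OF i fpos])
  then show "(\<integral>x. f x \<partial>M) \<le> C" using le C by (metis ennreal_le_iff)
qed

text \<open>AM-GM on the cross term. With \<open>d\<close> free the factor of the main term can
  approach 1, which gives sharp comparisons of square integrals without Minkowski's inequality;
  \<open>d = 1\<close> gives the crude factor 2.\<close>

lemma norm_square_weighted:
  fixes a b :: "'a::real_normed_vector"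
  assumes "d > 0"
  shows "(norm a)\<^sup>2 \<le> (1 + d) * (norm b)\<^sup>2 + (1 + 1 / d) * (norm (b - a))\<^sup>2"
proof -
  have "norm a \<le> norm b + norm (b - a)" using norm_triangle_sub[of a b] by (simp add: norm_minus_commute)
  then have "(norm a)\<^sup>2 \<le> (norm b + norm (b - a))\<^sup>2" by (intro power_mono) auto
  moreover have "0 \<le> (sqrt d * norm b - norm (b - a) / sqrt d)\<^sup>2" by simp
  moreover have "(sqrt d * norm b - norm (b - a) / sqrt d)\<^sup>2 = d * (norm b)\<^sup>2 - 2 * norm b * norm (b - a) + (1 / d) * (norm (b - a))\<^sup>2"
    using assms by (simp add: power2_diff power_mult_distrib power_divide)
  ultimately show ?thesis by (simp add: power2_sum algebra_simps)
qed

lemma norm_diff_square_le: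
  fixes a b :: "'a::real_normed_vector"
  shows "(norm (a - b))\<^sup>2 \<le> 2 * (norm a)\<^sup>2 + 2 * (norm b)\<^sup>2"
  using norm_square_weighted[of 1 "a - b" a] by simp

lemma norm_add_square_le:
  fixes a b :: "'a::real_normed_vector"
  shows "(norm (a + b))\<^sup>2 \<le> 2 * (norm a)\<^sup>2 + 2 * (norm b)\<^sup>2"
  using norm_diff_square_le[of a "- b"] by simp

lemma square_diff_integrable:
  fixes f g :: "'a \<Rightarrow> 'b::{real_normed_vector, second_countable_topology}"
  assumes [measurable]: "f \<in> borel_measurable M" "g \<in> borel_measurable M"
    and i: "integrable M (\<lambda>x. (norm (f x))\<^sup>2)" "integrable M (\<lambda>x. (norm (g x))\<^sup>2)"
  shows "integrable M (\<lambda>x. (norm (f x - g x))\<^sup>2)"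
proof (rule Bochner_Integration.integrable_bound)
  show "integrable M (\<lambda>x. 2 * (norm (f x))\<^sup>2 + 2 * (norm (g x))\<^sup>2)" using i by simp
  show "AE x in M. norm ((norm (f x - g x))\<^sup>2) \<le> norm (2 * (norm (f x))\<^sup>2 + 2 * (norm (g x))\<^sup>2)"
    using norm_diff_square_le[of "f _" "g _"] by (intro AE_I2) simp
qed measurable

section \<open>Plancherel's identity for functions in L1 and L2, by truncation\<close>

lemma ft_lincomb:
  assumes "integrable lborel u" "integrable lborel v"
  shows "ft (\<lambda>x. a * u x + c * v x) \<xi> = of_real a * ft u \<xi> + of_real c * ft v \<xi>"
proof -
  have "ft (\<lambda>x. a * u x + c * v x) \<xi> = (LINT x|lborel. of_real a * (complex_of_real (u x) * cis (- 2 * pi * (x \<bullet> \<xi>)))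
      + of_real c * (complex_of_real (v x) * cis (- 2 * pi * (x \<bullet> \<xi>))))"
    unfolding ft_def by (simp add: algebra_simps)
  also have "\<dots> = of_real a * ft u \<xi> + of_real c * ft v \<xi>"
    unfolding ft_def using ft_integrable[OF assms(1), of "- 2 * pi"] ft_integrable[OF assms(2), of "- 2 * pi"] by simp
  finally show ?thesis .
qed

lemma ft_diff:
  assumes "integrable lborel u" "integrable lborel v"
  shows "ft (\<lambda>x. u x - v x) \<xi> = ft u \<xi> - ft v \<xi>"
  using ft_lincomb[OF assms, of 1 "-1"] by simp

definition trunc :: "('a \<Rightarrow> real) \<Rightarrow> nat \<Rightarrow> 'a \<Rightarrow> real" where
  "trunc u k x = max (- real k) (min (real k) (u x))"

context
  fixes u :: "'a::euclidean_space \<Rightarrow> real"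
  assumes u: "integrable lborel u" and u2: "integrable lborel (\<lambda>x. (u x)\<^sup>2)"
begin

lemma L1_L2_measurable [measurable]: "u \<in> borel_measurable borel" using u by auto

lemma trunc_measurable [measurable]: "trunc u k \<in> borel_measurable borel"
  unfolding trunc_def[abs_def] by measurable

lemma trunc_abs_le: "\<bar>trunc u k x\<bar> \<le> \<bar>u x\<bar>" "\<bar>trunc u k x\<bar> \<le> real k"
  by (auto simp: trunc_def)

lemma trunc_tendsto: "(\<lambda>k. trunc u k x) \<longlonglongrightarrow> u x"
proof (rule tendsto_eventually)
  obtain K where "\<bar>u x\<bar> \<le> real K" using real_arch_simple by blast
  then have "trunc u k x = u x" if "k \<ge> K" for k
    using that of_nat_mono[OF that, where 'a=real] by (simp add: trunc_def)
  then show "\<forall>\<^sub>F k in sequentially. trunc u k x = u x" by (auto simp: eventually_sequentially)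
qed

lemma trunc_integrable: "integrable lborel (trunc u k)"
  by (rule Bochner_Integration.integrable_bound[OF u]) (auto simp: trunc_abs_le)

lemma trunc_square: "integrable lborel (\<lambda>x. (trunc u k x)\<^sup>2)"
  "(\<lambda>k. LINT x|lborel. (trunc u k x)\<^sup>2) \<longlonglongrightarrow> (LINT x|lborel. (u x)\<^sup>2)"
  "(\<lambda>k. LINT x|lborel. (u x - trunc u k x)\<^sup>2) \<longlonglongrightarrow> 0"
  "integrable lborel (\<lambda>x. (u x - trunc u k x)\<^sup>2)"
proof -
  have le: "(trunc u k x)\<^sup>2 \<le> (u x)\<^sup>2" for k x using trunc_abs_le by (simp add: abs_le_square_iff)
  show "integrable lborel (\<lambda>x. (trunc u k x)\<^sup>2)"
    by (rule Bochner_Integration.integrable_bound[OF u2]) (auto simp: le)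
  show "(\<lambda>k. LINT x|lborel. (trunc u k x)\<^sup>2) \<longlonglongrightarrow> (LINT x|lborel. (u x)\<^sup>2)"
  proof (rule integral_dominated_convergence[where w="\<lambda>x. (u x)\<^sup>2"])
    show "AE x in lborel. (\<lambda>k. (trunc u k x)\<^sup>2) \<longlonglongrightarrow> (u x)\<^sup>2"
      by (intro AE_I2 tendsto_intros trunc_tendsto)
    show "AE x in lborel. norm ((trunc u k x)\<^sup>2) \<le> (u x)\<^sup>2" for k by (intro AE_I2) (simp add: le)
  qed (use u2 in measurable)
  have le2: "(u x - trunc u k x)\<^sup>2 \<le> (u x)\<^sup>2" for k x
    by (subst abs_le_square_iff[symmetric]) (auto simp: trunc_def)
  show "integrable lborel (\<lambda>x. (u x - trunc u k x)\<^sup>2)"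
    by (rule Bochner_Integration.integrable_bound[OF u2]) (auto simp: le2)
  have "(\<lambda>k. LINT x|lborel. (u x - trunc u k x)\<^sup>2) \<longlonglongrightarrow> (LINT x|(lborel :: 'a measure). 0)"
  proof (rule integral_dominated_convergence[where w="\<lambda>x. (u x)\<^sup>2"])
    show "AE x in lborel. (\<lambda>k. (u x - trunc u k x)\<^sup>2) \<longlonglongrightarrow> 0"
    proof (rule AE_I2)
      fix x
      have "(\<lambda>k. (u x - trunc u k x)\<^sup>2) \<longlonglongrightarrow> (u x - u x)\<^sup>2" by (intro tendsto_intros trunc_tendsto)
      then show "(\<lambda>k. (u x - trunc u k x)\<^sup>2) \<longlonglongrightarrow> 0" by simp
    qed
    show "AE x in lborel. norm ((u x - trunc u k x)\<^sup>2) \<le> (u x)\<^sup>2" for k by (intro AE_I2) (simp add: le2)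
  qed (use u2 in measurable)
  then show "(\<lambda>k. LINT x|lborel. (u x - trunc u k x)\<^sup>2) \<longlonglongrightarrow> 0" by simp
qed

lemma ft_trunc_tendsto: "(\<lambda>k. ft (trunc u k) \<xi>) \<longlonglongrightarrow> ft u \<xi>"
  unfolding ft_def
proof (rule integral_dominated_convergence[where w="\<lambda>x. \<bar>u x\<bar>"])
  show "AE x in lborel. (\<lambda>k. complex_of_real (trunc u k x) * cis (- 2 * pi * (x \<bullet> \<xi>))) \<longlonglongrightarrow> complex_of_real (u x) * cis (- 2 * pi * (x \<bullet> \<xi>))"
    by (intro AE_I2 tendsto_intros trunc_tendsto)
  show "AE x in lborel. norm (complex_of_real (trunc u k x) * cis (- 2 * pi * (x \<bullet> \<xi>))) \<le> \<bar>u x\<bar>" for k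
    by (intro AE_I2) (simp add: norm_mult trunc_abs_le)
  show "integrable lborel (\<lambda>x. \<bar>u x\<bar>)" using u by simp
qed measurable

lemma Plancherel_le:
  "integrable lborel (\<lambda>\<xi>. (norm (ft u \<xi>))\<^sup>2)" "(LINT \<xi>|lborel. (norm (ft u \<xi>))\<^sup>2) \<le> (LINT x|lborel. (u x)\<^sup>2)"
proof -
  have le: "(trunc u k x)\<^sup>2 \<le> (u x)\<^sup>2" for k x using trunc_abs_le by (simp add: abs_le_square_iff)
  have b: "integrable lborel (\<lambda>\<xi>. (norm (ft (trunc u k) \<xi>))\<^sup>2)" 
    "(LINT \<xi>|lborel. (norm (ft (trunc u k) \<xi>))\<^sup>2) \<le> (LINT x|lborel. (u x)\<^sup>2)" for k
    using Plancherel_bounded[OF trunc_integrable trunc_abs_le(2), of k] 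
      integral_mono[OF trunc_square(1) u2 le, of k] by auto
  have l: "AE \<xi> in lborel. (\<lambda>k. (norm (ft (trunc u k) \<xi>))\<^sup>2) \<longlonglongrightarrow> (norm (ft u \<xi>))\<^sup>2"
    by (intro AE_I2 tendsto_intros ft_trunc_tendsto)
  show "integrable lborel (\<lambda>\<xi>. (norm (ft u \<xi>))\<^sup>2)"
    by (rule Fatou_bound(1)[OF b(1) _ l]) (auto intro!: always_eventually b(2))
  show "(LINT \<xi>|lborel. (norm (ft u \<xi>))\<^sup>2) \<le> (LINT x|lborel. (u x)\<^sup>2)"
    by (rule Fatou_bound(2)[OF b(1) _ l]) (auto intro!: always_eventually b(2))
qed

end

text \<open>Fatou along truncations gave one inequality; it also applies to
  \<open>u - trunc u k\<close>. By \<open>norm_square_weighted\<close> the square integral of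
  \<open>trunc u k\<close> is then at most \<open>1 + d\<close> times the full Fourier side plus a
  remainder that vanishes as \<open>k\<close> grows; finally \<open>d\<close> tends to 0.\<close>

lemma Plancherel:
  fixes u :: "'a::euclidean_space \<Rightarrow> real"
  assumes u: "integrable lborel u" and u2: "integrable lborel (\<lambda>x. (u x)\<^sup>2)"
  shows "integrable lborel (\<lambda>\<xi>. (norm (ft u \<xi>))\<^sup>2)" "(LINT \<xi>|lborel. (norm (ft u \<xi>))\<^sup>2) = (LINT x|lborel. (u x)\<^sup>2)"
proof -
  show int: "integrable lborel (\<lambda>\<xi>. (norm (ft u \<xi>))\<^sup>2)" using Plancherel_le[OF assms] by simp
  let ?I = "LINT \<xi>|lborel. (norm (ft u \<xi>))\<^sup>2"
  have ge: "(LINT x|lborel. (u x)\<^sup>2) \<le> (1 + d) * ?I" if d: "d > 0" for d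
  proof -
    have "(LINT x|lborel. (trunc u k x)\<^sup>2) \<le> (1 + d) * ?I + (1 + 1 / d) * (LINT x|lborel. (u x - trunc u k x)\<^sup>2)" for k
    proof -
      note tb = Plancherel_bounded[OF trunc_integrable[OF assms] trunc_abs_le(2)[OF assms], of k]
      have di: "integrable lborel (\<lambda>x. u x - trunc u k x)" using u trunc_integrable[OF assms] by simp
      note dd = Plancherel_le[OF di trunc_square(4)[OF assms]]
      have "(LINT x|lborel. (trunc u k x)\<^sup>2) = (LINT \<xi>|lborel. (norm (ft (trunc u k) \<xi>))\<^sup>2)" using tb by simp
      also have "\<dots> \<le> (LINT \<xi>|lborel. (1 + d) * (norm (ft u \<xi>))\<^sup>2 + (1 + 1 / d) * (norm (ft (\<lambda>x. u x - trunc u k x) \<xi>))\<^sup>2)"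
      proof (rule integral_mono)
        show "(norm (ft (trunc u k) \<xi>))\<^sup>2 \<le> (1 + d) * (norm (ft u \<xi>))\<^sup>2 + (1 + 1 / d) * (norm (ft (\<lambda>x. u x - trunc u k x) \<xi>))\<^sup>2" for \<xi>
          unfolding ft_diff[OF u trunc_integrable[OF assms]] by (rule norm_square_weighted[OF d])
      qed (use tb dd int in auto)
      also have "\<dots> = (1 + d) * ?I + (1 + 1 / d) * (LINT \<xi>|lborel. (norm (ft (\<lambda>x. u x - trunc u k x) \<xi>))\<^sup>2)"
        using dd int by simp
      also have "\<dots> \<le> (1 + d) * ?I + (1 + 1 / d) * (LINT x|lborel. (u x - trunc u k x)\<^sup>2)"
        using dd d by (intro add_left_mono mult_left_mono) auto
      finally show ?thesis .
    qed
    moreover have "(\<lambda>k. (1 + d) * ?I + (1 + 1 / d) * (LINT x|lborel. (u x - trunc u k x)\<^sup>2)) \<longlonglongrightarrow> (1 + d) * ?I + (1 + 1 / d) * 0"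
      by (intro tendsto_intros trunc_square[OF assms])
    ultimately have "(LINT x|lborel. (u x)\<^sup>2) \<le> (1 + d) * ?I + (1 + 1 / d) * 0"
      using trunc_square(2)[OF assms] LIMSEQ_le by blast
    then show ?thesis by simp
  qed
  have I0: "0 \<le> ?I" by simp
  have "(LINT x|lborel. (u x)\<^sup>2) \<le> ?I"
  proof (rule field_le_epsilon)
    fix e :: real assume e: "e > 0"
    \<comment> \<open>The choice \<open>d = e / (?I + 1)\<close>; the added 1 keeps the denominator
      positive.\<close>
    have "(LINT x|lborel. (u x)\<^sup>2) \<le> (1 + e / (?I + 1)) * ?I" using e I0 by (intro ge) (simp add: add_nonneg_pos)
    also have "\<dots> = ?I + e * (?I / (?I + 1))" by (simp add: algebra_simps)
    finally have 1: "(LINT x|lborel. (u x)\<^sup>2) \<le> ?I + e * (?I / (?I + 1))" .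
    have "?I / (?I + 1) \<le> 1" using I0 by (subst divide_le_eq_1) linarith
    then have "?I + e * (?I / (?I + 1)) \<le> ?I + e * 1" using e by (intro add_left_mono mult_left_mono) auto
    then show "(LINT x|lborel. (u x)\<^sup>2) \<le> ?I + e" using 1 by simp
  qed
  then show "?I = (LINT x|lborel. (u x)\<^sup>2)" using Plancherel_le(2)[OF assms] by simp
qed

section \<open>Passage from Borel to Lebesgue measurable functions\<close>

lemma lebesgue_borel_rep:
  fixes u :: "'a::euclidean_space \<Rightarrow> real"
  assumes "u \<in> borel_measurable lebesgue"
  shows "\<exists>v\<in>borel_measurable borel. AE x in lebesgue. u x = v x"
  using completion_ex_borel_measurable_real[OF assms] AE_completion by force

lemma fourier_eq_ft:
  fixes u v :: "real^'n::finite \<Rightarrow> real"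
  assumes "u \<in> borel_measurable lebesgue" and [measurable]: "v \<in> borel_measurable borel" and "AE x in lebesgue. u x = v x"
  shows "fourier u = ft v"
proof
  fix \<xi> :: "real^'n"
  have m: "(\<lambda>x. complex_of_real (v x) * cis (- 2 * pi * (x \<bullet> \<xi>))) \<in> borel_measurable lborel" by measurable
  have c: "(\<lambda>x. cis (- 2 * pi * (x \<bullet> \<xi>))) \<in> borel_measurable lebesgue" by (rule measurable_completion) simp
  have "fourier u \<xi> = (LINT x|lebesgue. complex_of_real (v x) * cis (- 2 * pi * (x \<bullet> \<xi>)))"
    unfolding fourier_def using assms(1) measurable_completion[OF m] c assms(3)
    by (intro integral_cong_AE) (auto elim: eventually_mono)
  also have "\<dots> = ft v \<xi>" unfolding ft_def by (rule integral_completion[OF m])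
  finally show "fourier u \<xi> = ft v \<xi>" .
qed

lemma integrable_borel_rep:
  fixes u v :: "'a::euclidean_space \<Rightarrow> real"
  assumes "u \<in> borel_measurable lebesgue" "v \<in> borel_measurable borel" "AE x in lebesgue. u x = v x"
    and [measurable]: "F \<in> borel_measurable (borel :: real measure)"
  shows "integrable lebesgue (\<lambda>x. F (u x) :: real) \<longleftrightarrow> integrable lborel (\<lambda>x. F (v x))"
    and "(LINT x|lebesgue. F (u x)) = (LINT x|lborel. F (v x))"
proof -
  note [measurable] = assms(2)
  have m: "(\<lambda>x. F (v x)) \<in> borel_measurable lborel" by measurable
  have mu: "(\<lambda>x. F (u x)) \<in> borel_measurable lebesgue" using measurable_compose[OF assms(1,4)] by simp
  have ae: "AE x in lebesgue. F (u x) = F (v x)" using assms(3) by eventually_elim simp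
  show "integrable lebesgue (\<lambda>x. F (u x)) \<longleftrightarrow> integrable lborel (\<lambda>x. F (v x))"
    using integrable_cong_AE[OF mu measurable_completion[OF m] ae] integrable_completion[OF m] by simp
  show "(LINT x|lebesgue. F (u x)) = (LINT x|lborel. F (v x))"
    using integral_cong_AE[OF mu measurable_completion[OF m] ae] integral_completion[OF m] by simp
qed

lemma fourier_measurable:
  fixes u :: "real^'n::finite \<Rightarrow> real"
  assumes "u \<in> borel_measurable lebesgue"
  shows "fourier u \<in> borel_measurable borel"
  using lebesgue_borel_rep[OF assms] fourier_eq_ft[OF assms] ft_measurable by metis

lemma fourier_measurable_lebesgue:
  fixes u :: "real^'n::finite \<Rightarrow> real"
  assumes "u \<in> borel_measurable lebesgue"
  shows "fourier u \<in> borel_measurable lebesgue"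
  by (rule measurable_completion) (simp add: fourier_measurable[OF assms])

lemma cis_inner_lebesgue: "(\<lambda>x::'a::euclidean_space. cis (c * (x \<bullet> \<xi>))) \<in> borel_measurable lebesgue"
  by (rule measurable_completion) simp

lemma fourier_integrand_integrable:
  fixes u :: "real^'n::finite \<Rightarrow> real"
  assumes "integrable lebesgue u"
  shows "integrable lebesgue (\<lambda>x. complex_of_real (u x) * cis (- 2 * pi * (x \<bullet> \<xi>)))"
  by (rule Bochner_Integration.integrable_bound[OF assms])
     (use assms cis_inner_lebesgue[of "- 2 * pi" \<xi>] in \<open>auto simp: norm_mult\<close>)

lemma fourier_lincomb:
  fixes u v :: "real^'n::finite \<Rightarrow> real"
  assumes "integrable lebesgue u" "integrable lebesgue v"
  shows "fourier (\<lambda>x. a * u x + c * v x) \<xi> = of_real a * fourier u \<xi> + of_real c * fourier v \<xi>"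
proof -
  have "fourier (\<lambda>x. a * u x + c * v x) \<xi> = (LINT x|lebesgue. of_real a * (complex_of_real (u x) * cis (- 2 * pi * (x \<bullet> \<xi>)))
      + of_real c * (complex_of_real (v x) * cis (- 2 * pi * (x \<bullet> \<xi>))))"
    unfolding fourier_def by (simp add: algebra_simps)
  also have "\<dots> = of_real a * fourier u \<xi> + of_real c * fourier v \<xi>"
    unfolding fourier_def using fourier_integrand_integrable[OF assms(1)] fourier_integrand_integrable[OF assms(2)] by simp
  finally show ?thesis .
qed

lemma fourier_diff:
  fixes u v :: "real^'n::finite \<Rightarrow> real"
  assumes "integrable lebesgue u" "integrable lebesgue v"
  shows "fourier (\<lambda>x. u x - v x) \<xi> = fourier u \<xi> - fourier v \<xi>"
  using fourier_lincomb[OF assms, of 1 "-1"] by simp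

lemma norm_fourier_le: 
  fixes u :: "real^'n::finite \<Rightarrow> real"
  shows "norm (fourier u \<xi>) \<le> (LINT x|lebesgue. \<bar>u x\<bar>)"
  unfolding fourier_def by (rule order_trans[OF integral_norm_bound]) (simp add: norm_mult)

lemma Plancherel_fourier:
  fixes u :: "real^'n::finite \<Rightarrow> real"
  assumes u: "integrable lebesgue u" "integrable lebesgue (\<lambda>x. (u x)\<^sup>2)"
  shows "integrable lebesgue (\<lambda>\<xi>. (norm (fourier u \<xi>))\<^sup>2)"
    and "(LINT \<xi>|lebesgue. (norm (fourier u \<xi>))\<^sup>2) = (LINT x|lebesgue. (u x)\<^sup>2)"
proof -
  have mu: "u \<in> borel_measurable lebesgue" using u by auto
  obtain v where v[measurable]: "v \<in> borel_measurable borel" "AE x in lebesgue. u x = v x"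
    using lebesgue_borel_rep[OF mu] by auto
  note r = integrable_borel_rep[OF mu v]
  have F: "fourier u = ft v" by (rule fourier_eq_ft[OF mu v])
  have v1: "integrable lborel v" "integrable lborel (\<lambda>x. (v x)\<^sup>2)"
    using r(1)[of "\<lambda>x. x"] r(1)[of "\<lambda>x. x\<^sup>2"] u by auto
  note P = Plancherel[OF v1]
  have m: "(\<lambda>\<xi>. (norm (ft v \<xi>))\<^sup>2) \<in> borel_measurable lborel" by measurable
  show "integrable lebesgue (\<lambda>\<xi>. (norm (fourier u \<xi>))\<^sup>2)"
    unfolding F integrable_completion[OF m] by (rule P)
  show "(LINT \<xi>|lebesgue. (norm (fourier u \<xi>))\<^sup>2) = (LINT x|lebesgue. (u x)\<^sup>2)"
    unfolding F integral_completion[OF m] using P(2) r(2)[of "\<lambda>x. x\<^sup>2"] by simp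
qed

section \<open>Test functions\<close>

abbreviation partial :: "'n::finite \<Rightarrow> (real^'n \<Rightarrow> real) \<Rightarrow> real^'n \<Rightarrow> real" where
  "partial i f \<equiv> (\<lambda>x. frechet_derivative f (at x) (axis i 1))"

text \<open>\<open>smooth_fun\<close> speaks of all iterated partials at once. A set of
  differentiable functions closed under partials contains them all, so a smoothness proof only has
  to exhibit such a set.\<close>

lemma smooth_coinduct:
  assumes "f \<in> S" and "\<And>g x. g \<in> S \<Longrightarrow> g differentiable (at x)"
    and "\<And>g i. g \<in> S \<Longrightarrow> partial i g \<in> S"
  shows "smooth_fun f"
proof -
  have "iter_partials is f \<in> S" for "is" by (induction "is") (use assms in auto)
  then show ?thesis using assms(2) by (auto simp: smooth_fun_def)
qed

lemma smooth_differentiable: "smooth_fun f \<Longrightarrow> f differentiable (at x)"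
  unfolding smooth_fun_def by (metis iter_partials.simps(1))

text \<open>The last entry of the list is the derivative taken first, so it can be absorbed into the
  function.\<close>

lemma iter_partials_append: "iter_partials (xs @ [i]) f = iter_partials xs (partial i f)"
  by (induction xs) simp_all

lemma smooth_partial: "smooth_fun f \<Longrightarrow> smooth_fun (partial i f)"
  unfolding smooth_fun_def iter_partials_append[symmetric] by blast

lemma smooth_continuous: "smooth_fun f \<Longrightarrow> continuous_on S f"
  by (meson continuous_at_imp_continuous_on differentiable_imp_continuous_within smooth_differentiable)

lemma partial_eq: "(f has_derivative f') (at x) \<Longrightarrow> partial i f x = f' (axis i 1)"
  using frechet_derivative_at[of f f' x] by simp

lemma partial_mem:
  assumes "\<And>x. (g has_derivative g' x) (at x)" "(\<lambda>x. g' x (axis i 1)) \<in> S"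
  shows "g differentiable (at x) \<and> partial i g \<in> S"
  using assms partial_eq[OF assms(1)] by (auto simp: differentiable_def)

lemma smooth_has_derivative: "smooth_fun f \<Longrightarrow> (f has_derivative frechet_derivative f (at x)) (at x)"
  by (simp add: frechet_derivative_works[symmetric] smooth_differentiable)

lemma frechet_derivative_partials:
  fixes f :: "real^'n::finite \<Rightarrow> real"
  assumes "f differentiable (at x)"
  shows "frechet_derivative f (at x) h = (\<Sum>i\<in>UNIV. h $ i * partial i f x)"
proof -
  have l: "linear (frechet_derivative f (at x))" by (rule linear_frechet_derivative[OF assms])
  have "h = (\<Sum>i\<in>UNIV. h $ i *\<^sub>R axis i 1)" by (simp add: basis_expansion scalar_mult_eq_scaleR[symmetric])
  then have "frechet_derivative f (at x) h = frechet_derivative f (at x) (\<Sum>i\<in>UNIV. h $ i *\<^sub>R axis i 1)" by simp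
  also have "\<dots> = (\<Sum>i\<in>UNIV. h $ i * partial i f x)" using l by (simp add: linear_sum linear_scale)
  finally show ?thesis .
qed

lemma smooth_lincomb:
  assumes "smooth_fun f" "smooth_fun g"
  shows "smooth_fun (\<lambda>x. a * f x + c * g x)"
proof (rule smooth_coinduct[where S="{\<lambda>x. a * f x + c * g x | f g. smooth_fun f \<and> smooth_fun g}"])
  show "(\<lambda>x. a * f x + c * g x) \<in> {\<lambda>x. a * f x + c * g x | f g. smooth_fun f \<and> smooth_fun g}" using assms by auto
  fix h x assume "h \<in> {\<lambda>x. a * f x + c * g x | f g. smooth_fun f \<and> smooth_fun g}"
  then obtain f g where h: "h = (\<lambda>x. a * f x + c * g x)" "smooth_fun f" "smooth_fun g" by auto
  note d = smooth_has_derivative[OF h(2)] smooth_has_derivative[OF h(3)]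
  have D: "(h has_derivative (\<lambda>y. a * frechet_derivative f (at x) y + c * frechet_derivative g (at x) y)) (at x)" for x
    unfolding h by (intro derivative_intros d)
  show "h differentiable (at x)" using D differentiableI by blast
  fix i
  have e: "partial i h = (\<lambda>x. a * partial i f x + c * partial i g x)" by (rule ext, rule partial_eq[OF D])
  show "partial i h \<in> {\<lambda>x. a * f x + c * g x | f g. smooth_fun f \<and> smooth_fun g}"
    unfolding e using smooth_partial[OF h(2), of i] smooth_partial[OF h(3), of i]
    by (intro CollectI exI[of _ "partial i f"] exI[of _ "partial i g"] conjI refl)
qed

text \<open>By the chain rule a partial of a pullback is a linear combination of pullbacks of
  partials; closing under sums and scalars makes the set stable, as \<open>smooth_coinduct\<close>
  requires.\<close>

inductive_set linear_pullbacks :: "(real^'n::finite \<Rightarrow> real^'n) \<Rightarrow> (real^'n \<Rightarrow> real) set" for L where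
  base: "smooth_fun f \<Longrightarrow> (\<lambda>x. f (L x)) \<in> linear_pullbacks L"
| add: "g \<in> linear_pullbacks L \<Longrightarrow> h \<in> linear_pullbacks L \<Longrightarrow> (\<lambda>x. g x + h x) \<in> linear_pullbacks L"
| scale: "g \<in> linear_pullbacks L \<Longrightarrow> (\<lambda>x. c * g x) \<in> linear_pullbacks L"

lemma smooth_linear_pullback:
  fixes f :: "real^'n::finite \<Rightarrow> real" and L :: "real^'n \<Rightarrow> real^'n"
  assumes L: "linear L" and "smooth_fun f" shows "smooth_fun (\<lambda>x. f (L x))"
proof (rule smooth_coinduct)
  show "(\<lambda>x. f (L x)) \<in> linear_pullbacks L" using assms by (intro linear_pullbacks.base)
  have sum: "(\<lambda>x. \<Sum>i\<in>I. g i x) \<in> linear_pullbacks L" if "finite I" "\<And>i. i \<in> I \<Longrightarrow> g i \<in> linear_pullbacks L" 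
    for g :: "'n \<Rightarrow> real^'n \<Rightarrow> real" and I
    using that
  proof (induction I rule: finite_induct)
    case empty
    have "(\<lambda>x. 0 * f (L x)) \<in> linear_pullbacks L"
      by (rule linear_pullbacks.scale, rule linear_pullbacks.base, rule assms)
    then show ?case by simp
  next
    case (insert j I) then show ?case using linear_pullbacks.add[of "g j" L "\<lambda>x. \<Sum>i\<in>I. g i x"] by simp
  qed
  have main: "g differentiable (at x) \<and> partial i g \<in> linear_pullbacks L" if "g \<in> linear_pullbacks L" for g x i
    using that
  proof (induction arbitrary: x i)
    case (base f)
    have "(L has_derivative L) (at x)" for x using L by (simp add: linear_imp_has_derivative)
    then have D: "((\<lambda>x. f (L x)) has_derivative (\<lambda>y. frechet_derivative f (at (L x)) (L y))) (at x)" for x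
      using diff_chain_at[of L L x f, OF _ smooth_has_derivative[OF base]] by (simp add: o_def)
    have m: "(\<lambda>x. \<Sum>j\<in>UNIV. L (axis i 1) $ j * partial j f (L x)) \<in> linear_pullbacks L"
    proof (rule sum)
      show "(\<lambda>x. L (axis i 1) $ j * partial j f (L x)) \<in> linear_pullbacks L" for j
        by (rule linear_pullbacks.scale, rule linear_pullbacks.base, rule smooth_partial, rule base)
    qed simp
    have "(\<lambda>x. frechet_derivative f (at (L x)) (L (axis i 1))) = (\<lambda>x. \<Sum>j\<in>UNIV. L (axis i 1) $ j * partial j f (L x))"
      by (rule ext, rule frechet_derivative_partials[OF smooth_differentiable[OF base]])
    then show ?case
      by (intro partial_mem[OF D]) (simp only: m)
  next
    case (add g h)
    have d: "(g has_derivative frechet_derivative g (at x)) (at x)" "(h has_derivative frechet_derivative h (at x)) (at x)" for x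
      using add frechet_derivative_works by blast+
    have D: "((\<lambda>x. g x + h x) has_derivative (\<lambda>y. frechet_derivative g (at x) y + frechet_derivative h (at x) y)) (at x)" for x
      by (intro derivative_intros d)
    show ?case by (rule partial_mem[OF D]) (use add linear_pullbacks.add[of "partial i g" L "partial i h"] in blast)
  next
    case (scale g c)
    have d: "(g has_derivative frechet_derivative g (at x)) (at x)" for x using scale frechet_derivative_works by blast
    have D: "((\<lambda>x. c * g x) has_derivative (\<lambda>y. c * frechet_derivative g (at x) y)) (at x)" for x
      by (intro derivative_intros d)
    show ?case by (rule partial_mem[OF D]) (use scale linear_pullbacks.scale[of "partial i g" L c] in blast)
  qed
  show "g differentiable (at x)" if "g \<in> linear_pullbacks L" for g x using main[OF that] by blast
  show "partial i g \<in> linear_pullbacks L" if "g \<in> linear_pullbacks L" for g i using main[OF that] by blast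
qed

text \<open>The derivative of \<open>t\<^sup>-\<^sup>k e\<^sup>-\<^sup>1\<^sup>/\<^sup>t\<close> is a combination of two functions of the same family, so the
  algebra generated by coordinates and \<open>flat k (r\<^sup>2 - |x - a|\<^sup>2)\<close> is closed under partial derivatives.\<close>

definition flat :: "nat \<Rightarrow> real \<Rightarrow> real" where
  "flat k t = (if t > 0 then (1 / t) ^ k * exp (- (1 / t)) else 0)"

lemma flat_deriv: "(flat k has_real_derivative (flat (k + 2) t - real k * flat (k + 1) t)) (at t)"
proof -
  consider "t > 0" | "t < 0" | "t = 0" by linarith
  then show ?thesis
  proof cases
    case 1
    have d: "((\<lambda>t. 1 / t) has_real_derivative - ((1 / t)\<^sup>2)) (at t)"
      using DERIV_inverse[of t UNIV] 1 by (simp add: inverse_eq_divide power2_eq_square)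
    have e: "((\<lambda>t. exp (- (1 / t))) has_real_derivative exp (- (1 / t)) * (1 / t)\<^sup>2) (at t)"
      using DERIV_fun_exp[OF DERIV_minus[OF d]] by simp
    have p: "((\<lambda>t. (1 / t) ^ k) has_real_derivative - real k * (1 / t) ^ (k + 1)) (at t)"
    proof (cases k)
      case (Suc n)
      have q: "- real k * y ^ (k + 1) = real k * (- (y\<^sup>2) * y ^ (k - Suc 0))" for y :: real
        by (simp add: Suc power2_eq_square algebra_simps)
      show ?thesis unfolding q[of "1 / t"] using DERIV_power[OF d, of k] .
    qed simp
    have "- real k * y ^ (k + 1) * z + z * y\<^sup>2 * y ^ k = y ^ (k + 2) * z - real k * (y ^ (k + 1) * z)" for y z :: real
      by (simp add: power2_eq_square)
    then have "((\<lambda>t. (1 / t) ^ k * exp (- (1 / t))) has_real_derivative (flat (k + 2) t - real k * flat (k + 1) t)) (at t)"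
      using DERIV_mult[OF p e] 1 by (simp only: flat_def if_True)
    then show ?thesis
      by (rule has_field_derivative_transform_within_open[where S="{0<..}"]) (use 1 in \<open>auto simp: flat_def\<close>)
  next
    case 2
    have "((\<lambda>t. 0) has_real_derivative (flat (k + 2) t - real k * flat (k + 1) t)) (at t)"
      using 2 by (auto simp: flat_def)
    then show ?thesis
      by (rule has_field_derivative_transform_within_open[where S="{..<0}"]) (use 2 in \<open>auto simp: flat_def\<close>)
  next
    case 3
    \<comment> \<open>At 0 the difference quotient is \<open>flat k t / t\<close>. For positive t
      this is s^(k+1) exp(-s) with s = 1/t, and it tends to 0 as s grows.\<close>
    have "((\<lambda>t::real. inverse t ^ (k + 1) / exp (inverse t)) \<longlongrightarrow> 0) (at_right 0)"
      using filterlim_compose[OF tendsto_power_div_exp_0[of "k + 1"] filterlim_inverse_at_top_right] .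
    then have "((\<lambda>t::real. (1 / t) ^ (k + 1) * exp (- (1 / t))) \<longlongrightarrow> 0) (at_right 0)"
      by (simp add: inverse_eq_divide exp_minus)
    moreover have "\<forall>\<^sub>F t::real in at_right 0. (1 / t) ^ (k + 1) * exp (- (1 / t)) = flat k t / t"
      using eventually_at_right_less[of "0::real"] by eventually_elim (simp add: flat_def)
    ultimately have r: "((\<lambda>t. flat k t / t) \<longlongrightarrow> 0) (at_right 0)"
      by (rule Lim_transform_eventually)
    have "\<forall>\<^sub>F t::real in at_left 0. flat k t / t = 0"
      by (simp add: eventually_at_filter flat_def)
    then have l: "((\<lambda>t. flat k t / t) \<longlongrightarrow> 0) (at_left 0)" by (rule tendsto_eventually)
    have "((\<lambda>t. flat k t / t) \<longlongrightarrow> 0) (at 0)" using l r by (simp add: filterlim_split_at)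
    then show ?thesis using 3 by (simp add: has_field_derivative_iff flat_def)
  qed
qed

inductive_set bump_algebra :: "real^'n::finite \<Rightarrow> real \<Rightarrow> (real^'n \<Rightarrow> real) set" for a r where
  const: "(\<lambda>x. c) \<in> bump_algebra a r"
| coord: "(\<lambda>x. x $ i) \<in> bump_algebra a r"
| flat: "(\<lambda>x. flat k (r\<^sup>2 - (norm (x - a))\<^sup>2)) \<in> bump_algebra a r"
| add: "g \<in> bump_algebra a r \<Longrightarrow> h \<in> bump_algebra a r \<Longrightarrow> (\<lambda>x. g x + h x) \<in> bump_algebra a r"
| mult: "g \<in> bump_algebra a r \<Longrightarrow> h \<in> bump_algebra a r \<Longrightarrow> (\<lambda>x. g x * h x) \<in> bump_algebra a r"

lemma bump_algebra_closed:
  fixes a :: "real^'n::finite"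
  shows "g \<in> bump_algebra a r \<Longrightarrow> g differentiable (at x) \<and> partial i g \<in> bump_algebra a r"
proof (induction arbitrary: x i rule: bump_algebra.induct)
  case (const c)
  have D: "((\<lambda>x. c) has_derivative (\<lambda>y. 0)) (at x)" for x :: "real^'n" by simp
  show ?case by (rule partial_mem[OF D]) (rule bump_algebra.const)
next
  case (coord j)
  have D: "((\<lambda>x. x $ j) has_derivative (\<lambda>y. y $ j)) (at x)" for x :: "real^'n"
    by (intro bounded_linear.has_derivative[OF bounded_linear_vec_nth] derivative_intros)
  show ?case by (rule partial_mem[OF D]) (rule bump_algebra.const)
next
  case (flat k)
  have D: "((\<lambda>x. flat k (r\<^sup>2 - (norm (x - a))\<^sup>2)) has_derivative
     (\<lambda>y. (flat (k + 2) (r\<^sup>2 - (norm (x - a))\<^sup>2) - real k * flat (k + 1) (r\<^sup>2 - (norm (x - a))\<^sup>2)) * (- 2 * ((x - a) \<bullet> y)))) (at x)" for x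
  proof -
    have 1: "((\<lambda>x. r\<^sup>2 - (norm (x - a))\<^sup>2) has_derivative (\<lambda>y. - 2 * ((x - a) \<bullet> y))) (at x)"
      unfolding power2_norm_eq_inner
      by (auto intro!: derivative_eq_intros simp: inner_commute)
    show ?thesis
      using diff_chain_at[OF 1 flat_deriv[of k "r\<^sup>2 - (norm (x - a))\<^sup>2", unfolded has_field_derivative_def]]
      by (simp add: o_def)
  qed
  \<comment> \<open>The derivative is rewritten with sums and products only, so that it matches the
    rules generating \<open>bump_algebra\<close>.\<close>
  have "(\<lambda>x. (flat (k + 2) (r\<^sup>2 - (norm (x - a))\<^sup>2) + (- real k) * flat (k + 1) (r\<^sup>2 - (norm (x - a))\<^sup>2)) * (- 2 * (x $ i + (- a $ i))))
      \<in> bump_algebra a r"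
    by (intro bump_algebra.intros)
  then show ?case by (intro partial_mem[OF D]) (simp add: inner_axis)
next
  case (add g h)
  have d: "(g has_derivative frechet_derivative g (at x)) (at x)" "(h has_derivative frechet_derivative h (at x)) (at x)" for x
    using add frechet_derivative_works by blast+
  have D: "((\<lambda>x. g x + h x) has_derivative (\<lambda>y. frechet_derivative g (at x) y + frechet_derivative h (at x) y)) (at x)" for x
    by (intro derivative_intros d)
  show ?case by (rule partial_mem[OF D]) (use add bump_algebra.add[of "partial i g" a r "partial i h"] in blast)
next
  case (mult g h)
  have d: "(g has_derivative frechet_derivative g (at x)) (at x)" "(h has_derivative frechet_derivative h (at x)) (at x)" for x
    using mult frechet_derivative_works by blast+
  have D: "((\<lambda>x. g x * h x) has_derivative (\<lambda>y. g x * frechet_derivative h (at x) y + frechet_derivative g (at x) y * h x)) (at x)" for x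
    by (intro derivative_intros d)
  have "(\<lambda>x. g x * partial i h x + partial i g x * h x) \<in> bump_algebra a r"
    by (rule bump_algebra.add; rule bump_algebra.mult) (use mult in auto)
  then show ?case by (rule partial_mem[OF D])
qed

definition bump :: "real^'n::finite \<Rightarrow> real \<Rightarrow> real^'n \<Rightarrow> real" where
  "bump a r x = flat 0 (r\<^sup>2 - (norm (x - a))\<^sup>2)"

lemma smooth_bump: "smooth_fun (bump a r)"
proof (rule smooth_coinduct)
  show "bump a r \<in> bump_algebra a r" unfolding bump_def[abs_def] by (rule bump_algebra.flat)
qed (simp_all add: bump_algebra_closed)

lemma bump_nonzero_iff: "r > 0 \<Longrightarrow> bump a r x \<noteq> 0 \<longleftrightarrow> x \<in> ball a r"
proof -
  assume r: "r > 0"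
  have "(norm (x - a))\<^sup>2 < r\<^sup>2 \<longleftrightarrow> norm (x - a) < r"
    using r power2_less_imp_less[of "norm (x - a)" r] power_strict_mono[of "norm (x - a)" r 2] by auto
  then show ?thesis by (simp add: bump_def flat_def dist_norm norm_minus_commute)
qed

section \<open>Operations on test functions\<close>

lemma test_fun_bump:
  assumes "r > 0" "cball a r \<subseteq> D" shows "bump a r \<in> test_fun D"
proof -
  have "{x. bump a r x \<noteq> 0} = ball a r" by (auto simp: bump_nonzero_iff assms)
  then show ?thesis using smooth_bump assms by (simp add: test_fun_def)
qed

lemma test_fun_smooth: "\<phi> \<in> test_fun D \<Longrightarrow> smooth_fun \<phi>" by (simp add: test_fun_def)

lemma test_fun_lincomb:
  assumes f: "f \<in> test_fun D" and g: "g \<in> test_fun D"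
  shows "(\<lambda>x. a * f x + c * g x) \<in> test_fun D"
proof -
  have "closure {x. a * f x + c * g x \<noteq> 0} \<subseteq> closure ({x. f x \<noteq> 0} \<union> {x. g x \<noteq> 0})"
    by (intro closure_mono) auto
  then have s: "closure {x. a * f x + c * g x \<noteq> 0} \<subseteq> closure {x. f x \<noteq> 0} \<union> closure {x. g x \<noteq> 0}" by simp
  \<comment> \<open>A closed subset of a compact set, presented as its intersection with that
    set.\<close>
  have "compact (closure {x. a * f x + c * g x \<noteq> 0})"
    by (rule closed_Int_compact[of "closure {x. a * f x + c * g x \<noteq> 0}" "closure {x. f x \<noteq> 0} \<union> closure {x. g x \<noteq> 0}", simplified Int_absorb2[OF s]])
       (use f g in \<open>auto simp: test_fun_def\<close>)
  then show ?thesis using s f g smooth_lincomb by (auto simp: test_fun_def)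
qed

lemma test_fun_pullback:
  fixes D :: "(real^'n::finite) set" and L :: "real^'n \<Rightarrow> real^'n"
  assumes f: "f \<in> test_fun D" and L: "linear L" "bij L" and E: "L ` E = D"
  shows "(\<lambda>x. f (L x)) \<in> test_fun E"
proof -
  define K where "K = inv L"
  have K: "linear K" "\<And>x. L (K x) = x" "\<And>x. K (L x) = x"
    unfolding K_def using inj_linear_imp_inv_linear[OF L(1) bij_is_inj[OF L(2)]]
      surj_f_inv_f[OF bij_is_surj[OF L(2)]] inv_f_f[OF bij_is_inj[OF L(2)]] by auto
  let ?C = "K ` closure {x. f x \<noteq> 0}"
  have cC: "compact ?C"
    using f K(1) by (intro compact_continuous_image linear_continuous_on) (auto simp: test_fun_def linear_conv_bounded_linear)
  have "{x. f (L x) \<noteq> 0} \<subseteq> ?C"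
  proof
    fix x assume "x \<in> {x. f (L x) \<noteq> 0}"
    then have "L x \<in> closure {x. f x \<noteq> 0}" using closure_subset[of "{x. f x \<noteq> 0}"] by auto
    then show "x \<in> ?C" by (rule rev_image_eqI) (simp add: K)
  qed
  then have cl: "closure {x. f (L x) \<noteq> 0} \<subseteq> ?C" by (rule closure_minimal) (rule compact_imp_closed[OF cC])
  moreover have "?C \<subseteq> E"
  proof -
    have "?C \<subseteq> K ` (L ` E)" using f E by (auto simp: test_fun_def)
    also have "\<dots> = E" by (simp add: image_image K)
    finally show ?thesis .
  qed
  moreover have "compact (closure {x. f (L x) \<noteq> 0})"
    using compact_closure bounded_subset[OF compact_imp_bounded[OF cC]] cl closure_subset by blast
  ultimately show ?thesis using smooth_linear_pullback[OF L(1) test_fun_smooth[OF f]] by (auto simp: test_fun_def)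
qed

lemma test_fun_support: 
  assumes "\<phi> \<in> test_fun D" obtains R where "\<And>x. norm x > R \<Longrightarrow> \<phi> x = 0" "R > 0"
proof -
  have "bounded (closure {x. \<phi> x \<noteq> 0})" using assms by (simp add: test_fun_def compact_imp_bounded)
  then obtain R where "R > 0" "\<forall>x\<in>closure {x. \<phi> x \<noteq> 0}. norm x \<le> R" using bounded_pos by blast
  then show ?thesis using that[of R] closure_subset[of "{x. \<phi> x \<noteq> 0}"] by force
qed

lemma test_fun_zero_outside: "\<phi> \<in> test_fun D \<Longrightarrow> x \<notin> D \<Longrightarrow> \<phi> x = 0"
  using closure_subset[of "{x. \<phi> x \<noteq> 0}"] by (auto simp: test_fun_def)

lemma test_fun_partial: assumes "\<phi> \<in> test_fun D" shows "partial i \<phi> \<in> test_fun D"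
proof -
  have z: "partial i \<phi> x = 0" if "x \<notin> closure {x. \<phi> x \<noteq> 0}" for x
  proof -
    have "((\<lambda>x. 0) has_derivative (\<lambda>y. 0)) (at x)" by simp
    then have "(\<phi> has_derivative (\<lambda>y. 0)) (at x)"
      by (rule has_derivative_transform_within_open[where s="- closure {x. \<phi> x \<noteq> 0}"])
         (use that closure_subset[of "{x. \<phi> x \<noteq> 0}"] in auto)
    then show ?thesis by (rule partial_eq)
  qed
  have s: "closure {x. partial i \<phi> x \<noteq> 0} \<subseteq> closure {x. \<phi> x \<noteq> 0}"
    by (rule closure_minimal) (use z in auto)
  have "compact (closure {x. partial i \<phi> x \<noteq> 0})"
    by (rule closed_Int_compact[of "closure {x. partial i \<phi> x \<noteq> 0}" "closure {x. \<phi> x \<noteq> 0}", simplified Int_absorb2[OF s]])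
       (use assms in \<open>auto simp: test_fun_def\<close>)
  then show ?thesis using s assms smooth_partial by (auto simp: test_fun_def)
qed

lemma test_fun_bounded: assumes "\<phi> \<in> test_fun D" obtains B where "\<And>x. \<bar>\<phi> x\<bar> \<le> B" "B \<ge> 0"
proof -
  obtain R where R: "\<And>x. norm x > R \<Longrightarrow> \<phi> x = 0" "R > 0" using test_fun_support[OF assms] by auto
  have "compact (\<phi> ` cball 0 R)"
    by (intro compact_continuous_image smooth_continuous test_fun_smooth[OF assms]) simp
  then obtain B where B: "B > 0" "\<forall>y\<in>\<phi> ` cball 0 R. norm y \<le> B" using bounded_pos compact_imp_bounded by blast
  have "\<bar>\<phi> x\<bar> \<le> B" for x by (cases "norm x > R") (use R B in auto)
  then show ?thesis using that B(1) by force
qed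

text \<open>Mean value inequality with the sum of the bounds of the partials, which are again test
  functions. It bounds difference quotients uniformly in the step.\<close>

lemma test_fun_Lipschitz: 
  fixes \<phi> :: "real^'n::finite \<Rightarrow> real"
  assumes "\<phi> \<in> test_fun D" obtains K where "K \<ge> 0" "\<And>x y. \<bar>\<phi> x - \<phi> y\<bar> \<le> K * norm (x - y)"
proof -
  have "\<forall>i. \<exists>B. \<forall>x. \<bar>partial i \<phi> x\<bar> \<le> B" using test_fun_bounded[OF test_fun_partial[OF assms]] by metis
  then obtain B where B: "\<And>i x. \<bar>partial i \<phi> x\<bar> \<le> B i" by metis
  let ?K = "\<Sum>i\<in>UNIV. B i"
  have "\<bar>\<phi> x - \<phi> y\<bar> \<le> ?K * norm (x - y)" for x y
  proof -
    have "norm (\<phi> x - \<phi> y) \<le> ?K * norm (x - y)"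
    proof (rule differentiable_bound[where S=UNIV])
      show "(\<phi> has_derivative frechet_derivative \<phi> (at x)) (at x within UNIV)" for x
        using smooth_has_derivative[OF test_fun_smooth[OF assms]] by simp
      show "onorm (frechet_derivative \<phi> (at x)) \<le> ?K" for x
      proof (rule onorm_bound)
        have "0 \<le> B i" for i by (rule order_trans[OF abs_ge_zero B])
        then show "0 \<le> ?K" by (intro sum_nonneg) auto
        fix h
        have "norm (frechet_derivative \<phi> (at x) h) \<le> (\<Sum>i\<in>UNIV. \<bar>h $ i * partial i \<phi> x\<bar>)"
          by (subst frechet_derivative_partials[OF smooth_differentiable[OF test_fun_smooth[OF assms]]]) simp
        also have "\<dots> \<le> (\<Sum>i\<in>UNIV. norm h * B i)"
          using B component_le_norm_cart[of h] by (intro sum_mono) (auto simp: abs_mult intro!: mult_mono)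
        finally show "norm (frechet_derivative \<phi> (at x) h) \<le> ?K * norm h" by (simp add: sum_distrib_left mult.commute)
      qed
    qed auto
    then show ?thesis by simp
  qed
  moreover have "?K \<ge> 0" using order_trans[OF abs_ge_zero B] by (intro sum_nonneg) auto
  ultimately show ?thesis using that by blast
qed

lemma test_fun_borel: "\<phi> \<in> test_fun D \<Longrightarrow> \<phi> \<in> borel_measurable borel"
  by (intro borel_measurable_continuous_onI smooth_continuous test_fun_smooth)

lemma bounded_support_integrable:
  fixes f :: "'a::euclidean_space \<Rightarrow> real"
  assumes [measurable]: "f \<in> borel_measurable borel" and "\<And>x. \<bar>f x\<bar> \<le> B" and "\<And>x. norm x > R \<Longrightarrow> f x = 0"
  shows "integrable lborel f"
proof (rule Bochner_Integration.integrable_bound)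
  show "integrable lborel (\<lambda>x. B * indicator (cball 0 R) x :: real)"
    by (intro integrable_mult_right integrable_real_indicator) (use emeasure_bounded_finite[OF bounded_cball] in auto)
  show "AE x in lborel. norm (f x) \<le> norm (B * indicator (cball 0 R) x :: real)"
    using assms(2,3) by (intro AE_I2) (auto simp: indicator_def intro: order_trans[OF _ abs_ge_self])
qed simp

lemma test_fun_integrable: 
  assumes "\<phi> \<in> test_fun D" 
  shows "integrable lborel \<phi>" "integrable lborel (\<lambda>x. (\<phi> x)\<^sup>2)"
proof -
  obtain R where R: "\<And>x. norm x > R \<Longrightarrow> \<phi> x = 0" using test_fun_support[OF assms] by metis
  obtain B where B: "\<And>x. \<bar>\<phi> x\<bar> \<le> B" using test_fun_bounded[OF assms] by metis
  have [measurable]: "\<phi> \<in> borel_measurable borel" by (rule test_fun_borel[OF assms])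
  show "integrable lborel \<phi>" by (rule bounded_support_integrable[OF _ B R]) auto
  show "integrable lborel (\<lambda>x. (\<phi> x)\<^sup>2)"
    by (rule bounded_support_integrable[of _ "B\<^sup>2" R]) (use B R in \<open>auto intro: power_mono[of "\<bar>\<phi> _\<bar>" B 2, simplified]\<close>)
qed

text \<open>Parseval for difference quotients, instead of an integration by parts.\<close>

lemma test_fun_gradient:
  fixes \<phi> :: "real^'n::finite \<Rightarrow> real"
  assumes \<phi>: "\<phi> \<in> test_fun D"
  shows "integrable lborel (\<lambda>\<xi>. (2 * pi * (\<xi> $ i))\<^sup>2 * (norm (ft \<phi> \<xi>))\<^sup>2)"
proof -
  obtain R where R: "\<And>x. norm x > R \<Longrightarrow> \<phi> x = 0" using test_fun_support[OF assms] by metis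
  obtain K where K: "K \<ge> 0" "\<And>x y. \<bar>\<phi> x - \<phi> y\<bar> \<le> K * norm (x - y)" using test_fun_Lipschitz[OF assms] by auto
  have [measurable]: "\<phi> \<in> borel_measurable borel" by (rule test_fun_borel[OF assms])
  note ip = test_fun_integrable[OF \<phi>]
  let ?h = "\<lambda>k::nat. 1 / real (Suc k)"
  \<comment> \<open>Difference quotient in direction \<open>i\<close> with step
    \<open>1 / (k + 1)\<close>. It is bounded by the Lipschitz constant and supported in a ball of
    radius \<open>R + 1\<close>, uniformly in \<open>k\<close>; hence its square integrals are
    bounded uniformly too.\<close>
  define d where "d k x = real (Suc k) * \<phi> (x + ?h k *\<^sub>R axis i 1) - real (Suc k) * \<phi> x" for k x
  have [measurable]: "d k \<in> borel_measurable borel" for k unfolding d_def[abs_def] by measurable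
  have dK: "\<bar>d k x\<bar> \<le> K" for k x
  proof -
    have "\<bar>d k x\<bar> = real (Suc k) * \<bar>\<phi> (x + ?h k *\<^sub>R axis i 1) - \<phi> x\<bar>"
      unfolding d_def by (simp add: right_diff_distrib[symmetric] abs_mult del: of_nat_Suc)
    also have "\<dots> \<le> real (Suc k) * (K * norm ((x + ?h k *\<^sub>R axis i 1) - x))" by (intro mult_left_mono K) auto
    also have "\<dots> = K" by (simp del: of_nat_Suc)
    finally show ?thesis .
  qed
  have dR: "d k x = 0" if "norm x > R + 1" for k x
  proof -
    have "norm (?h k *\<^sub>R (axis i 1 :: real^'n)) \<le> 1" by simp
    then have "norm (x + ?h k *\<^sub>R axis i 1) > R" using that norm_diff_ineq[of x "?h k *\<^sub>R axis i 1"] by linarith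
    then show ?thesis using R that by (simp add: d_def)
  qed
  have d1: "integrable lborel (d k)" for k by (rule bounded_support_integrable[OF _ dK dR]) auto
  have d2le: "(d k x)\<^sup>2 \<le> K\<^sup>2 * indicator (cball 0 (R + 1)) x" for k x
    using dR[of x k] power_mono[OF dK abs_ge_zero, of k x 2] by (auto simp: indicator_def)
  have iK: "integrable lborel (\<lambda>x::real^'n. K\<^sup>2 * indicator (cball 0 (R + 1)) x :: real)"
    by (intro integrable_mult_right integrable_real_indicator) (use emeasure_bounded_finite[OF bounded_cball] in auto)
  have d2: "integrable lborel (\<lambda>x. (d k x)\<^sup>2)" for k
    by (rule Bochner_Integration.integrable_bound[OF iK]) (use d2le in \<open>auto intro: order_trans[OF _ abs_ge_self]\<close>)
  define C where "C = (LINT x|lborel. K\<^sup>2 * indicator (cball (0::real^'n) (R + 1)) x)"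
  have "(LINT x|lborel. (d k x)\<^sup>2) \<le> C" for k unfolding C_def by (rule integral_mono[OF d2 iK d2le])
  then have P: "integrable lborel (\<lambda>\<xi>. (norm (ft (d k) \<xi>))\<^sup>2)" "(LINT \<xi>|lborel. (norm (ft (d k) \<xi>))\<^sup>2) \<le> C" for k
    using Plancherel[OF d1 d2] by auto
  have shift: "ft (\<lambda>x. \<phi> (x + t)) \<xi> = cis (2 * pi * (t \<bullet> \<xi>)) * ft \<phi> \<xi>" for t \<xi>
  proof -
    have "ft (\<lambda>x. \<phi> (x + t)) \<xi> = (LINT x|lborel. cis (2 * pi * (t \<bullet> \<xi>)) * (complex_of_real (\<phi> (x + t)) * cis (- 2 * pi * ((x + t) \<bullet> \<xi>))))"
      unfolding ft_def
    proof (rule Bochner_Integration.integral_cong[OF refl])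
      fix x
      have "cis (- 2 * pi * (x \<bullet> \<xi>)) = cis (2 * pi * (t \<bullet> \<xi>)) * cis (- 2 * pi * ((x + t) \<bullet> \<xi>))"
        by (simp add: cis_mult inner_add_left algebra_simps)
      then show "complex_of_real (\<phi> (x + t)) * cis (- 2 * pi * (x \<bullet> \<xi>)) = cis (2 * pi * (t \<bullet> \<xi>)) * (complex_of_real (\<phi> (x + t)) * cis (- 2 * pi * ((x + t) \<bullet> \<xi>)))"
        by (simp only: mult_ac)
    qed
    also have "\<dots> = cis (2 * pi * (t \<bullet> \<xi>)) * (LINT x|lborel. complex_of_real (\<phi> (x + t)) * cis (- 2 * pi * ((x + t) \<bullet> \<xi>)))"
      by (rule integral_mult_right_zero)
    also have "(LINT x|lborel. complex_of_real (\<phi> (x + t)) * cis (- 2 * pi * ((x + t) \<bullet> \<xi>))) = ft \<phi> \<xi>"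
      unfolding ft_def by (rule integral_lborel_shift(2)) measurable
    finally show ?thesis .
  qed
  have ftd: "ft (d k) \<xi> = of_real (real (Suc k)) * (cis (2 * pi * (\<xi> $ i) * ?h k) - 1) * ft \<phi> \<xi>" for k \<xi>
  proof -
    have s: "integrable lborel (\<lambda>x. \<phi> (x + ?h k *\<^sub>R axis i 1))" using integral_lborel_shift(1)[of \<phi>] ip by simp
    have "d k = (\<lambda>x. real (Suc k) * \<phi> (x + ?h k *\<^sub>R axis i 1) + (- real (Suc k)) * \<phi> x)"
      by (rule ext) (simp add: d_def del: of_nat_Suc)
    then have "ft (d k) \<xi> = of_real (real (Suc k)) * ft (\<lambda>x. \<phi> (x + ?h k *\<^sub>R axis i 1)) \<xi> + of_real (- real (Suc k)) * ft \<phi> \<xi>"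
      using ft_lincomb[OF s ip(1), of "real (Suc k)" "- real (Suc k)" \<xi>] by (simp del: of_nat_Suc)
    then show ?thesis unfolding shift by (simp add: inner_axis' algebra_simps del: of_nat_Suc)
  qed
  \<comment> \<open>The Fourier multiplier of the difference quotient tends to that of the
    derivative; this is the derivative of exp at 0.\<close>
  have lim: "(\<lambda>k. of_real (real (Suc k)) * (cis (t * ?h k) - 1)) \<longlonglongrightarrow> \<i> * of_real t" for t
    proof (cases "t = 0")
      case False
      let ?z = "\<lambda>k. \<i> * of_real (t * ?h k)"
      have "((\<lambda>z::complex. (exp z - 1) / z) \<longlongrightarrow> 1) (at 0)"
        using DERIV_exp[of "0::complex"] by (simp add: has_field_derivative_iff)
      moreover have "filterlim ?z (at 0) sequentially"
      proof -
        have nz: "?z k \<noteq> 0" for k using False by (simp del: of_nat_Suc)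
        have "?z \<longlonglongrightarrow> \<i> * of_real (t * 0)" by (intro tendsto_intros LIMSEQ_Suc[OF lim_1_over_n])
        then have "?z \<longlonglongrightarrow> 0" by simp
        then show ?thesis by (rule filterlim_atI) (rule always_eventually, rule allI, rule nz)
      qed
      ultimately have "(\<lambda>k. (exp (?z k) - 1) / ?z k) \<longlonglongrightarrow> 1" by (rule filterlim_compose)
      then have "(\<lambda>k. \<i> * of_real t * ((exp (?z k) - 1) / ?z k)) \<longlonglongrightarrow> \<i> * of_real t * 1" by (intro tendsto_intros)
      moreover have "\<i> * of_real t * ((exp (?z k) - 1) / ?z k) = of_real (real (Suc k)) * (cis (t * ?h k) - 1)" for k
        using False by (simp add: cis_conv_exp field_simps del: of_nat_Suc)
      ultimately show ?thesis by simp
    qed simp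
  have "(\<lambda>k. (norm (ft (d k) \<xi>))\<^sup>2) \<longlonglongrightarrow> (norm (\<i> * of_real (2 * pi * (\<xi> $ i)) * ft \<phi> \<xi>))\<^sup>2" for \<xi>
    unfolding ftd by (intro tendsto_intros lim)
  moreover have "(norm (\<i> * of_real (2 * pi * (\<xi> $ i)) * ft \<phi> \<xi>))\<^sup>2 = (2 * pi * (\<xi> $ i))\<^sup>2 * (norm (ft \<phi> \<xi>))\<^sup>2" for \<xi>
    by (simp add: norm_mult power_mult_distrib)
  ultimately have l: "AE \<xi> in lborel. (\<lambda>k. (norm (ft (d k) \<xi>))\<^sup>2) \<longlonglongrightarrow> (2 * pi * (\<xi> $ i))\<^sup>2 * (norm (ft \<phi> \<xi>))\<^sup>2"
    by (intro AE_I2) simp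
  show ?thesis by (rule Fatou_bound(1)[OF P(1) _ l]) (auto intro!: always_eventually P(2))
qed

section \<open>The form domain\<close>

abbreviation sobolev_weight :: "real \<Rightarrow> real^'n::finite \<Rightarrow> real" where
  "sobolev_weight s \<xi> \<equiv> (1 + (2 * pi * norm \<xi>)\<^sup>2) powr s"

lemma sobolev_weight_ge_1: "0 \<le> s \<Longrightarrow> 1 \<le> sobolev_weight s \<xi>"
  by (rule ge_one_powr_ge_zero) auto

lemma sobolev_weight_measurable: "sobolev_weight s \<in> borel_measurable lebesgue"
  by (rule measurable_completion) measurable

lemma in_HD:
  assumes "in_H s u"
  shows "integrable lebesgue u" "integrable lebesgue (\<lambda>x. (u x)\<^sup>2)"
    "integrable lebesgue (\<lambda>\<xi>. sobolev_weight s \<xi> * (cmod (fourier u \<xi>))\<^sup>2)" "u \<in> borel_measurable lebesgue"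
    "fourier u \<in> borel_measurable lebesgue"
  using assms fourier_measurable_lebesgue[of u] by (auto simp: in_H_def)

text \<open>\<open>H_norm2\<close> is a squared norm. The factor 2 comes from |a + b|^2 \<le> 2|a|^2
  + 2|b|^2, used in place of the triangle inequality; it does no harm in limits.\<close>

lemma in_H_lincomb:
  assumes u: "in_H s u" and v: "in_H s v"
  shows "in_H s (\<lambda>x. a * u x + c * v x)"
    and "H_norm2 s (\<lambda>x. a * u x + c * v x) \<le> 2 * a\<^sup>2 * H_norm2 s u + 2 * c\<^sup>2 * H_norm2 s v"
proof -
  note iu = in_HD[OF u] and iv = in_HD[OF v]
  note [measurable] = iu(4,5) iv(4,5) sobolev_weight_measurable
  let ?g = "\<lambda>\<xi>. (2 * a\<^sup>2) * (sobolev_weight s \<xi> * (cmod (fourier u \<xi>))\<^sup>2) + (2 * c\<^sup>2) * (sobolev_weight s \<xi> * (cmod (fourier v \<xi>))\<^sup>2)"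
  have ig: "integrable lebesgue ?g" using iu iv by simp
  have F: "fourier (\<lambda>x. a * u x + c * v x) = (\<lambda>\<xi>. of_real a * fourier u \<xi> + of_real c * fourier v \<xi>)"
    by (rule ext, rule fourier_lincomb[OF iu(1) iv(1)])
  have le: "sobolev_weight s \<xi> * (cmod (fourier (\<lambda>x. a * u x + c * v x) \<xi>))\<^sup>2 \<le> ?g \<xi>" for \<xi>
  proof -
    have "(cmod (of_real a * fourier u \<xi> + of_real c * fourier v \<xi>))\<^sup>2 \<le> 2 * (a\<^sup>2 * (cmod (fourier u \<xi>))\<^sup>2) + 2 * (c\<^sup>2 * (cmod (fourier v \<xi>))\<^sup>2)"
      using norm_add_square_le[of "of_real a * fourier u \<xi>" "of_real c * fourier v \<xi>"] by (simp add: norm_mult power_mult_distrib)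
    then have "sobolev_weight s \<xi> * (cmod (fourier (\<lambda>x. a * u x + c * v x) \<xi>))\<^sup>2 \<le>
       sobolev_weight s \<xi> * (2 * (a\<^sup>2 * (cmod (fourier u \<xi>))\<^sup>2) + 2 * (c\<^sup>2 * (cmod (fourier v \<xi>))\<^sup>2))"
      unfolding F by (rule mult_left_mono) simp
    then show ?thesis by (simp add: algebra_simps)
  qed
  have i: "integrable lebesgue (\<lambda>\<xi>. sobolev_weight s \<xi> * (cmod (fourier (\<lambda>x. a * u x + c * v x) \<xi>))\<^sup>2)"
  proof (rule Bochner_Integration.integrable_bound[OF ig])
    show "(\<lambda>\<xi>. sobolev_weight s \<xi> * (cmod (fourier (\<lambda>x. a * u x + c * v x) \<xi>))\<^sup>2) \<in> borel_measurable lebesgue"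
      unfolding F by measurable
    show "AE \<xi> in lebesgue. norm (sobolev_weight s \<xi> * (cmod (fourier (\<lambda>x. a * u x + c * v x) \<xi>))\<^sup>2) \<le> norm (?g \<xi>)"
      by (intro AE_I2) (use le in \<open>auto intro: order_trans[OF _ abs_ge_self]\<close>)
  qed
  have "integrable lebesgue (\<lambda>x. (a * u x - (- c * v x))\<^sup>2)"
    using square_diff_integrable[of "\<lambda>x. a * u x" lebesgue "\<lambda>x. - c * v x"] iu iv
    by (simp add: power_mult_distrib)
  then show "in_H s (\<lambda>x. a * u x + c * v x)"
    unfolding in_H_def using iu iv i by simp
  show "H_norm2 s (\<lambda>x. a * u x + c * v x) \<le> 2 * a\<^sup>2 * H_norm2 s u + 2 * c\<^sup>2 * H_norm2 s v"
    unfolding H_norm2_def using integral_mono[OF i ig le] iu iv by simp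
qed

lemma in_H_diff:
  assumes u: "in_H s u" and v: "in_H s v"
  shows "in_H s (\<lambda>x. u x - v x)" "H_norm2 s (\<lambda>x. u x - v x) \<le> 2 * H_norm2 s u + 2 * H_norm2 s v"
  using in_H_lincomb[OF assms, of 1 "-1"] by simp_all

lemma H_norm2_nonneg: "0 \<le> H_norm2 s u"
  unfolding H_norm2_def by (intro Bochner_Integration.integral_nonneg) simp

lemma H_norm2_diff_triangle:
  assumes "in_H s u" "in_H s v" "in_H s w"
  shows "H_norm2 s (\<lambda>x. u x - w x) \<le> 2 * H_norm2 s (\<lambda>x. u x - v x) + 2 * H_norm2 s (\<lambda>x. v x - w x)"
  using in_H_lincomb(2)[OF in_H_diff(1)[OF assms(1,2)] in_H_diff(1)[OF assms(2,3)], of 1 1] by simp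

lemma H_norm2_scale:
  assumes "in_H s u" shows "H_norm2 s (\<lambda>x. c * u x) = c\<^sup>2 * H_norm2 s u"
  using fourier_lincomb[OF in_HD(1)[OF assms] in_HD(1)[OF assms], of c 0]
  unfolding H_norm2_def by (simp add: norm_mult power_mult_distrib mult.left_commute[of _ "c\<^sup>2"])

lemma L2_le_H_norm2:
  assumes "in_H s u" "0 \<le> s"
  shows "(LINT x|lebesgue. (u x)\<^sup>2) \<le> H_norm2 s u"
proof -
  note iu = in_HD[OF assms(1)]
  note P = Plancherel_fourier[OF iu(1,2)]
  have "(cmod (fourier u \<xi>))\<^sup>2 \<le> sobolev_weight s \<xi> * (cmod (fourier u \<xi>))\<^sup>2" for \<xi>
    using mult_right_mono[OF sobolev_weight_ge_1[OF assms(2), of \<xi>], of "(cmod (fourier u \<xi>))\<^sup>2"] by simp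
  then show ?thesis unfolding H_norm2_def using integral_mono[OF P(1) iu(3)] P(2) by simp
qed

lemma norm_square_cart: "(norm (x::real^'n::finite))\<^sup>2 = (\<Sum>i\<in>UNIV. (x $ i)\<^sup>2)"
  unfolding norm_vec_def L2_set_def by (simp add: sum_nonneg)

text \<open>For \<open>s \<le> 1\<close> the weight is at most 1 + |2 pi \<xi>|^2, the sum of 1 and
  the squared coordinates; the terms are covered by Plancherel's identity and by
  \<open>test_fun_gradient\<close>. With \<open>s = \<alpha> / 2\<close> this is a use of
  \<open>\<alpha> \<le> 2\<close>.\<close>

lemma test_fun_in_H:
  fixes \<phi> :: "real^'n::finite \<Rightarrow> real"
  assumes \<phi>: "\<phi> \<in> test_fun D" and s: "s \<le> 1"
  shows "in_H s \<phi>"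
proof -
  note [measurable] = test_fun_borel[OF \<phi>]
  note i = test_fun_integrable[OF \<phi>]
  have F: "fourier \<phi> = ft \<phi>"
    by (rule fourier_eq_ft) (auto intro: measurable_completion)
  note P = Plancherel[OF i]
  have g: "integrable lborel (\<lambda>\<xi>. (norm (ft \<phi> \<xi>))\<^sup>2 + (\<Sum>i\<in>UNIV. (2 * pi * (\<xi> $ i))\<^sup>2 * (norm (ft \<phi> \<xi>))\<^sup>2))"
    using P(1) test_fun_gradient[OF \<phi>] by (intro Bochner_Integration.integrable_add Bochner_Integration.integrable_sum)
  have e: "(norm (ft \<phi> \<xi>))\<^sup>2 + (\<Sum>i\<in>UNIV. (2 * pi * (\<xi> $ i))\<^sup>2 * (norm (ft \<phi> \<xi>))\<^sup>2) = (1 + (2 * pi * norm \<xi>)\<^sup>2) * (norm (ft \<phi> \<xi>))\<^sup>2" for \<xi>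
    by (simp add: power_mult_distrib norm_square_cart sum_distrib_left sum_distrib_right algebra_simps)
  have "integrable lborel (\<lambda>\<xi>. sobolev_weight s \<xi> * (cmod (ft \<phi> \<xi>))\<^sup>2)"
  proof (rule Bochner_Integration.integrable_bound[OF g])
    show "AE \<xi> in lborel. norm (sobolev_weight s \<xi> * (cmod (ft \<phi> \<xi>))\<^sup>2) \<le> norm ((norm (ft \<phi> \<xi>))\<^sup>2 + (\<Sum>i\<in>UNIV. (2 * pi * (\<xi> $ i))\<^sup>2 * (norm (ft \<phi> \<xi>))\<^sup>2))"
    proof (rule AE_I2)
      fix \<xi> :: "real^'n"
      have "sobolev_weight s \<xi> \<le> sobolev_weight 1 \<xi>" by (rule powr_mono) (use s in auto)
      then have "sobolev_weight s \<xi> \<le> 1 + (2 * pi * norm \<xi>)\<^sup>2" by (simp add: add_nonneg_pos)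
      then have "sobolev_weight s \<xi> * (cmod (ft \<phi> \<xi>))\<^sup>2 \<le> (1 + (2 * pi * norm \<xi>)\<^sup>2) * (cmod (ft \<phi> \<xi>))\<^sup>2" by (rule mult_right_mono) simp
      then show "norm (sobolev_weight s \<xi> * (cmod (ft \<phi> \<xi>))\<^sup>2) \<le> norm ((norm (ft \<phi> \<xi>))\<^sup>2 + (\<Sum>i\<in>UNIV. (2 * pi * (\<xi> $ i))\<^sup>2 * (norm (ft \<phi> \<xi>))\<^sup>2))"
        unfolding e by (simp add: abs_mult)
    qed
  qed measurable
  then have "integrable lebesgue (\<lambda>\<xi>. sobolev_weight s \<xi> * (cmod (ft \<phi> \<xi>))\<^sup>2)"
    by (subst integrable_completion) simp_all
  moreover have "integrable lebesgue \<phi>" "integrable lebesgue (\<lambda>x. (\<phi> x)\<^sup>2)"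
    using i by (simp_all add: integrable_completion)
  ultimately show ?thesis by (simp add: in_H_def F)
qed

section \<open>The form domain as a closed subspace\<close>

lemma form_domainD:
  assumes "u \<in> form_domain \<alpha> D"
  shows "in_H (\<alpha>/2) u" "\<And>e. e > 0 \<Longrightarrow> \<exists>\<phi>\<in>test_fun D. H_norm2 (\<alpha>/2) (\<lambda>x. \<phi> x - u x) < e"
proof -
  show "in_H (\<alpha>/2) u" using assms by (simp add: form_domain_def)
  fix e :: real assume e: "e > 0"
  obtain \<phi> where \<phi>: "\<And>k::nat. \<phi> k \<in> test_fun D" "(\<lambda>k. H_norm2 (\<alpha>/2) (\<lambda>x. \<phi> k x - u x)) \<longlonglongrightarrow> 0"
    using assms by (auto simp: form_domain_def)
  have "\<forall>\<^sub>F k in sequentially. H_norm2 (\<alpha>/2) (\<lambda>x. \<phi> k x - u x) < e" by (rule order_tendstoD(2)[OF \<phi>(2) e])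
  then obtain k where "H_norm2 (\<alpha>/2) (\<lambda>x. \<phi> k x - u x) < e" using eventually_happens'[OF sequentially_bot] by blast
  then show "\<exists>\<phi>\<in>test_fun D. H_norm2 (\<alpha>/2) (\<lambda>x. \<phi> x - u x) < e" using \<phi>(1) by blast
qed

lemma form_domainI:
  assumes "in_H (\<alpha>/2) u" "\<And>e. e > 0 \<Longrightarrow> \<exists>\<phi>\<in>test_fun D. H_norm2 (\<alpha>/2) (\<lambda>x. \<phi> x - u x) < e"
  shows "u \<in> form_domain \<alpha> D"
proof -
  have "\<exists>\<phi>\<in>test_fun D. H_norm2 (\<alpha>/2) (\<lambda>x. \<phi> x - u x) < 1 / real (Suc k)" for k by (rule assms(2)) simp
  then obtain \<phi> where \<phi>: "\<And>k::nat. \<phi> k \<in> test_fun D" "\<And>k. H_norm2 (\<alpha>/2) (\<lambda>x. \<phi> k x - u x) < 1 / real (Suc k)"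
    by metis
  have "(\<lambda>k. H_norm2 (\<alpha>/2) (\<lambda>x. \<phi> k x - u x)) \<longlonglongrightarrow> 0"
  proof (rule tendsto_sandwich[OF _ _ tendsto_const LIMSEQ_Suc[OF lim_1_over_n]])
    show "\<forall>\<^sub>F k in sequentially. 0 \<le> H_norm2 (\<alpha>/2) (\<lambda>x. \<phi> k x - u x)" by (simp add: H_norm2_nonneg)
    show "\<forall>\<^sub>F k in sequentially. H_norm2 (\<alpha>/2) (\<lambda>x. \<phi> k x - u x) \<le> 1 / real (Suc k)"
      using \<phi>(2) by (intro always_eventually allI less_imp_le)
  qed
  then show ?thesis using assms(1) \<phi>(1) by (auto simp: form_domain_def)
qed

lemma form_domain_closed:
  assumes a: "\<alpha> \<le> 2" and u: "in_H (\<alpha>/2) u"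
    and ap: "\<And>e. e > 0 \<Longrightarrow> \<exists>v\<in>form_domain \<alpha> D. H_norm2 (\<alpha>/2) (\<lambda>x. v x - u x) < e"
  shows "u \<in> form_domain \<alpha> D"
proof (rule form_domainI[OF u])
  fix e :: real assume e: "e > 0"
  obtain v where v: "v \<in> form_domain \<alpha> D" "H_norm2 (\<alpha>/2) (\<lambda>x. v x - u x) < e / 4" using ap[of "e/4"] e by auto
  obtain \<phi> where \<phi>: "\<phi> \<in> test_fun D" "H_norm2 (\<alpha>/2) (\<lambda>x. \<phi> x - v x) < e / 4" using form_domainD(2)[OF v(1), of "e/4"] e by auto
  have "in_H (\<alpha>/2) \<phi>" using a by (intro test_fun_in_H[OF \<phi>(1)]) simp
  then have "H_norm2 (\<alpha>/2) (\<lambda>x. \<phi> x - u x) \<le> 2 * H_norm2 (\<alpha>/2) (\<lambda>x. \<phi> x - v x) + 2 * H_norm2 (\<alpha>/2) (\<lambda>x. v x - u x)"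
    by (rule H_norm2_diff_triangle[OF _ form_domainD(1)[OF v(1)] u])
  then show "\<exists>\<phi>\<in>test_fun D. H_norm2 (\<alpha>/2) (\<lambda>x. \<phi> x - u x) < e" using v \<phi> by (intro bexI[of _ \<phi>]) auto
qed

lemma test_fun_form_domain:
  assumes "\<phi> \<in> test_fun D" "\<alpha> \<le> 2" shows "\<phi> \<in> form_domain \<alpha> D"
proof (rule form_domainI)
  show i: "in_H (\<alpha>/2) \<phi>" using assms by (intro test_fun_in_H) auto
  have "H_norm2 (\<alpha>/2) (\<lambda>x. \<phi> x - \<phi> x) = 0" using H_norm2_scale[OF i, of 0] by simp
  then show "\<exists>\<psi>\<in>test_fun D. H_norm2 (\<alpha>/2) (\<lambda>x. \<psi> x - \<phi> x) < e" if "e > 0" for e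
    using assms that by (intro bexI[of _ \<phi>]) auto
qed

lemma form_domain_lincomb:
  assumes a: "\<alpha> \<le> 2" and u: "u \<in> form_domain \<alpha> D" and v: "v \<in> form_domain \<alpha> D"
  shows "(\<lambda>x. a * u x + c * v x) \<in> form_domain \<alpha> D"
proof (rule form_domainI)
  note iu = form_domainD(1)[OF u] and iv = form_domainD(1)[OF v]
  show "in_H (\<alpha>/2) (\<lambda>x. a * u x + c * v x)" by (rule in_H_lincomb(1)[OF iu iv])
  fix e :: real assume e: "e > 0"
  \<comment> \<open>The trailing 1 keeps the denominator positive and makes the final inequality
    strict.\<close>
  define d where "d = e / (2 * a\<^sup>2 + 2 * c\<^sup>2 + 1)"
  have den: "2 * a\<^sup>2 + 2 * c\<^sup>2 + 1 > 0" by (simp add: add_nonneg_pos)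
  then have d: "d > 0" using e by (simp add: d_def)
  obtain \<phi> where \<phi>: "\<phi> \<in> test_fun D" "H_norm2 (\<alpha>/2) (\<lambda>x. \<phi> x - u x) < d" using form_domainD(2)[OF u d] by auto
  obtain \<psi> where \<psi>: "\<psi> \<in> test_fun D" "H_norm2 (\<alpha>/2) (\<lambda>x. \<psi> x - v x) < d" using form_domainD(2)[OF v d] by auto
  have i: "in_H (\<alpha>/2) \<phi>" "in_H (\<alpha>/2) \<psi>" using a \<phi> \<psi> by (auto intro!: test_fun_in_H)
  have "H_norm2 (\<alpha>/2) (\<lambda>x. a * (\<phi> x - u x) + c * (\<psi> x - v x)) \<le> 2 * a\<^sup>2 * H_norm2 (\<alpha>/2) (\<lambda>x. \<phi> x - u x) + 2 * c\<^sup>2 * H_norm2 (\<alpha>/2) (\<lambda>x. \<psi> x - v x)"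
    by (rule in_H_lincomb(2)[OF in_H_diff(1)[OF i(1) iu] in_H_diff(1)[OF i(2) iv]])
  also have "\<dots> \<le> 2 * a\<^sup>2 * d + 2 * c\<^sup>2 * d"
    using \<phi>(2) \<psi>(2) by (intro add_mono mult_left_mono) auto
  also have "\<dots> < (2 * a\<^sup>2 + 2 * c\<^sup>2 + 1) * d" using d by (simp add: algebra_simps)
  also have "\<dots> = e" using den by (simp add: d_def)
  finally have "H_norm2 (\<alpha>/2) (\<lambda>x. (a * \<phi> x + c * \<psi> x) - (a * u x + c * v x)) < e" by (simp add: algebra_simps)
  then show "\<exists>\<phi>\<in>test_fun D. H_norm2 (\<alpha>/2) (\<lambda>x. \<phi> x - (a * u x + c * v x)) < e"
    using test_fun_lincomb[OF \<phi>(1) \<psi>(1)] by (intro bexI[of _ "\<lambda>x. a * \<phi> x + c * \<psi> x"]) auto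
qed

text \<open>Test functions vanish outside \<open>D\<close>, so the square integral of
  \<open>u\<close> there is at most the squared L2 distance to any approximating test function. The
  L1 bounds through \<open>vol D\<close> rest on this.\<close>

lemma form_domain_zero_outside:
  assumes a: "0 < \<alpha>" "\<alpha> \<le> 2" and D: "open D" and u: "u \<in> form_domain \<alpha> D"
  shows "AE x in lebesgue. x \<notin> D \<longrightarrow> u x = 0"
proof -
  note iu = in_HD[OF form_domainD(1)[OF u]]
  note [measurable] = iu(4)
  have [measurable]: "D \<in> sets lebesgue" using D by simp
  have i: "integrable lebesgue (\<lambda>x. indicator (- D) x * (u x)\<^sup>2)"
    by (rule Bochner_Integration.integrable_bound[OF iu(2)]) (auto simp: indicator_def)
  have "(LINT x|lebesgue. indicator (- D) x * (u x)\<^sup>2) \<le> 0 + e" if e: "e > 0" for e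
  proof -
    obtain \<phi> where \<phi>: "\<phi> \<in> test_fun D" "H_norm2 (\<alpha>/2) (\<lambda>x. \<phi> x - u x) < e" using form_domainD(2)[OF u e] by auto
    have ip: "in_H (\<alpha>/2) (\<lambda>x. \<phi> x - u x)" using a by (intro in_H_diff(1) form_domainD(1)[OF u] test_fun_in_H[OF \<phi>(1)]) auto
    have "(LINT x|lebesgue. indicator (- D) x * (u x)\<^sup>2) \<le> (LINT x|lebesgue. (\<phi> x - u x)\<^sup>2)"
      by (rule integral_mono[OF i in_HD(2)[OF ip]]) (auto simp: indicator_def test_fun_zero_outside[OF \<phi>(1)])
    also have "\<dots> \<le> H_norm2 (\<alpha>/2) (\<lambda>x. \<phi> x - u x)" using a by (intro L2_le_H_norm2[OF ip]) simp
    finally show ?thesis using \<phi>(2) by simp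
  qed
  then have "(LINT x|lebesgue. indicator (- D) x * (u x)\<^sup>2) \<le> 0" by (rule field_le_epsilon)
  moreover have "0 \<le> (LINT x|lebesgue. indicator (- D) x * (u x)\<^sup>2)" by (intro Bochner_Integration.integral_nonneg) simp
  ultimately have "(LINT x|lebesgue. indicator (- D) x * (u x)\<^sup>2) = 0" by simp
  then have "AE x in lebesgue. indicator (- D) x * (u x)\<^sup>2 = 0"
    using integral_nonneg_eq_0_iff_AE[OF i] by (simp add: indicator_def)
  then show ?thesis by eventually_elim (auto simp: indicator_def)
qed

text \<open>The parameter \<open>t\<close> of AM-GM replaces the square root in the Cauchy-Schwarz inequality.\<close>

lemma L1_le_L2:
  fixes u :: "real^'n::finite \<Rightarrow> real"
  assumes u[measurable]: "u \<in> borel_measurable lebesgue" and u2: "integrable lebesgue (\<lambda>x. (u x)\<^sup>2)"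
    and z: "AE x in lebesgue. x \<notin> D \<longrightarrow> u x = 0" and D: "open D" "bounded D" and t: "t > 0"
  shows "integrable lebesgue u" "(LINT x|lebesgue. \<bar>u x\<bar>) \<le> t * vol D + (1 / t) * (LINT x|lebesgue. (u x)\<^sup>2)"
proof -
  have [measurable]: "D \<in> sets lebesgue" using D by simp
  have fD: "emeasure lebesgue D < \<infinity>" using emeasure_bounded_finite[OF D(2)] D(1) by simp
  let ?g = "\<lambda>x. t * indicator D x + (1 / t) * (u x)\<^sup>2"
  have iD: "integrable lebesgue (indicator D :: _ \<Rightarrow> real)" using fD by simp
  have ig: "integrable lebesgue ?g" using u2 iD by simp
  have le: "AE x in lebesgue. \<bar>u x\<bar> \<le> ?g x"
    using z
  proof eventually_elim
    case (elim x)
    show ?case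
    proof (cases "x \<in> D")
      case True
      have "0 \<le> (\<bar>u x\<bar> - t)\<^sup>2 + (t * t + u x * u x)" by simp
      also have "\<dots> = 2 * (t * t + u x * u x - t * \<bar>u x\<bar>)" by (simp add: power2_eq_square algebra_simps)
      finally have "t * \<bar>u x\<bar> \<le> t * t + u x * u x" by simp
      then show ?thesis using True t by (simp add: power2_eq_square field_simps)
    next
      case False then show ?thesis using elim t by simp
    qed
  qed
  show iu: "integrable lebesgue u"
    by (rule Bochner_Integration.integrable_bound[OF ig]) (use le in \<open>auto elim!: eventually_mono intro: order_trans[OF _ abs_ge_self]\<close>)
  have "(LINT x|lebesgue. \<bar>u x\<bar>) \<le> (LINT x|lebesgue. ?g x)"
    using iu ig le by (intro integral_mono_AE) auto
  also have "\<dots> = t * vol D + (1 / t) * (LINT x|lebesgue. (u x)\<^sup>2)"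
    using u2 iD by (simp add: vol_def)
  finally show "(LINT x|lebesgue. \<bar>u x\<bar>) \<le> t * vol D + (1 / t) * (LINT x|lebesgue. (u x)\<^sup>2)" .
qed

lemma AE_summable_of_integrals:
  fixes d :: "nat \<Rightarrow> 'a \<Rightarrow> real"
  assumes d: "\<And>k. integrable M (d k)" "\<And>k x. 0 \<le> d k x" and s: "summable (\<lambda>k. \<integral>x. d k x \<partial>M)"
  shows "AE x in M. summable (\<lambda>k. d k x)"
proof -
  have [measurable]: "\<And>k. d k \<in> borel_measurable M" using d(1) by auto
  have "(\<integral>\<^sup>+x. (\<Sum>k. ennreal (d k x)) \<partial>M) = (\<Sum>k. \<integral>\<^sup>+x. ennreal (d k x) \<partial>M)" by (rule nn_integral_suminf) simp
  also have "\<dots> = (\<Sum>k. ennreal (\<integral>x. d k x \<partial>M))" using d by (subst nn_integral_eq_integral) auto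
  also have "\<dots> < \<infinity>" using s d(2) by (subst suminf_ennreal2) auto
  finally have "AE x in M. (\<Sum>k. ennreal (d k x)) \<noteq> \<infinity>" by (intro nn_integral_PInf_AE) auto
  then show ?thesis by eventually_elim (use d(2) in \<open>auto intro: summable_suminf_not_top\<close>)
qed

lemma convergent_of_summable_differences:
  fixes v :: "nat \<Rightarrow> real"
  assumes "summable (\<lambda>k. \<bar>v (Suc k) - v k\<bar>)"
  shows "convergent v"
proof -
  have "summable (\<lambda>k. v (Suc k) - v k)" using assms by (rule summable_rabs_cancel)
  then have "(\<lambda>n. \<Sum>k<n. v (Suc k) - v k) \<longlonglongrightarrow> (\<Sum>k. v (Suc k) - v k)" by (rule summable_LIMSEQ)
  then have "(\<lambda>n. v n - v 0) \<longlonglongrightarrow> (\<Sum>k. v (Suc k) - v k)" by (simp add: sum_lessThan_telescope)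
  then have "(\<lambda>n. (v n - v 0) + v 0) \<longlonglongrightarrow> (\<Sum>k. v (Suc k) - v k) + v 0" by (intro tendsto_intros)
  then show ?thesis by (auto simp: convergent_def)
qed

text \<open>If squared L2 distances are of size 4^(-k), the choice t = 2^(-k) in
  \<open>L1_le_L2\<close> makes both terms of size 2^(-k); this evaluates the second one.\<close>

lemma half_quarter_power: "(1 / (1/2) ^ k) * (1/4) ^ k = ((1/2) ^ k :: real)"
proof -
  have "(1/4 :: real) ^ k = (1/2) ^ k * (1/2) ^ k" by (simp add: power_mult_distrib[symmetric])
  then show ?thesis by simp
qed

section \<open>Completeness and compactness of the form domain\<close>

locale fractional_domain =
  fixes \<alpha> :: real and D :: "(real^'n::finite) set"
  assumes alpha: "0 < \<alpha>" "\<alpha> \<le> 2" and D: "open D" "bounded D" "D \<noteq> {}"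
begin

abbreviation "s \<equiv> \<alpha> / 2"
abbreviation "V \<equiv> form_domain \<alpha> D"

lemma s_pos: "0 \<le> s" using alpha by simp

lemma V_in_H: "u \<in> V \<Longrightarrow> in_H s u" by (rule form_domainD)

lemma V_lincomb: "u \<in> V \<Longrightarrow> v \<in> V \<Longrightarrow> (\<lambda>x. a * u x + c * v x) \<in> V"
  by (rule form_domain_lincomb[OF alpha(2)])

lemma V_diff: "u \<in> V \<Longrightarrow> v \<in> V \<Longrightarrow> (\<lambda>x. u x - v x) \<in> V"
  using V_lincomb[of u v 1 "-1"] by simp

lemma V_zero_outside: "u \<in> V \<Longrightarrow> AE x in lebesgue. x \<notin> D \<longrightarrow> u x = 0"
  by (rule form_domain_zero_outside[OF alpha D(1)])

lemma V_L1: "u \<in> V \<Longrightarrow> t > 0 \<Longrightarrow> (LINT x|lebesgue. \<bar>u x\<bar>) \<le> t * vol D + (1 / t) * (LINT x|lebesgue. (u x)\<^sup>2)"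
  by (rule L1_le_L2(2)[OF in_HD(4,2)[OF V_in_H] V_zero_outside D(1,2)])

lemma V_L2: "u \<in> V \<Longrightarrow> (LINT x|lebesgue. (u x)\<^sup>2) \<le> H_norm2 s u"
  by (rule L2_le_H_norm2[OF V_in_H s_pos])

text \<open>Riesz-Fischer. Summable L1 increments give an almost everywhere limit \<open>u\<close>.
  Fatou's lemma gives L2 convergence, the finite volume of \<open>D\<close> turns it into L1
  convergence, so the transforms converge uniformly, and Fatou's lemma on the Fourier side bounds
  the distance in \<open>H_norm2\<close>.\<close>

lemma complete_fast:
  assumes v: "\<And>k. v k \<in> V" and fast: "\<And>k l. k \<le> l \<Longrightarrow> H_norm2 s (\<lambda>x. v k x - v l x) \<le> (1/4) ^ k"
  shows "\<exists>u\<in>V. \<forall>k. H_norm2 s (\<lambda>x. v k x - u x) \<le> (1/4) ^ k"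
proof -
  note iv = in_HD[OF V_in_H[OF v]]
  have [measurable]: "v k \<in> borel_measurable lebesgue" for k using iv(4) .
  have volD: "0 \<le> vol D" by (simp add: vol_def)
  have dV: "(\<lambda>x. v k x - v l x) \<in> V" for k l by (rule V_diff[OF v v])
  have L2: "(LINT x|lebesgue. (v k x - v l x)\<^sup>2) \<le> (1/4) ^ k" if "k \<le> l" for k l
    using V_L2[OF dV] fast[OF that] by (rule order_trans)
  have tail: "(LINT x|lebesgue. \<bar>v (Suc k) x - v k x\<bar>) \<le> (vol D + 1) * (1/2) ^ k" for k
  proof -
    have e: "(1 / (1/2) ^ k) * (1/4) ^ k = ((1/2) ^ k :: real)" by (rule half_quarter_power)
    have "(LINT x|lebesgue. \<bar>v k x - v (Suc k) x\<bar>) \<le> (1/2)^k * vol D + (1 / (1/2)^k) * (LINT x|lebesgue. (v k x - v (Suc k) x)\<^sup>2)"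
      by (rule V_L1[OF dV]) simp
    also have "\<dots> \<le> (1/2)^k * vol D + (1 / (1/2)^k) * (1/4)^k"
      using L2[of k "Suc k"] by (intro add_left_mono mult_left_mono) auto
    also have "\<dots> = (vol D + 1) * (1/2) ^ k" unfolding e by (simp add: algebra_simps)
    finally show ?thesis by (simp add: abs_minus_commute)
  qed
  have geo: "summable (\<lambda>k. (vol D + 1) * (1/2) ^ k)" by (intro summable_mult summable_geometric) simp
  have "summable (\<lambda>k. LINT x|lebesgue. \<bar>v (Suc k) x - v k x\<bar>)"
    by (rule summable_comparison_test'[OF geo, of 0]) (use tail in simp)
  then have "AE x in lebesgue. summable (\<lambda>k. \<bar>v (Suc k) x - v k x\<bar>)"
    using iv(1) by (intro AE_summable_of_integrals) auto
  then have conv: "AE x in lebesgue. convergent (\<lambda>k. v k x)"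
    by eventually_elim (rule convergent_of_summable_differences)
  \<comment> \<open>On the null set without convergence the value of \<open>lim\<close> is
    arbitrary, yet \<open>u\<close> stays measurable.\<close>
  define u where "u x = lim (\<lambda>k. v k x)" for x
  have [measurable]: "u \<in> borel_measurable lebesgue" unfolding u_def[abs_def] by measurable
  have lim: "AE x in lebesgue. (\<lambda>k. v k x) \<longlonglongrightarrow> u x"
    using conv by eventually_elim (simp add: u_def convergent_LIMSEQ_iff)
  have uz: "AE x in lebesgue. x \<notin> D \<longrightarrow> u x = 0"
  proof -
    have "AE x in lebesgue. \<forall>k. x \<notin> D \<longrightarrow> v k x = 0" using V_zero_outside[OF v] by (subst AE_all_countable) simp
    then show ?thesis using lim
      by eventually_elim (auto simp: LIMSEQ_const_iff)
  qed
  have dv2: "integrable lebesgue (\<lambda>x. (v k x - u x)\<^sup>2)" "(LINT x|lebesgue. (v k x - u x)\<^sup>2) \<le> (1/4)^k" for k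
  proof -
    have l: "AE x in lebesgue. (\<lambda>l. (v k x - v l x)\<^sup>2) \<longlonglongrightarrow> (v k x - u x)\<^sup>2"
      using lim by eventually_elim (intro tendsto_intros)
    have ev: "\<forall>\<^sub>F l in sequentially. (LINT x|lebesgue. (v k x - v l x)\<^sup>2) \<le> (1/4)^k"
      by (rule eventually_mono[OF eventually_ge_at_top[of k]]) (rule L2)
    show "integrable lebesgue (\<lambda>x. (v k x - u x)\<^sup>2)" "(LINT x|lebesgue. (v k x - u x)\<^sup>2) \<le> (1/4)^k"
      using Fatou_bound[OF in_HD(2)[OF V_in_H[OF dV]] _ l _ ev] by auto
  qed
  have dz: "AE x in lebesgue. x \<notin> D \<longrightarrow> v k x - u x = 0" for k
    using V_zero_outside[OF v[of k]] uz by eventually_elim auto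
  have dL1: "integrable lebesgue (\<lambda>x. v k x - u x)" "(LINT x|lebesgue. \<bar>v k x - u x\<bar>) \<le> (vol D + 1) * (1/2) ^ k" for k
  proof -
    have m: "(\<lambda>x. v k x - u x) \<in> borel_measurable lebesgue" by measurable
    note L = L1_le_L2[OF m dv2(1) dz D(1,2), of "(1/2)^k"]
    show "integrable lebesgue (\<lambda>x. v k x - u x)" using L(1) by simp
    have e: "(1 / (1/2) ^ k) * (1/4) ^ k = ((1/2) ^ k :: real)" by (rule half_quarter_power)
    have "(LINT x|lebesgue. \<bar>v k x - u x\<bar>) \<le> (1/2)^k * vol D + (1 / (1/2)^k) * (LINT x|lebesgue. (v k x - u x)\<^sup>2)"
      by (rule L(2)) simp
    also have "\<dots> \<le> (1/2)^k * vol D + (1 / (1/2)^k) * (1/4)^k"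
      using dv2(2)[of k] by (intro add_left_mono mult_left_mono) auto
    also have "\<dots> = (vol D + 1) * (1/2) ^ k" unfolding e by (simp add: algebra_simps)
    finally show "(LINT x|lebesgue. \<bar>v k x - u x\<bar>) \<le> (vol D + 1) * (1/2) ^ k" .
  qed
  have iu: "integrable lebesgue u"
    using Bochner_Integration.integrable_diff[OF iv(1)[of 0] dL1(1)[of 0]] by simp
  have iu2: "integrable lebesgue (\<lambda>x. (u x)\<^sup>2)"
    using square_diff_integrable[of "v 0" lebesgue "\<lambda>x. v 0 x - u x"] iv(2)[of 0] dv2(1)[of 0] by simp
  have Flim: "(\<lambda>l. fourier (v l) \<xi>) \<longlonglongrightarrow> fourier u \<xi>" for \<xi>
  proof -
    have "norm (fourier (v l) \<xi> - fourier u \<xi>) \<le> (vol D + 1) * (1/2) ^ l" for l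
      using order_trans[OF norm_fourier_le dL1(2)[of l]] unfolding fourier_diff[OF iv(1)[of l] iu, symmetric] .
    moreover have "(\<lambda>l. (vol D + 1) * (1/2) ^ l) \<longlonglongrightarrow> 0"
      by (intro tendsto_mult_right_zero LIMSEQ_realpow_zero) auto
    ultimately have "(\<lambda>l. fourier (v l) \<xi> - fourier u \<xi>) \<longlonglongrightarrow> 0"
      by (rule Lim_null_comparison[OF always_eventually[OF allI]])
    then show ?thesis by (simp add: LIM_zero_iff)
  qed
  have dF: "fourier (\<lambda>x. v k x - v l x) = (\<lambda>\<xi>. fourier (v k) \<xi> - fourier (v l) \<xi>)" for k l
    by (rule ext, rule fourier_diff[OF iv(1) iv(1)])
  have dFu: "fourier (\<lambda>x. v k x - u x) = (\<lambda>\<xi>. fourier (v k) \<xi> - fourier u \<xi>)" for k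
    by (rule ext, rule fourier_diff[OF iv(1) iu])
  have HF: "integrable lebesgue (\<lambda>\<xi>. sobolev_weight s \<xi> * (cmod (fourier (\<lambda>x. v k x - u x) \<xi>))\<^sup>2)"
    "H_norm2 s (\<lambda>x. v k x - u x) \<le> (1/4)^k" for k
  proof -
    have l: "AE \<xi> in lebesgue. (\<lambda>l. sobolev_weight s \<xi> * (cmod (fourier (\<lambda>x. v k x - v l x) \<xi>))\<^sup>2)
        \<longlonglongrightarrow> sobolev_weight s \<xi> * (cmod (fourier (\<lambda>x. v k x - u x) \<xi>))\<^sup>2"
      unfolding dF dFu by (intro AE_I2 tendsto_intros Flim)
    have ev: "\<forall>\<^sub>F l in sequentially. (LINT \<xi>|lebesgue. sobolev_weight s \<xi> * (cmod (fourier (\<lambda>x. v k x - v l x) \<xi>))\<^sup>2) \<le> (1/4)^k"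
      by (rule eventually_mono[OF eventually_ge_at_top[of k]]) (use fast[of k] in \<open>simp add: H_norm2_def\<close>)
    have m: "(\<lambda>\<xi>. sobolev_weight s \<xi> * (cmod (fourier (\<lambda>x. v k x - u x) \<xi>))\<^sup>2) \<in> borel_measurable lebesgue"
    proof -
      note [measurable] = sobolev_weight_measurable
      have [measurable]: "fourier (\<lambda>x. v k x - u x) \<in> borel_measurable lebesgue"
        by (rule fourier_measurable_lebesgue) measurable
      show ?thesis by measurable
    qed
    note FB = Fatou_bound[OF in_HD(3)[OF V_in_H[OF dV]] _ l m ev]
    show "integrable lebesgue (\<lambda>\<xi>. sobolev_weight s \<xi> * (cmod (fourier (\<lambda>x. v k x - u x) \<xi>))\<^sup>2)"
      by (rule FB(1)) simp
    show "H_norm2 s (\<lambda>x. v k x - u x) \<le> (1/4)^k"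
      unfolding H_norm2_def by (rule FB(2)) simp
  qed
  have inHd: "in_H s (\<lambda>x. v k x - u x)" for k
    unfolding in_H_def using dL1(1) dv2(1) HF(1) by blast
  have inHu: "in_H s u" using in_H_diff(1)[OF V_in_H[OF v[of 0]] inHd[of 0]] by simp
  have "u \<in> V"
  proof (rule form_domain_closed[OF alpha(2) inHu])
    fix e :: real assume "e > 0"
    then obtain k where "(1/4 :: real) ^ k < e" using real_arch_pow_inv[of e "1/4"] by auto
    then show "\<exists>v\<in>V. H_norm2 s (\<lambda>x. v x - u x) < e" using HF(2)[of k] v by (intro bexI[of _ "v k"]) auto
  qed
  then show ?thesis using HF(2) by blast
qed

lemma fourier_form_domain_diff:
  "u \<in> V \<Longrightarrow> v \<in> V \<Longrightarrow> fourier (\<lambda>x. u x - v x) \<xi> = fourier u \<xi> - fourier v \<xi>"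
  by (rule fourier_diff) (auto dest: V_in_H in_HD(1))

lemma form_domain_complete:
  assumes v: "\<And>k::nat. v k \<in> V"
    and Cauchy: "\<And>e. e > 0 \<Longrightarrow> \<exists>N. \<forall>m\<ge>N. \<forall>l\<ge>N. H_norm2 s (\<lambda>x. v m x - v l x) < e"
  shows "\<exists>u\<in>V. (\<lambda>m. H_norm2 s (\<lambda>x. v m x - u x)) \<longlonglongrightarrow> 0"
proof -
  have "\<exists>N. \<forall>m\<ge>N. \<forall>l\<ge>N. H_norm2 s (\<lambda>x. v m x - v l x) < (1/4)^k" for k by (rule Cauchy) simp
  then obtain N where N: "\<And>k m l. m \<ge> N k \<Longrightarrow> l \<ge> N k \<Longrightarrow> H_norm2 s (\<lambda>x. v m x - v l x) < (1/4)^k" by metis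
  \<comment> \<open>The maximum over the earlier thresholds makes \<open>r l\<close> at least
    \<open>N k\<close> for every \<open>k \<le> l\<close>, as \<open>complete_fast\<close> requires;
    \<open>r\<close> may repeat values.\<close>
  define r where "r k = Max (N ` {..k})" for k
  have rN: "N k \<le> r l" if "k \<le> l" for k l using that by (auto simp: r_def)
  have "\<exists>u\<in>V. \<forall>k. H_norm2 s (\<lambda>x. v (r k) x - u x) \<le> (1/4) ^ k"
    by (rule complete_fast) (use v N rN in \<open>auto intro: less_imp_le\<close>)
  then obtain u where u: "u \<in> V" "\<And>k. H_norm2 s (\<lambda>x. v (r k) x - u x) \<le> (1/4) ^ k" by blast
  have "(\<lambda>m. H_norm2 s (\<lambda>x. v m x - u x)) \<longlonglongrightarrow> 0"
  proof (rule LIMSEQ_I)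
    fix e :: real assume "e > 0"
    then obtain k where k: "(1/4 :: real) ^ k < e / 4" using real_arch_pow_inv[of "e/4" "1/4"] by auto
    have "norm (H_norm2 s (\<lambda>x. v m x - u x) - 0) < e" if m: "m \<ge> N k" for m
    proof -
      have "H_norm2 s (\<lambda>x. v m x - u x) \<le> 2 * H_norm2 s (\<lambda>x. v m x - v (r k) x) + 2 * H_norm2 s (\<lambda>x. v (r k) x - u x)"
        by (rule H_norm2_diff_triangle[OF V_in_H[OF v] V_in_H[OF v] V_in_H[OF u(1)]])
      also have "\<dots> < e" using N[OF m rN[of k k]] u(2)[of k] k by simp
      finally show ?thesis by (simp add: abs_of_nonneg H_norm2_nonneg)
    qed
    then show "\<exists>N. \<forall>m\<ge>N. norm (H_norm2 s (\<lambda>x. v m x - u x) - 0) < e" by blast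
  qed
  then show ?thesis using u(1) by blast
qed

text \<open>The phase is Lipschitz in the frequency with constant 2 pi |x|, and \<open>u\<close>
  vanishes almost everywhere outside the bounded set \<open>D\<close>. This is the equicontinuity
  behind the compactness proof.\<close>

lemma fourier_Lipschitz:
  assumes u: "u \<in> V" and R: "\<And>x. x \<in> D \<Longrightarrow> norm x \<le> R" and R0: "0 \<le> R"
  shows "norm (fourier u \<xi> - fourier u \<eta>) \<le> 2 * pi * R * (LINT x|lebesgue. \<bar>u x\<bar>) * norm (\<xi> - \<eta>)"
proof -
  note iu = in_HD[OF V_in_H[OF u]]
  have cis_lip: "norm (cis a - cis b) \<le> \<bar>a - b\<bar>" for a b
  proof -
    have "cis a - cis b = cis b * (cis (a - b) - 1)" by (simp add: cis_mult algebra_simps)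
    then have "norm (cis a - cis b) = norm (iexp (a - b) - 1)" by (simp add: norm_mult cis_conv_exp)
    also have "\<dots> \<le> \<bar>a - b\<bar>" using iexp_approx1[of "a - b" 0] by simp
    finally show ?thesis .
  qed
  let ?f = "\<lambda>\<xi> x. complex_of_real (u x) * cis (- 2 * pi * (x \<bullet> \<xi>))"
  have i: "integrable lebesgue (?f \<xi>)" for \<xi> by (rule fourier_integrand_integrable[OF iu(1)])
  have "norm (fourier u \<xi> - fourier u \<eta>) = norm (LINT x|lebesgue. ?f \<xi> x - ?f \<eta> x)"
    unfolding fourier_def using i by simp
  also have "\<dots> \<le> (LINT x|lebesgue. norm (?f \<xi> x - ?f \<eta> x))" by (rule integral_norm_bound)
  also have "\<dots> \<le> (LINT x|lebesgue. (2 * pi * R * norm (\<xi> - \<eta>)) * \<bar>u x\<bar>)"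
  proof (rule integral_mono_AE)
    show "AE x in lebesgue. norm (?f \<xi> x - ?f \<eta> x) \<le> (2 * pi * R * norm (\<xi> - \<eta>)) * \<bar>u x\<bar>"
      using V_zero_outside[OF u]
    proof eventually_elim
      case (elim x)
      show ?case
      proof (cases "x \<in> D")
        case True
        have "norm (?f \<xi> x - ?f \<eta> x) = \<bar>u x\<bar> * norm (cis (- 2 * pi * (x \<bullet> \<xi>)) - cis (- 2 * pi * (x \<bullet> \<eta>)))"
          by (simp add: right_diff_distrib[symmetric] norm_mult)
        also have "\<dots> \<le> \<bar>u x\<bar> * \<bar>- 2 * pi * (x \<bullet> \<xi>) - - 2 * pi * (x \<bullet> \<eta>)\<bar>"
          by (intro mult_left_mono cis_lip) auto
        also have "\<bar>- 2 * pi * (x \<bullet> \<xi>) - - 2 * pi * (x \<bullet> \<eta>)\<bar> = 2 * pi * \<bar>x \<bullet> (\<xi> - \<eta>)\<bar>"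
        proof -
          have "- 2 * pi * (x \<bullet> \<xi>) - - 2 * pi * (x \<bullet> \<eta>) = - (2 * pi) * (x \<bullet> (\<xi> - \<eta>))"
            by (simp add: inner_diff_right algebra_simps)
          then show ?thesis by (simp add: abs_mult)
        qed
        also have "\<bar>u x\<bar> * (2 * pi * \<bar>x \<bullet> (\<xi> - \<eta>)\<bar>) \<le> \<bar>u x\<bar> * (2 * pi * (R * norm (\<xi> - \<eta>)))"
          using Cauchy_Schwarz_ineq2[of x "\<xi> - \<eta>"] mult_right_mono[OF R[OF True], of "norm (\<xi> - \<eta>)"]
          by (intro mult_left_mono) auto
        finally show ?thesis by (simp add: mult_ac)
      next
        case False then show ?thesis using elim by simp
      qed
    qed
  qed (use iu i in auto)
  finally show ?thesis using iu by (simp add: mult_ac)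
qed

text \<open>Rellich's theorem on the Fourier side: the transforms are uniformly bounded and uniformly
  Lipschitz, so a subsequence converges pointwise; the weight controls the high frequencies.\<close>

lemma form_domain_compact:
  assumes v: "\<And>k::nat. v k \<in> V" and C: "\<And>k. H_norm2 s (v k) \<le> C"
  shows "\<exists>r. strict_mono r \<and> (\<forall>e>0. \<exists>N::nat. \<forall>m\<ge>N. \<forall>l\<ge>N. (LINT x|lebesgue. (v (r m) x - v (r l) x)\<^sup>2) < e)"
proof -
  note iv = in_HD[OF V_in_H[OF v]]
  define M where "M = vol D + C"
  have L1: "(LINT x|lebesgue. \<bar>v k x\<bar>) \<le> M" for k
    using V_L1[OF v[of k], of 1] order_trans[OF V_L2[OF v[of k]] C[of k]] by (simp add: M_def)
  have M0: "0 \<le> M" using order_trans[OF Bochner_Integration.integral_nonneg L1[of 0]] by simp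
  have C0: "0 \<le> C" using order_trans[OF H_norm2_nonneg C[of 0]] .
  have FM: "norm (fourier (v k) \<xi>) \<le> M" for k \<xi> using norm_fourier_le L1 by (rule order_trans)
  obtain R where R: "R > 0" "\<And>x. x \<in> D \<Longrightarrow> norm x \<le> R" using D(2) bounded_pos by metis
  \<comment> \<open>The added 1 makes \<open>K\<close> positive, since it appears in a denominator
    below.\<close>
  define K where "K = 2 * pi * R * M + 1"
  have K0: "K > 0" using R M0 by (simp add: K_def add_nonneg_pos)
  have lip: "norm (fourier (v k) \<xi> - fourier (v k) \<eta>) \<le> K * norm (\<xi> - \<eta>)" for k \<xi> \<eta>
  proof -
    have "2 * pi * R * (LINT x|lebesgue. \<bar>v k x\<bar>) \<le> K"
      unfolding K_def using L1[of k] R by (intro add_increasing2 mult_left_mono) auto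
    then show ?thesis
      using order_trans[OF fourier_Lipschitz[OF v R(2)] mult_right_mono[OF _ norm_ge_zero]] R(1) by (metis less_imp_le)
  qed
  \<comment> \<open>Diagonal selection gives convergence at countably many dense frequencies; the
    common Lipschitz constant spreads it to all frequencies.\<close>
  obtain S :: "(real^'n) set" where S: "countable S" "\<And>X. open X \<Longrightarrow> X \<noteq> {} \<Longrightarrow> \<exists>d\<in>S. d \<in> X"
    using countable_dense_exists by metis
  obtain r where r: "strict_mono r" and rS: "\<And>x. x \<in> S \<Longrightarrow> \<exists>l. (\<lambda>k. fourier (v (r k)) x) \<longlonglongrightarrow> l"
    using function_convergent_subsequence[OF S(1), of "\<lambda>k. fourier (v k)" M] FM by blast
  have "Cauchy (\<lambda>k. fourier (v (r k)) \<xi>)" for \<xi>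
  proof (rule metric_CauchyI)
    fix e :: real assume e: "e > 0"
    have "e / (3 * K) > 0" using e K0 by simp
    then have "ball \<xi> (e / (3 * K)) \<noteq> {}" unfolding ball_eq_empty by linarith
    then obtain d where d: "d \<in> S" "dist \<xi> d < e / (3 * K)" using S(2)[OF open_ball] by (metis mem_ball)
    have "Cauchy (\<lambda>k. fourier (v (r k)) d)" using rS[OF d(1)] LIMSEQ_imp_Cauchy by blast
    then obtain N where N: "\<And>m l. m \<ge> N \<Longrightarrow> l \<ge> N \<Longrightarrow> dist (fourier (v (r m)) d) (fourier (v (r l)) d) < e / 3"
      using metric_CauchyD[of _ "e/3"] e by (meson divide_pos_pos zero_less_numeral)
    have near: "dist (fourier (v k) \<xi>) (fourier (v k) d) < e / 3" for k
    proof -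
      have "dist (fourier (v k) \<xi>) (fourier (v k) d) \<le> K * dist \<xi> d" using lip by (simp add: dist_norm)
      also have "\<dots> < K * (e / (3 * K))" using d(2) K0 by (intro mult_strict_left_mono)
      also have "\<dots> = e / 3" using K0 by simp
      finally show ?thesis .
    qed
    have "dist (fourier (v (r m)) \<xi>) (fourier (v (r l)) \<xi>) < e" if "m \<ge> N" "l \<ge> N" for m l
      using N[OF that] near[of "r m"] near[of "r l"]
        dist_triangle[of "fourier (v (r m)) \<xi>" "fourier (v (r l)) \<xi>" "fourier (v (r m)) d"]
        dist_triangle[of "fourier (v (r m)) d" "fourier (v (r l)) \<xi>" "fourier (v (r l)) d"]
      by (simp add: dist_commute)
    then show "\<exists>N. \<forall>m\<ge>N. \<forall>l\<ge>N. dist (fourier (v (r m)) \<xi>) (fourier (v (r l)) \<xi>) < e" by blast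
  qed
  then have "\<forall>\<xi>. \<exists>g. (\<lambda>k. fourier (v (r k)) \<xi>) \<longlonglongrightarrow> g" by (simp add: Cauchy_convergent_iff convergent_def)
  then obtain g where g: "\<And>\<xi>. (\<lambda>k. fourier (v (r k)) \<xi>) \<longlonglongrightarrow> g \<xi>" by metis
  have [measurable]: "fourier (v k) \<in> borel_measurable lebesgue" for k using iv(5) .
  have [measurable]: "g \<in> borel_measurable lebesgue"
    by (rule borel_measurable_LIMSEQ_metric[OF _ g]) simp
  have gM: "norm (g \<xi>) \<le> M" for \<xi>
    by (rule LIMSEQ_le_const2[OF tendsto_norm[OF g]]) (use FM in auto)
  have ball: "(\<lambda>k. LINT \<xi>|lebesgue. indicator (cball 0 \<rho>) \<xi> * (norm (fourier (v (r k)) \<xi> - g \<xi>))\<^sup>2) \<longlonglongrightarrow> 0"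
    and iball: "integrable lebesgue (\<lambda>\<xi>. indicator (cball 0 \<rho>) \<xi> * (norm (fourier (v (r k)) \<xi> - g \<xi>))\<^sup>2)" for \<rho> k
  proof -
    have [measurable]: "cball (0::real^'n) \<rho> \<in> sets lebesgue" by simp
    let ?w = "\<lambda>\<xi>::real^'n. (2 * M)\<^sup>2 * indicator (cball 0 \<rho>) \<xi> :: real"
    have iw: "integrable lebesgue ?w"
      using emeasure_bounded_finite[OF bounded_cball] by (intro integrable_mult_right integrable_real_indicator) auto
    have b: "norm (indicator (cball 0 \<rho>) \<xi> * (norm (fourier (v (r k)) \<xi> - g \<xi>))\<^sup>2) \<le> ?w \<xi>" for k \<xi>
    proof -
      have "norm (fourier (v (r k)) \<xi> - g \<xi>) \<le> 2 * M" using norm_triangle_ineq4[of "fourier (v (r k)) \<xi>" "g \<xi>"] FM gM by (smt (verit))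
      then have "(norm (fourier (v (r k)) \<xi> - g \<xi>))\<^sup>2 \<le> (2 * M)\<^sup>2" by (intro power_mono) auto
      then show ?thesis by (simp add: indicator_def)
    qed
    show "integrable lebesgue (\<lambda>\<xi>. indicator (cball 0 \<rho>) \<xi> * (norm (fourier (v (r k)) \<xi> - g \<xi>))\<^sup>2)"
    proof (rule Bochner_Integration.integrable_bound[OF iw])
      show "(\<lambda>\<xi>. indicator (cball 0 \<rho>) \<xi> * (norm (fourier (v (r k)) \<xi> - g \<xi>))\<^sup>2) \<in> borel_measurable lebesgue"
        by measurable
      show "AE \<xi> in lebesgue. norm (indicator (cball 0 \<rho>) \<xi> * (norm (fourier (v (r k)) \<xi> - g \<xi>))\<^sup>2) \<le> norm (?w \<xi>)"
        by (intro AE_I2 order_trans[OF b]) simp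
    qed
    have "(\<lambda>k. LINT \<xi>|lebesgue. indicator (cball 0 \<rho>) \<xi> * (norm (fourier (v (r k)) \<xi> - g \<xi>))\<^sup>2) \<longlonglongrightarrow> (LINT \<xi>|(lebesgue :: (real^'n) measure). 0)"
    proof (rule integral_dominated_convergence[where w="?w"])
      have "(\<lambda>k. indicator (cball 0 \<rho>) \<xi> * (norm (fourier (v (r k)) \<xi> - g \<xi>))\<^sup>2) \<longlonglongrightarrow> indicator (cball 0 \<rho>) \<xi> * (norm (g \<xi> - g \<xi>))\<^sup>2" for \<xi>
        by (intro tendsto_intros g)
      then show "AE \<xi> in lebesgue. (\<lambda>k. indicator (cball 0 \<rho>) \<xi> * (norm (fourier (v (r k)) \<xi> - g \<xi>))\<^sup>2) \<longlonglongrightarrow> 0"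
        by (intro AE_I2) simp
      show "AE \<xi> in lebesgue. norm (indicator (cball 0 \<rho>) \<xi> * (norm (fourier (v (r k)) \<xi> - g \<xi>))\<^sup>2) \<le> ?w \<xi>" for k
        using b by (intro AE_I2)
    qed (use iw in auto)
    then show "(\<lambda>k. LINT \<xi>|lebesgue. indicator (cball 0 \<rho>) \<xi> * (norm (fourier (v (r k)) \<xi> - g \<xi>))\<^sup>2) \<longlonglongrightarrow> 0" by simp
  qed
  have main: "\<exists>N. \<forall>m\<ge>N. \<forall>l\<ge>N. (LINT x|lebesgue. (v (r m) x - v (r l) x)\<^sup>2) < e" if e: "e > 0" for e
  proof -
    \<comment> \<open>Beyond radius \<open>\<rho>\<close> the weight is to exceed
      \<open>8 * C / e\<close>. A difference of two members has \<open>H_norm2\<close> at most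
      \<open>4 * C\<close>, so its high frequencies contribute less than \<open>e / 2\<close>, while
      the ball contributes at most four times \<open>e / 8\<close>.\<close>
    have "filterlim (\<lambda>\<rho>. (1 + (2 * pi * \<rho>)\<^sup>2) powr s) at_top at_top"
      using alpha(1) by real_asymp
    then have "\<forall>\<^sub>F \<rho> in at_top. (1 + (2 * pi * \<rho>)\<^sup>2) powr s > 8 * C / e + 1"
      unfolding filterlim_at_top_dense by blast
    then have "\<forall>\<^sub>F \<rho> in at_top. \<rho> \<ge> 0 \<and> (1 + (2 * pi * \<rho>)\<^sup>2) powr s > 8 * C / e + 1"
      using eventually_ge_at_top[of 0] by eventually_elim simp
    then obtain \<rho> :: real where \<rho>: "\<rho> \<ge> 0" "(1 + (2 * pi * \<rho>)\<^sup>2) powr s > 8 * C / e + 1"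
      using eventually_happens'[OF trivial_limit_at_top_linorder] by blast
    define W where "W = (1 + (2 * pi * \<rho>)\<^sup>2) powr s"
    have "0 \<le> 8 * C / e" using C0 e by simp
    then have W: "W > 8 * C / e + 1" "W > 0" using \<rho>(2) unfolding W_def by linarith+
    have CW: "4 * C / W < e / 2"
    proof -
      have "8 * C / e < W" using W by simp
      then show ?thesis using W(2) e by (simp add: field_simps)
    qed
    define a where "a k = (LINT \<xi>|lebesgue. indicator (cball 0 \<rho>) \<xi> * (norm (fourier (v (r k)) \<xi> - g \<xi>))\<^sup>2)" for k
    have "a \<longlonglongrightarrow> 0" unfolding a_def by (rule ball)
    then have "\<forall>\<^sub>F k in sequentially. a k < e / 8" using e by (intro order_tendstoD) auto
    then obtain N where N: "\<And>k. k \<ge> N \<Longrightarrow> a k < e / 8" by (auto simp: eventually_sequentially)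
    have "(LINT x|lebesgue. (v (r m) x - v (r l) x)\<^sup>2) < e" if ml: "m \<ge> N" "l \<ge> N" for m l
    proof -
      have dV: "(\<lambda>x. v (r m) x - v (r l) x) \<in> V" by (rule V_diff[OF v v])
      note id = in_HD[OF V_in_H[OF dV]]
      note P = Plancherel_fourier[OF id(1,2)]
      let ?A = "\<lambda>k \<xi>. indicator (cball 0 \<rho>) \<xi> * (norm (fourier (v (r k)) \<xi> - g \<xi>))\<^sup>2"
      let ?H = "\<lambda>\<xi>. sobolev_weight s \<xi> * (cmod (fourier (\<lambda>x. v (r m) x - v (r l) x) \<xi>))\<^sup>2"
      \<comment> \<open>Inside the ball both transforms are compared with the pointwise limit
        \<open>g\<close>; outside it the weight is at least \<open>W\<close>.\<close>
      have le: "(norm (fourier (\<lambda>x. v (r m) x - v (r l) x) \<xi>))\<^sup>2 \<le> 2 * ?A m \<xi> + 2 * ?A l \<xi> + (1 / W) * ?H \<xi>" for \<xi>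
      proof (cases "norm \<xi> \<le> \<rho>")
        case True
        have "0 \<le> (1 / W) * ?H \<xi>" using W by simp
        moreover have "(norm (fourier (v (r m)) \<xi> - fourier (v (r l)) \<xi>))\<^sup>2 \<le> 2 * (norm (fourier (v (r m)) \<xi> - g \<xi>))\<^sup>2 + 2 * (norm (fourier (v (r l)) \<xi> - g \<xi>))\<^sup>2"
          using norm_diff_square_le[of "fourier (v (r m)) \<xi> - g \<xi>" "fourier (v (r l)) \<xi> - g \<xi>"] by simp
        ultimately show ?thesis using True by (simp add: fourier_form_domain_diff[OF v v])
      next
        case False
        have "W \<le> sobolev_weight s \<xi>" unfolding W_def
          using False \<rho>(1) s_pos by (intro powr_mono2 add_left_mono power_mono mult_left_mono) auto
        then have "(1 / W) * (W * (cmod (fourier (\<lambda>x. v (r m) x - v (r l) x) \<xi>))\<^sup>2) \<le> (1 / W) * ?H \<xi>"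
          using W by (intro mult_left_mono mult_right_mono) auto
        then show ?thesis using False W by simp
      qed
      have "(LINT x|lebesgue. (v (r m) x - v (r l) x)\<^sup>2) = (LINT \<xi>|lebesgue. (norm (fourier (\<lambda>x. v (r m) x - v (r l) x) \<xi>))\<^sup>2)"
        using P(2) by simp
      also have "\<dots> \<le> (LINT \<xi>|lebesgue. 2 * ?A m \<xi> + 2 * ?A l \<xi> + (1 / W) * ?H \<xi>)"
        using P(1) iball id(3) by (intro integral_mono le Bochner_Integration.integrable_add integrable_mult_right) auto
      also have "\<dots> = 2 * a m + 2 * a l + (1 / W) * H_norm2 s (\<lambda>x. v (r m) x - v (r l) x)"
        unfolding a_def H_norm2_def using iball[of \<rho> m] iball[of \<rho> l] id(3) by simp
      also have "H_norm2 s (\<lambda>x. v (r m) x - v (r l) x) \<le> 4 * C"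
        using in_H_diff(2)[OF V_in_H[OF v[of "r m"]] V_in_H[OF v[of "r l"]]] C[of "r m"] C[of "r l"] by simp
      then have "2 * a m + 2 * a l + (1 / W) * H_norm2 s (\<lambda>x. v (r m) x - v (r l) x) \<le> 2 * a m + 2 * a l + (1 / W) * (4 * C)"
        using W by (intro add_left_mono mult_left_mono) auto
      also have "\<dots> < e" using N[OF ml(1)] N[OF ml(2)] CW by simp
      finally show ?thesis .
    qed
    then show ?thesis by blast
  qed
  show ?thesis using r main by blast
qed

end

section \<open>Spectral theory of the fractional Laplacian on a bounded open set\<close>

context fractional_domain
begin

definition L2_form :: "(real^'n \<Rightarrow> real) \<Rightarrow> (real^'n \<Rightarrow> real) \<Rightarrow> real" where
  "L2_form u v = (LINT x|lebesgue. u x * v x)"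

abbreviation symbol :: "real^'n \<Rightarrow> real" where "symbol \<xi> \<equiv> (2 * pi * norm \<xi>) powr \<alpha>"

lemma symbol_eq: "symbol \<xi> = ((2 * pi * norm \<xi>)\<^sup>2) powr s"
proof (cases "\<xi> = 0")
  case False
  then have "(2 * pi * norm \<xi>)\<^sup>2 = (2 * pi * norm \<xi>) powr 2" by simp
  then show ?thesis by (simp only: powr_powr) simp
qed simp

lemma symbol_le: "symbol \<xi> \<le> sobolev_weight s \<xi>"
  unfolding symbol_eq using s_pos by (intro powr_mono2) auto

text \<open>Together with \<open>symbol_le\<close> and Plancherel's identity this makes
  \<open>H_norm2\<close> comparable with \<open>L2_form + frac_form\<close>, so completeness and
  compactness transfer. The constant comes from \<open>2 powr s \<le> 2\<close>.\<close>

lemma sobolev_weight_le: "sobolev_weight s \<xi> \<le> 2 * (1 + symbol \<xi>)"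
proof -
  let ?a = "(2 * pi * norm \<xi>)\<^sup>2"
  have "(1 + ?a) powr s \<le> (2 * max 1 ?a) powr s" using s_pos by (intro powr_mono2) auto
  also have "\<dots> = 2 powr s * max 1 ?a powr s" by (intro powr_mult) 
  also have "\<dots> \<le> 2 powr 1 * (1 + ?a powr s)"
  proof (rule mult_mono)
    show "2 powr s \<le> (2::real) powr 1" using alpha by (intro powr_mono) auto
    show "max 1 ?a powr s \<le> 1 + ?a powr s" by (simp add: max_def)
  qed auto
  finally show ?thesis unfolding symbol_eq by simp
qed

lemma symbol_measurable: "symbol \<in> borel_measurable lebesgue"
  by (rule measurable_completion) measurable

lemma L2_integrable: assumes "u \<in> V" "v \<in> V" shows "integrable lebesgue (\<lambda>x. u x * v x)"
proof (rule Bochner_Integration.integrable_bound)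
  note iu = in_HD[OF V_in_H[OF assms(1)]] and iv = in_HD[OF V_in_H[OF assms(2)]]
  note [measurable] = iu(4) iv(4)
  show "integrable lebesgue (\<lambda>x. (u x)\<^sup>2 + (v x)\<^sup>2)" using iu iv by simp
  show "(\<lambda>x. u x * v x) \<in> borel_measurable lebesgue" by measurable
  have "\<bar>u x * v x\<bar> \<le> (u x)\<^sup>2 + (v x)\<^sup>2" for x
  proof -
    have "2 * (\<bar>u x\<bar> * \<bar>v x\<bar>) \<le> (u x)\<^sup>2 + (v x)\<^sup>2" using sum_squares_bound[of "\<bar>u x\<bar>" "\<bar>v x\<bar>"] by simp
    moreover have "0 \<le> \<bar>u x\<bar> * \<bar>v x\<bar>" by simp
    ultimately show ?thesis unfolding abs_mult by linarith
  qed
  then show "AE x in lebesgue. norm (u x * v x) \<le> norm ((u x)\<^sup>2 + (v x)\<^sup>2)" by simp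
qed

lemma symbol_square_integrable: 
  assumes "u \<in> V" shows "integrable lebesgue (\<lambda>\<xi>. symbol \<xi> * (cmod (fourier u \<xi>))\<^sup>2)"
proof (rule Bochner_Integration.integrable_bound)
  note iu = in_HD[OF V_in_H[OF assms]]
  note [measurable] = iu(5) symbol_measurable
  show "integrable lebesgue (\<lambda>\<xi>. sobolev_weight s \<xi> * (cmod (fourier u \<xi>))\<^sup>2)" by (rule iu)
  show "(\<lambda>\<xi>. symbol \<xi> * (cmod (fourier u \<xi>))\<^sup>2) \<in> borel_measurable lebesgue" by measurable
  show "AE \<xi> in lebesgue. norm (symbol \<xi> * (cmod (fourier u \<xi>))\<^sup>2) \<le> norm (sobolev_weight s \<xi> * (cmod (fourier u \<xi>))\<^sup>2)"
    using symbol_le by (intro AE_I2) (simp add: abs_mult mult_right_mono)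
qed

lemma symbol_integrable: 
  assumes "u \<in> V" "v \<in> V"
  shows "integrable lebesgue (\<lambda>\<xi>. complex_of_real (symbol \<xi>) * (fourier u \<xi> * cnj (fourier v \<xi>)))"
proof (rule Bochner_Integration.integrable_bound)
  note iu = in_HD[OF V_in_H[OF assms(1)]] and iv = in_HD[OF V_in_H[OF assms(2)]]
  note [measurable] = iu(5) iv(5) symbol_measurable
  show "integrable lebesgue (\<lambda>\<xi>. symbol \<xi> * (cmod (fourier u \<xi>))\<^sup>2 + symbol \<xi> * (cmod (fourier v \<xi>))\<^sup>2)"
    by (intro Bochner_Integration.integrable_add symbol_square_integrable assms)
  have "(\<lambda>\<xi>. cnj (fourier v \<xi>)) \<in> borel_measurable lebesgue"
    by (rule borel_measurable_continuous_on[OF _ iv(5)]) (intro continuous_intros)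
  then show "(\<lambda>\<xi>. complex_of_real (symbol \<xi>) * (fourier u \<xi> * cnj (fourier v \<xi>))) \<in> borel_measurable lebesgue"
  proof (intro borel_measurable_times)
    show "(\<lambda>\<xi>. complex_of_real (symbol \<xi>)) \<in> borel_measurable lebesgue"
      by (rule borel_measurable_continuous_on[OF _ symbol_measurable]) (intro continuous_intros)
  qed (rule iu(5))
  have "norm (complex_of_real (symbol \<xi>) * (fourier u \<xi> * cnj (fourier v \<xi>))) \<le> symbol \<xi> * (cmod (fourier u \<xi>))\<^sup>2 + symbol \<xi> * (cmod (fourier v \<xi>))\<^sup>2" for \<xi>
  proof -
    have "2 * (cmod (fourier u \<xi>) * cmod (fourier v \<xi>)) \<le> (cmod (fourier u \<xi>))\<^sup>2 + (cmod (fourier v \<xi>))\<^sup>2"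
      using sum_squares_bound[of "cmod (fourier u \<xi>)" "cmod (fourier v \<xi>)"] by simp
    moreover have "0 \<le> cmod (fourier u \<xi>) * cmod (fourier v \<xi>)" by simp
    ultimately have "cmod (fourier u \<xi>) * cmod (fourier v \<xi>) \<le> (cmod (fourier u \<xi>))\<^sup>2 + (cmod (fourier v \<xi>))\<^sup>2" by linarith
    then have "symbol \<xi> * (cmod (fourier u \<xi>) * cmod (fourier v \<xi>)) \<le> symbol \<xi> * ((cmod (fourier u \<xi>))\<^sup>2 + (cmod (fourier v \<xi>))\<^sup>2)"
      by (rule mult_left_mono) simp
    then show ?thesis by (simp add: norm_mult distrib_left)
  qed
  then show "AE \<xi> in lebesgue. norm (complex_of_real (symbol \<xi>) * (fourier u \<xi> * cnj (fourier v \<xi>))) \<le> norm (symbol \<xi> * (cmod (fourier u \<xi>))\<^sup>2 + symbol \<xi> * (cmod (fourier v \<xi>))\<^sup>2)"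
    by (intro AE_I2) (auto intro: order_trans[OF _ abs_ge_self])
qed

lemma frac_form_diag: "frac_form \<alpha> u u = (LINT \<xi>|lebesgue. symbol \<xi> * (cmod (fourier u \<xi>))\<^sup>2)"
proof -
  have "complex_of_real (symbol \<xi>) * (fourier u \<xi> * cnj (fourier u \<xi>)) = complex_of_real (symbol \<xi> * (cmod (fourier u \<xi>))\<^sup>2)" for \<xi>
    by (simp only: complex_norm_square of_real_mult)
  then have "frac_form \<alpha> u u = Re (LINT \<xi>|lebesgue. complex_of_real (symbol \<xi> * (cmod (fourier u \<xi>))\<^sup>2))"
    unfolding frac_form_def by (simp only:)
  also have "\<dots> = (LINT \<xi>|lebesgue. symbol \<xi> * (cmod (fourier u \<xi>))\<^sup>2)"
    by (subst integral_complex_of_real) simp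
  finally show ?thesis .
qed

lemma frac_form_psd: "psd_form V (frac_form \<alpha>)"
proof
  show "(\<lambda>x. a * u x + c * v x) \<in> V" if "u \<in> V" "v \<in> V" for u v a c using that by (rule V_lincomb)
  show "frac_form \<alpha> u v = frac_form \<alpha> v u" if "u \<in> V" "v \<in> V" for u v
  proof -
    have "frac_form \<alpha> u v = Re (cnj (LINT \<xi>|lebesgue. complex_of_real (symbol \<xi>) * (fourier u \<xi> * cnj (fourier v \<xi>))))"
      by (simp add: frac_form_def)
    also have "\<dots> = Re (LINT \<xi>|lebesgue. cnj (complex_of_real (symbol \<xi>) * (fourier u \<xi> * cnj (fourier v \<xi>))))"
      by (subst Bochner_Integration.integral_cnj) simp
    also have "\<dots> = frac_form \<alpha> v u" by (simp add: frac_form_def mult_ac)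
    finally show ?thesis .
  qed
  show "frac_form \<alpha> (\<lambda>x. a * u x + c * v x) w = a * frac_form \<alpha> u w + c * frac_form \<alpha> v w"
    if "u \<in> V" "v \<in> V" "w \<in> V" for u v w a c
  proof -
    have "(LINT \<xi>|lebesgue. complex_of_real (symbol \<xi>) * (fourier (\<lambda>x. a * u x + c * v x) \<xi> * cnj (fourier w \<xi>)))
      = (LINT \<xi>|lebesgue. of_real a * (complex_of_real (symbol \<xi>) * (fourier u \<xi> * cnj (fourier w \<xi>)))
           + of_real c * (complex_of_real (symbol \<xi>) * (fourier v \<xi> * cnj (fourier w \<xi>))))"
      unfolding fourier_lincomb[OF in_HD(1)[OF V_in_H[OF that(1)]] in_HD(1)[OF V_in_H[OF that(2)]]]
      by (simp add: algebra_simps)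
    also have "\<dots> = of_real a * (LINT \<xi>|lebesgue. complex_of_real (symbol \<xi>) * (fourier u \<xi> * cnj (fourier w \<xi>)))
           + of_real c * (LINT \<xi>|lebesgue. complex_of_real (symbol \<xi>) * (fourier v \<xi> * cnj (fourier w \<xi>)))"
      using symbol_integrable[OF that(1,3)] symbol_integrable[OF that(2,3)] by simp
    finally show ?thesis unfolding frac_form_def by simp
  qed
  show "0 \<le> frac_form \<alpha> u u" for u :: "real^'n \<Rightarrow> real" unfolding frac_form_diag by (intro Bochner_Integration.integral_nonneg) simp
qed

lemma L2_form_psd: "psd_form V L2_form"
proof
  show "(\<lambda>x. a * u x + c * v x) \<in> V" if "u \<in> V" "v \<in> V" for u v a c using that by (rule V_lincomb)
  show "L2_form u v = L2_form v u" for u v by (simp add: L2_form_def mult.commute)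
  show "0 \<le> L2_form u u" for u unfolding L2_form_def by (intro Bochner_Integration.integral_nonneg) simp
  show "L2_form (\<lambda>x. a * u x + c * v x) w = a * L2_form u w + c * L2_form v w"
    if "u \<in> V" "v \<in> V" "w \<in> V" for u v w a c
  proof -
    have "L2_form (\<lambda>x. a * u x + c * v x) w = (LINT x|lebesgue. a * (u x * w x) + c * (v x * w x))"
      unfolding L2_form_def by (simp add: algebra_simps)
    also have "\<dots> = a * L2_form u w + c * L2_form v w"
      unfolding L2_form_def using L2_integrable[OF that(1,3)] L2_integrable[OF that(2,3)] by simp
    finally show ?thesis .
  qed
qed

lemma L2_form_diag: "L2_form u u = (LINT x|lebesgue. (u x)\<^sup>2)" by (simp add: L2_form_def power2_eq_square)

lemma form_le_H_norm2:
  assumes "u \<in> V" shows "L2_form u u \<le> H_norm2 s u" "frac_form \<alpha> u u \<le> H_norm2 s u"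
proof -
  show "L2_form u u \<le> H_norm2 s u" unfolding L2_form_diag by (rule V_L2[OF assms])
  show "frac_form \<alpha> u u \<le> H_norm2 s u" unfolding frac_form_diag H_norm2_def
    by (rule integral_mono[OF symbol_square_integrable[OF assms] in_HD(3)[OF V_in_H[OF assms]]])
       (simp add: mult_right_mono symbol_le)
qed

lemma H_norm2_le_form:
  assumes "u \<in> V" shows "H_norm2 s u \<le> 2 * (L2_form u u + frac_form \<alpha> u u)"
proof -
  note iu = in_HD[OF V_in_H[OF assms]]
  note P = Plancherel_fourier[OF iu(1,2)]
  have "H_norm2 s u \<le> (LINT \<xi>|lebesgue. 2 * ((cmod (fourier u \<xi>))\<^sup>2 + symbol \<xi> * (cmod (fourier u \<xi>))\<^sup>2))"
    unfolding H_norm2_def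
  proof (rule integral_mono[OF iu(3)])
    show "integrable lebesgue (\<lambda>\<xi>. 2 * ((cmod (fourier u \<xi>))\<^sup>2 + symbol \<xi> * (cmod (fourier u \<xi>))\<^sup>2))"
      using P(1) symbol_square_integrable[OF assms] by (intro integrable_mult_right Bochner_Integration.integrable_add)
    show "sobolev_weight s \<xi> * (cmod (fourier u \<xi>))\<^sup>2 \<le> 2 * ((cmod (fourier u \<xi>))\<^sup>2 + symbol \<xi> * (cmod (fourier u \<xi>))\<^sup>2)" for \<xi>
      using mult_right_mono[OF sobolev_weight_le[of \<xi>], of "(cmod (fourier u \<xi>))\<^sup>2"] by (simp add: algebra_simps)
  qed
  also have "\<dots> = 2 * (L2_form u u + frac_form \<alpha> u u)"
    unfolding frac_form_diag L2_form_diag using P symbol_square_integrable[OF assms] by simp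
  finally show ?thesis .
qed

lemma disjoint_balls:
  obtains c :: "nat \<Rightarrow> real^'n" and r where "r > 0" "\<And>i. i < n \<Longrightarrow> cball (c i) r \<subseteq> D"
    "\<And>i k. i < n \<Longrightarrow> k < n \<Longrightarrow> i \<noteq> k \<Longrightarrow> cball (c i) r \<inter> cball (c k) r = {}"
proof -
  obtain a where "a \<in> D" using D(3) by auto
  then obtain R where R: "R > 0" "ball a R \<subseteq> D" using D(1) openE by blast
  obtain e :: "real^'n" where e: "norm e = 1" using norm_axis_1 by blast
  \<comment> \<open>The centres lie on a ray from \<open>a\<close> with spacing \<open>h\<close>.
    The first \<open>n\<close> of them stay within \<open>R / 2\<close> of \<open>a\<close>; radius
    \<open>h / 4\<close> keeps the closed balls disjoint and inside \<open>ball a R\<close>.\<close>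
  define h where "h = R / (2 * (real n + 1))"
  have h: "h > 0" using R by (simp add: h_def)
  have hn: "real i * h \<le> R / 2" if "i < n" for i
  proof -
    have "real i * h \<le> (real n + 1) * h" using that h by (intro mult_right_mono) auto
    also have "\<dots> = R / 2"
    proof -
      have "real n + 1 \<noteq> 0" by simp
      then show ?thesis unfolding h_def by (simp add: divide_simps)
    qed
    finally show ?thesis .
  qed
  have hR: "h \<le> R / 2" unfolding h_def using R by (simp add: field_simps)
  define c where "c i = a + (real i * h) *\<^sub>R e" for i
  have "cball (c i) (h / 4) \<subseteq> D" if i: "i < n" for i
  proof
    fix x assume "x \<in> cball (c i) (h / 4)"
    then have "dist (c i) x \<le> h / 4" by simp
    moreover have "dist a (c i) \<le> R / 2" using hn[OF i] h e by (simp add: c_def dist_norm)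
    ultimately have "dist a x < R" using dist_triangle[of a x "c i"] hR R by simp
    then show "x \<in> D" using R by auto
  qed
  moreover have "cball (c i) (h / 4) \<inter> cball (c k) (h / 4) = {}" if "i \<noteq> k" for i k
  proof (rule ccontr)
    assume "cball (c i) (h / 4) \<inter> cball (c k) (h / 4) \<noteq> {}"
    then obtain x where "dist (c i) x \<le> h / 4" "dist (c k) x \<le> h / 4" by auto
    then have 1: "dist (c i) (c k) \<le> h / 2" using dist_triangle2[of "c i" "c k" x] by simp
    have "c i - c k = ((real i - real k) * h) *\<^sub>R e" by (simp add: c_def algebra_simps)
    then have "dist (c i) (c k) = \<bar>real i - real k\<bar> * h" using e h by (simp add: dist_norm abs_mult)
    moreover have "1 \<le> \<bar>real i - real k\<bar>" using that by linarith
    ultimately have "h \<le> dist (c i) (c k)" using h by simp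
    then show False using 1 h by simp
  qed
  ultimately show ?thesis using that[of "h / 4" c] h by auto
qed

text \<open>Normalized bumps on disjoint balls. Infinite dimension guarantees that the minimization
  never runs out of unit vectors.\<close>

lemma orthonormal_family_exists:
  "\<exists>u. (\<forall>i<n::nat. u i \<in> V) \<and> (\<forall>i<n. \<forall>k<n. L2_form (u i) (u k) = (if i = k then 1 else 0))"
proof -
  obtain c :: "nat \<Rightarrow> real^'n" and r where r: "r > 0" and sub: "\<And>i. i < n \<Longrightarrow> cball (c i) r \<subseteq> D"
    and disj: "\<And>i k. i < n \<Longrightarrow> k < n \<Longrightarrow> i \<noteq> k \<Longrightarrow> cball (c i) r \<inter> cball (c k) r = {}"
    using disjoint_balls[of n] by metis
  define \<phi> where "\<phi> i = bump (c i) r" for i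
  have t: "\<phi> i \<in> test_fun D" if "i < n" for i unfolding \<phi>_def by (rule test_fun_bump[OF r sub[OF that]])
  have V: "\<phi> i \<in> V" if "i < n" for i by (rule test_fun_form_domain[OF t[OF that] alpha(2)])
  have orth: "\<phi> i x * \<phi> k x = 0" if "i < n" "k < n" "i \<noteq> k" for i k x
  proof (rule ccontr)
    assume "\<phi> i x * \<phi> k x \<noteq> 0"
    then have "x \<in> ball (c i) r" "x \<in> ball (c k) r" using bump_nonzero_iff[OF r] by (auto simp: \<phi>_def)
    then have "x \<in> cball (c i) r \<inter> cball (c k) r" by auto
    then show False using disj[OF that] by auto
  qed
  have pos: "L2_form (\<phi> i) (\<phi> i) > 0" if i: "i < n" for i
  proof (rule ccontr)
    assume "\<not> ?thesis"
    moreover have "0 \<le> L2_form (\<phi> i) (\<phi> i)" by (rule psd_form.nonneg[OF L2_form_psd V[OF i]])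
    ultimately have "L2_form (\<phi> i) (\<phi> i) = 0" by simp
    then have "(LINT x|lebesgue. (\<phi> i x)\<^sup>2) = 0" by (simp add: L2_form_diag)
    then have "AE x in lebesgue. (\<phi> i x)\<^sup>2 = 0"
      using integral_nonneg_eq_0_iff_AE[OF in_HD(2)[OF V_in_H[OF V[OF i]]]] by simp
    then have "AE x in lebesgue. x \<notin> ball (c i) r"
      by eventually_elim (use bump_nonzero_iff[OF r, of "c i"] in \<open>auto simp: \<phi>_def\<close>)
    then have "negligible (ball (c i) r)"
      by (simp add: negligible_iff_null_sets AE_iff_null_sets)
    then show False using open_not_negligible[of "ball (c i) r"] r by simp
  qed
  let ?u = "\<lambda>i x. (1 / sqrt (L2_form (\<phi> i) (\<phi> i))) * \<phi> i x"
  have "?u i \<in> V" if "i < n" for i by (rule psd_form.scale_mem[OF L2_form_psd V[OF that]])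
  moreover have "L2_form (?u i) (?u k) = (if i = k then 1 else 0)" if "i < n" "k < n" for i k
  proof (cases "i = k")
    case True
    have "L2_form (?u i) (?u i) = (1 / sqrt (L2_form (\<phi> i) (\<phi> i)))\<^sup>2 * L2_form (\<phi> i) (\<phi> i)"
      by (rule psd_form.scale_quadratic[OF L2_form_psd V[OF that(1)]])
    also have "\<dots> = 1" using pos[OF that(1)] by (simp add: power_divide)
    finally show ?thesis using True by simp
  next
    case False
    have "(\<lambda>x. ?u i x * ?u k x) = (\<lambda>x. 0)" using orth[OF that False] by (intro ext) auto
    then have "L2_form (?u i) (?u k) = 0" by (subst L2_form_def) (simp only: Bochner_Integration.integral_zero)
    then show ?thesis using False by simp
  qed
  ultimately show ?thesis by (intro exI[of _ ?u]) auto
qed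

text \<open>The abstract theory applies because \<open>H_norm2\<close> and
  \<open>L2_form + frac_form\<close> bound each other. The null condition is Plancherel's identity
  for functions that vanish almost everywhere.\<close>

sublocale spectral: spectral_form V L2_form "frac_form \<alpha>"
proof (intro spectral_form.intro L2_form_psd frac_form_psd spectral_form_axioms.intro)
  fix u assume u: "u \<in> V" "L2_form u u = 0"
  note iu = in_HD[OF V_in_H[OF u(1)]]
  note P = Plancherel_fourier[OF iu(1,2)]
  have "(LINT \<xi>|lebesgue. (cmod (fourier u \<xi>))\<^sup>2) = 0" using P u by (simp add: L2_form_diag)
  then have "AE \<xi> in lebesgue. (cmod (fourier u \<xi>))\<^sup>2 = 0" using integral_nonneg_eq_0_iff_AE[OF P(1)] by simp
  then have "AE \<xi> in lebesgue. symbol \<xi> * (cmod (fourier u \<xi>))\<^sup>2 = 0" by eventually_elim simp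
  then show "frac_form \<alpha> u u = 0" unfolding frac_form_diag by (rule integral_eq_zero_AE)
next
  fix v :: "nat \<Rightarrow> real^'n \<Rightarrow> real" and C
  assume v: "\<And>m. v m \<in> V" and C: "\<And>m. L2_form (v m) (v m) + frac_form \<alpha> (v m) (v m) \<le> C"
  have "H_norm2 s (v m) \<le> 2 * C" for m using H_norm2_le_form[OF v[of m]] C[of m] by simp
  from form_domain_compact[of v "2 * C", OF v this]
  show "\<exists>r. strict_mono r \<and> (\<forall>e>0. \<exists>N::nat. \<forall>m\<ge>N. \<forall>l\<ge>N.
         L2_form (\<lambda>x. v (r m) x - v (r l) x) (\<lambda>x. v (r m) x - v (r l) x) < e)"
    by (simp add: L2_form_diag)
next
  fix v :: "nat \<Rightarrow> real^'n \<Rightarrow> real"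
  assume v: "\<And>m. v m \<in> V" and C: "\<forall>e>0. \<exists>N. \<forall>m\<ge>N. \<forall>l\<ge>N.
         L2_form (\<lambda>x. v m x - v l x) (\<lambda>x. v m x - v l x) + frac_form \<alpha> (\<lambda>x. v m x - v l x) (\<lambda>x. v m x - v l x) < e"
  have "\<exists>N. \<forall>m\<ge>N. \<forall>l\<ge>N. H_norm2 s (\<lambda>x. v m x - v l x) < e" if e: "e > 0" for e
  proof -
    have "e / 2 > 0" using e by simp
    then obtain N where N: "\<And>m l. m \<ge> N \<Longrightarrow> l \<ge> N \<Longrightarrow> 
      L2_form (\<lambda>x. v m x - v l x) (\<lambda>x. v m x - v l x) + frac_form \<alpha> (\<lambda>x. v m x - v l x) (\<lambda>x. v m x - v l x) < e / 2"
      using C by meson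
    have "H_norm2 s (\<lambda>x. v m x - v l x) < e" if "m \<ge> N" "l \<ge> N" for m l
      using N[OF that] H_norm2_le_form[OF V_diff[OF v v], of m l] by simp
    then show ?thesis by blast
  qed
  from form_domain_complete[of v, OF v this] obtain u where u: "u \<in> V" "(\<lambda>m. H_norm2 s (\<lambda>x. v m x - u x)) \<longlonglongrightarrow> 0" by blast
  have dV: "(\<lambda>x. v m x - u x) \<in> V" for m by (rule V_diff[OF v u(1)])
  have "(\<lambda>m. L2_form (\<lambda>x. v m x - u x) (\<lambda>x. v m x - u x)) \<longlonglongrightarrow> 0"
    by (rule tendsto_sandwich[OF _ _ tendsto_const u(2)])
       (auto intro!: always_eventually psd_form.nonneg[OF L2_form_psd dV] form_le_H_norm2[OF dV])
  moreover have "(\<lambda>m. frac_form \<alpha> (\<lambda>x. v m x - u x) (\<lambda>x. v m x - u x)) \<longlonglongrightarrow> 0"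
    by (rule tendsto_sandwich[OF _ _ tendsto_const u(2)])
       (auto intro!: always_eventually psd_form.nonneg[OF frac_form_psd dV] form_le_H_norm2[OF dV])
  ultimately show "\<exists>u\<in>V. (\<lambda>m. L2_form (\<lambda>x. v m x - u x) (\<lambda>x. v m x - u x)) \<longlonglongrightarrow> 0 \<and>
            (\<lambda>m. frac_form \<alpha> (\<lambda>x. v m x - u x) (\<lambda>x. v m x - u x)) \<longlonglongrightarrow> 0" using u(1) by blast
next
  show "\<exists>u. (\<forall>i<n. u i \<in> V) \<and> (\<forall>i<n. \<forall>k<n. L2_form (u i) (u k) = (if i = k then 1 else 0))" for n :: nat
    by (rule orthonormal_family_exists)
qed

lemma frac_eigenvalue_eq: "frac_eigenvalue \<alpha> D j = spectral.ev j"
  unfolding frac_eigenvalue_def spectral.ev_def spectral.eigen_def frac_eigenfun_def L2_form_def ..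

lemma frac_eigenvalue_sum_attained:
  "\<exists>u. spectral.ON n u \<and> (\<Sum>j=1..n. frac_eigenvalue \<alpha> D j)
     = (\<Sum>i<n. LINT \<xi>|lebesgue. symbol \<xi> * (cmod (fourier (u i) \<xi>))\<^sup>2)"
  using spectral.eigenvalue_sum_attained[of n] unfolding frac_eigenvalue_eq frac_form_diag .

lemma frac_eigenvalue_sum_le:
  assumes "spectral.ON n u"
  shows "(\<Sum>j=1..n. frac_eigenvalue \<alpha> D j) \<le> (\<Sum>i<n. LINT \<xi>|lebesgue. symbol \<xi> * (cmod (fourier (u i) \<xi>))\<^sup>2)"
  using spectral.eigenvalue_sum_le[OF assms] unfolding frac_eigenvalue_eq frac_form_diag .

lemma eigenvalue_sum_nonneg: "0 \<le> (\<Sum>j=1..n. frac_eigenvalue \<alpha> D j)"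
proof -
  obtain u where "(\<Sum>j=1..n. frac_eigenvalue \<alpha> D j)
     = (\<Sum>i<n. LINT \<xi>|lebesgue. symbol \<xi> * (cmod (fourier (u i) \<xi>))\<^sup>2)"
    using frac_eigenvalue_sum_attained[of n] by blast
  also have "0 \<le> \<dots>" by (intro sum_nonneg Bochner_Integration.integral_nonneg) simp
  finally show ?thesis .
qed

end

section \<open>Linear images of the domain\<close>

text \<open>\<open>L\<close> moves the domain, and functions are transplanted by composition with
  its inverse \<open>K\<close>; carrying both maps avoids inverses in the formulas.\<close>

locale linear_iso =
  fixes K L :: "real^'n::finite \<Rightarrow> real^'n"
  assumes lin: "linear K" "linear L" and KL: "\<And>x. K (L x) = x" and LK: "\<And>x. L (K x) = x"
begin

lemma bij: "bij K" "bij L"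
  by (rule bij_betw_byWitness[where f'=L], auto simp: KL LK)
     (rule bij_betw_byWitness[where f'=K], auto simp: KL LK)

lemma adj: "linear (adjoint K)" "linear (adjoint L)" "adjoint K (adjoint L x) = x" "adjoint L (adjoint K x) = x"
proof -
  show "linear (adjoint K)" "linear (adjoint L)" using lin by (auto intro: adjoint_linear)
  have "y \<bullet> adjoint K (adjoint L x) = y \<bullet> x" "y \<bullet> adjoint L (adjoint K x) = y \<bullet> x" for y
    using lin by (simp_all add: adjoint_works KL LK)
  then show "adjoint K (adjoint L x) = x" "adjoint L (adjoint K x) = x" 
    by (metis vector_eq_rdot inner_commute)+
qed

lemma adj_bij: "bij (adjoint L)"
  by (rule bij_betw_byWitness[where f'="adjoint K"]) (auto simp: adj)

abbreviation "pull u \<equiv> (\<lambda>x. u (K x))"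

lemmas jK = jac(1)[OF lin(1) bij(1)]

text \<open>Since x . \<xi> = K x . L^T \<xi>, the substitution y = K x produces the transform of
  \<open>u\<close> at L^T \<xi>.\<close>

lemma fourier_pull:
  assumes "u \<in> borel_measurable lebesgue"
  shows "fourier (pull u) \<xi> = jac K *\<^sub>R fourier u (adjoint L \<xi>)"
proof -
  have "x \<bullet> \<xi> = K x \<bullet> adjoint L \<xi>" for x using lin(2) by (simp add: adjoint_works LK)
  then have "fourier (pull u) \<xi> = (LINT x|lebesgue. (\<lambda>y. complex_of_real (u y) * cis (- 2 * pi * (y \<bullet> adjoint L \<xi>))) (K x))"
    by (simp add: fourier_def)
  also have "\<dots> = jac K *\<^sub>R fourier u (adjoint L \<xi>)"
    unfolding fourier_def using assms cis_inner_lebesgue[of "- 2 * pi" "adjoint L \<xi>"]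
    by (intro integral_lebesgue_linear lin bij borel_measurable_times) simp_all
  finally show ?thesis .
qed

text \<open>Substitution \<eta> = L^T \<xi>, so \<xi> = K^T \<eta>. The adjoint of \<open>K\<close>
  ends up inside the weight; with the symbol as weight this is the source of the quadratic form in
  \<eta> that is averaged later.\<close>

lemma weighted_pull:
  fixes h :: "real^'n \<Rightarrow> real"
  assumes u: "u \<in> borel_measurable lebesgue" and h: "h \<in> borel_measurable borel"
  shows "integrable lebesgue (\<lambda>\<xi>. h \<xi> * (cmod (fourier (pull u) \<xi>))\<^sup>2)
       \<longleftrightarrow> integrable lebesgue (\<lambda>\<eta>. h (adjoint K \<eta>) * (cmod (fourier u \<eta>))\<^sup>2)"
    and "(LINT \<xi>|lebesgue. h \<xi> * (cmod (fourier (pull u) \<xi>))\<^sup>2)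
       = ((jac K)\<^sup>2 * jac (adjoint L)) * (LINT \<eta>|lebesgue. h (adjoint K \<eta>) * (cmod (fourier u \<eta>))\<^sup>2)"
proof -
  let ?f = "\<lambda>\<eta>. (jac K)\<^sup>2 * (h (adjoint K \<eta>) * (cmod (fourier u \<eta>))\<^sup>2)"
  have [measurable]: "adjoint K \<in> borel_measurable borel"
    using adj(1) by (intro borel_measurable_continuous_onI linear_continuous_on) (simp add: linear_conv_bounded_linear)
  note [measurable] = h fourier_measurable[OF u]
  have m: "?f \<in> borel_measurable lebesgue" by (rule measurable_completion) measurable
  have eq: "h \<xi> * (cmod (fourier (pull u) \<xi>))\<^sup>2 = ?f (adjoint L \<xi>)" for \<xi>
    unfolding fourier_pull[OF u] using jK by (simp add: adj power_mult_distrib)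
  show "integrable lebesgue (\<lambda>\<xi>. h \<xi> * (cmod (fourier (pull u) \<xi>))\<^sup>2)
       \<longleftrightarrow> integrable lebesgue (\<lambda>\<eta>. h (adjoint K \<eta>) * (cmod (fourier u \<eta>))\<^sup>2)"
    unfolding eq using integrable_lebesgue_linear[OF adj(2) adj_bij m] jK by simp
  show "(LINT \<xi>|lebesgue. h \<xi> * (cmod (fourier (pull u) \<xi>))\<^sup>2)
       = ((jac K)\<^sup>2 * jac (adjoint L)) * (LINT \<eta>|lebesgue. h (adjoint K \<eta>) * (cmod (fourier u \<eta>))\<^sup>2)"
    unfolding eq using integral_lebesgue_linear[OF adj(2) adj_bij m] by simp
qed

lemma pull_square:
  assumes "u \<in> borel_measurable lebesgue"
  shows "(LINT x|lebesgue. (pull u x)\<^sup>2) = jac K * (LINT x|lebesgue. (u x)\<^sup>2)"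
  using assms integral_lebesgue_linear[OF lin(1) bij(1), of "\<lambda>y. (u y)\<^sup>2"] by simp

text \<open>This is \<open>|det K| |det L\<^sup>T| = 1\<close>, read off from Plancherel's identity for a function and its pullback.\<close>

lemma jac_adjoint: "jac K * jac (adjoint L) = 1"
proof -
  define \<phi> :: "real^'n \<Rightarrow> real" where "\<phi> = bump 0 1"
  have t: "\<phi> \<in> test_fun UNIV" unfolding \<phi>_def by (rule test_fun_bump) auto
  have "in_H 1 \<phi>" by (rule test_fun_in_H[OF t]) simp
  note i = in_HD[OF this]
  have ip: "integrable lebesgue (pull \<phi>)" "integrable lebesgue (\<lambda>x. (pull \<phi> x)\<^sup>2)"
    using integrable_lebesgue_linear[OF lin(1) bij(1) i(4)] integrable_lebesgue_linear[OF lin(1) bij(1), of "\<lambda>y. (\<phi> y)\<^sup>2"] i by auto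
  have "(LINT x|lebesgue. (\<phi> x)\<^sup>2) \<noteq> 0"
  proof
    assume "(LINT x|lebesgue. (\<phi> x)\<^sup>2) = 0"
    then have "AE x in lebesgue. (\<phi> x)\<^sup>2 = 0" using integral_nonneg_eq_0_iff_AE[OF i(2)] by simp
    then have "AE x in lebesgue. x \<notin> ball (0::real^'n) 1"
      by eventually_elim (use bump_nonzero_iff[of 1 "0::real^'n"] in \<open>auto simp: \<phi>_def\<close>)
    then have "negligible (ball (0::real^'n) 1)" by (simp add: negligible_iff_null_sets AE_iff_null_sets)
    then show False using open_not_negligible[of "ball (0::real^'n) 1"] by simp
  qed
  moreover have "jac K * (LINT x|lebesgue. (\<phi> x)\<^sup>2) = ((jac K)\<^sup>2 * jac (adjoint L)) * (LINT x|lebesgue. (\<phi> x)\<^sup>2)"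
    using Plancherel_fourier(2)[OF ip] Plancherel_fourier(2)[OF i(1,2)] pull_square[OF i(4)] weighted_pull(2)[OF i(4), of "\<lambda>_. 1"]
    by simp
  ultimately have "jac K * 1 = jac K * (jac K * jac (adjoint L))" by (simp add: power2_eq_square)
  then show ?thesis using jK by (metis less_irrefl mult_left_cancel)
qed

lemma weighted_pull':
  fixes h :: "real^'n \<Rightarrow> real"
  assumes "u \<in> borel_measurable lebesgue" "h \<in> borel_measurable borel"
  shows "(LINT \<xi>|lebesgue. h \<xi> * (cmod (fourier (pull u) \<xi>))\<^sup>2)
       = jac K * (LINT \<eta>|lebesgue. h (adjoint K \<eta>) * (cmod (fourier u \<eta>))\<^sup>2)"
  using weighted_pull(2)[OF assms] jac_adjoint by (simp add: power2_eq_square)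

lemma sobolev_weight_adjoint: 
  assumes "0 \<le> s"
  obtains B where "B \<ge> 0" "\<And>\<eta>. sobolev_weight s (adjoint K \<eta>) \<le> B * sobolev_weight s \<eta>"
proof -
  obtain b where b: "b > 0" "\<And>x. norm (adjoint K x) \<le> b * norm x" using linear_bounded_pos[OF adj(1)] by blast
  \<comment> \<open>With \<open>c \<ge> 1\<close> the factor \<open>c\<^sup>2\<close> also dominates
    the constant term 1 of the weight.\<close>
  define c where "c = max 1 b"
  have c: "c \<ge> 1" "norm (adjoint K x) \<le> c * norm x" for x
    using b(2)[of x] mult_right_mono[of b c "norm x"] unfolding c_def by (auto intro: order_trans)
  have "sobolev_weight s (adjoint K \<eta>) \<le> (c\<^sup>2) powr s * sobolev_weight s \<eta>" for \<eta>
  proof -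
    have "(2 * pi * norm (adjoint K \<eta>))\<^sup>2 \<le> (2 * pi * (c * norm \<eta>))\<^sup>2"
      using c by (intro power_mono mult_left_mono) auto
    also have "\<dots> = c\<^sup>2 * (2 * pi * norm \<eta>)\<^sup>2" by (simp add: power_mult_distrib)
    finally have "1 + (2 * pi * norm (adjoint K \<eta>))\<^sup>2 \<le> c\<^sup>2 * (1 + (2 * pi * norm \<eta>)\<^sup>2)"
      using add_mono[OF one_le_power[OF c(1), of 2]] by (simp only: distrib_left mult_1_right)
    then have "sobolev_weight s (adjoint K \<eta>) \<le> (c\<^sup>2 * (1 + (2 * pi * norm \<eta>)\<^sup>2)) powr s"
      using assms by (intro powr_mono2) auto
    also have "\<dots> = (c\<^sup>2) powr s * sobolev_weight s \<eta>" by (intro powr_mult)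
    finally show ?thesis .
  qed
  then show ?thesis by (intro that[of "(c\<^sup>2) powr s"]) auto
qed

lemma pull_in_H: 
  assumes s: "0 \<le> s"
  obtains C where "C \<ge> 0" "\<And>u. in_H s u \<Longrightarrow> in_H s (pull u)" "\<And>u. in_H s u \<Longrightarrow> H_norm2 s (pull u) \<le> C * H_norm2 s u"
proof -
  obtain B where B: "B \<ge> 0" "\<And>\<eta>. sobolev_weight s (adjoint K \<eta>) \<le> B * sobolev_weight s \<eta>"
    using sobolev_weight_adjoint[OF s] by metis
  have w: "sobolev_weight s \<in> borel_measurable (borel :: (real^'n) measure)" by measurable
  have *: "in_H s (pull u) \<and> H_norm2 s (pull u) \<le> (jac K * B) * H_norm2 s u" if u: "in_H s u" for u
  proof -
    note i = in_HD[OF u]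
    have [measurable]: "adjoint K \<in> borel_measurable borel"
      using adj(1) by (intro borel_measurable_continuous_onI linear_continuous_on) (simp add: linear_conv_bounded_linear)
    note [measurable] = fourier_measurable[OF i(4)]
    have le: "sobolev_weight s (adjoint K \<eta>) * (cmod (fourier u \<eta>))\<^sup>2 \<le> B * (sobolev_weight s \<eta> * (cmod (fourier u \<eta>))\<^sup>2)" for \<eta>
      using mult_right_mono[OF B(2)[of \<eta>], of "(cmod (fourier u \<eta>))\<^sup>2"] by (simp add: mult.assoc)
    have i2: "integrable lebesgue (\<lambda>\<eta>. sobolev_weight s (adjoint K \<eta>) * (cmod (fourier u \<eta>))\<^sup>2)"
    proof (rule Bochner_Integration.integrable_bound)
      show "integrable lebesgue (\<lambda>\<eta>. B * (sobolev_weight s \<eta> * (cmod (fourier u \<eta>))\<^sup>2))" using i by simp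
      show "(\<lambda>\<eta>. sobolev_weight s (adjoint K \<eta>) * (cmod (fourier u \<eta>))\<^sup>2) \<in> borel_measurable lebesgue"
        by (rule measurable_completion) measurable
      show "AE \<eta> in lebesgue. norm (sobolev_weight s (adjoint K \<eta>) * (cmod (fourier u \<eta>))\<^sup>2) \<le> norm (B * (sobolev_weight s \<eta> * (cmod (fourier u \<eta>))\<^sup>2))"
        by (intro AE_I2) (use le in \<open>auto intro: order_trans[OF _ abs_ge_self]\<close>)
    qed
    have "integrable lebesgue (pull u)" "integrable lebesgue (\<lambda>x. (pull u x)\<^sup>2)"
      using integrable_lebesgue_linear[OF lin(1) bij(1) i(4)] integrable_lebesgue_linear[OF lin(1) bij(1), of "\<lambda>y. (u y)\<^sup>2"] i by auto
    then have "in_H s (pull u)" unfolding in_H_def weighted_pull(1)[OF i(4) w] using i2 by simp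
    moreover have "H_norm2 s (pull u) \<le> jac K * (LINT \<eta>|lebesgue. B * (sobolev_weight s \<eta> * (cmod (fourier u \<eta>))\<^sup>2))"
      unfolding H_norm2_def weighted_pull'[OF i(4) w] using jK i i2 le by (intro mult_left_mono integral_mono) auto
    ultimately show ?thesis by (simp add: H_norm2_def mult.assoc)
  qed
  show ?thesis by (rule that[of "jac K * B"]) (use * jK B in auto)
qed

lemma pull_form_domain:
  assumes a: "0 < \<alpha>" "\<alpha> \<le> 2" and E: "K ` E = D" and u: "u \<in> form_domain \<alpha> D"
  shows "pull u \<in> form_domain \<alpha> E"
proof (rule form_domainI)
  obtain C where C: "C \<ge> 0" "\<And>u. in_H (\<alpha>/2) u \<Longrightarrow> in_H (\<alpha>/2) (pull u)" "\<And>u. in_H (\<alpha>/2) u \<Longrightarrow> H_norm2 (\<alpha>/2) (pull u) \<le> C * H_norm2 (\<alpha>/2) u"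
    using pull_in_H[of "\<alpha>/2"] a by (metis half_gt_zero less_imp_le)
  show "in_H (\<alpha>/2) (pull u)" by (rule C(2)[OF form_domainD(1)[OF u]])
  fix e :: real assume e: "e > 0"
  then have "e / (C + 1) > 0" using C(1) by simp
  then obtain \<phi> where \<phi>: "\<phi> \<in> test_fun D" "H_norm2 (\<alpha>/2) (\<lambda>x. \<phi> x - u x) < e / (C + 1)" using form_domainD(2)[OF u] by blast
  have "in_H (\<alpha>/2) (\<lambda>x. \<phi> x - u x)" using a by (intro in_H_diff(1) test_fun_in_H[OF \<phi>(1)] form_domainD(1)[OF u]) simp
  then have "H_norm2 (\<alpha>/2) (\<lambda>x. pull \<phi> x - pull u x) \<le> C * H_norm2 (\<alpha>/2) (\<lambda>x. \<phi> x - u x)" by (rule C(3))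
  also have "\<dots> \<le> C * (e / (C + 1))" using C(1) \<phi>(2) by (intro mult_left_mono) auto
  also have "\<dots> < e" using C(1) e by (simp add: field_simps)
  finally show "\<exists>\<psi>\<in>test_fun E. H_norm2 (\<alpha>/2) (\<lambda>x. \<psi> x - pull u x) < e"
    using test_fun_pullback[OF \<phi>(1) lin(1) bij(1) E] by (intro bexI[of _ "pull \<phi>"])
qed

end

section \<open>Transplantation of eigenfunctions to the image domain\<close>

locale transformed_domain = fractional_domain \<alpha> D + linear_iso K L for \<alpha> and D :: "(real^'n::finite) set" and K L :: "real^'n \<Rightarrow> real^'n"
begin

lemma image_K: "K ` (L ` D) = D" by (simp add: image_image KL)

sublocale image: fractional_domain \<alpha> "L ` D"
proof
  show "0 < \<alpha>" "\<alpha> \<le> 2" by (rule alpha)+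
  show "open (L ` D)" using lin(2) bij(2) D(1) by (simp add: open_surjective_linear_image bij_is_surj)
  show "bounded (L ` D)" using lin(2) D(2) by (simp add: bounded_linear_image linear_conv_bounded_linear)
  show "L ` D \<noteq> {}" using D(3) by simp
qed

text \<open>The functions \<open>pull (u i)\<close> are orthogonal with common squared norm
  \<open>jac K\<close>. Normalizing them cancels the same factor in \<open>weighted_pull'\<close>,
  so no determinant is left in the bound.\<close>

lemma eigenvalue_sum_image_le:
  assumes u: "spectral.ON n u"
  shows "(\<Sum>j=1..n. frac_eigenvalue \<alpha> (L ` D) j)
    \<le> (\<Sum>i<n. LINT \<eta>|lebesgue. symbol (adjoint K \<eta>) * (cmod (fourier (u i) \<eta>))\<^sup>2)"
proof -
  let ?c = "1 / sqrt (jac K)"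
  let ?v = "\<lambda>i x. ?c * pull (u i) x"
  have uV: "u i \<in> V" if "i < n" for i using u that by (simp add: spectral.ON_def)
  have pV: "pull (u i) \<in> form_domain \<alpha> (L ` D)" if "i < n" for i
    by (rule pull_form_domain[OF alpha image_K uV[OF that]])
  have c2: "?c\<^sup>2 * jac K = 1" using jK by (simp add: power_divide)
  have "image.spectral.ON n ?v"
    unfolding image.spectral.ON_def
  proof (intro conjI allI impI)
    show "?v i \<in> form_domain \<alpha> (L ` D)" if "i < n" for i by (rule image.spectral.b.scale_mem[OF pV[OF that]])
    fix i k assume ik: "i < n" "k < n"
    note m = in_HD(4)[OF V_in_H[OF uV[OF ik(1)]]] in_HD(4)[OF V_in_H[OF uV[OF ik(2)]]]
    have "image.L2_form (?v i) (?v k) = (LINT x|lebesgue. ?c\<^sup>2 * (\<lambda>y. u i y * u k y) (K x))"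
      unfolding image.L2_form_def by (simp add: power2_eq_square mult_ac)
    also have "\<dots> = ?c\<^sup>2 * (LINT x|lebesgue. (\<lambda>y. u i y * u k y) (K x))" by (rule integral_mult_right_zero)
    also have "(LINT x|lebesgue. (\<lambda>y. u i y * u k y) (K x)) = jac K *\<^sub>R (LINT y|lebesgue. u i y * u k y)"
      using m by (intro integral_lebesgue_linear lin bij) simp
    also have "?c\<^sup>2 * (jac K *\<^sub>R (LINT y|lebesgue. u i y * u k y)) = (?c\<^sup>2 * jac K) * L2_form (u i) (u k)"
      unfolding L2_form_def by simp
    also have "\<dots> = (if i = k then 1 else 0)" unfolding c2 using u ik by (simp add: spectral.ON_def)
    finally show "image.L2_form (?v i) (?v k) = (if i = k then 1 else 0)" .
  qed
  from image.frac_eigenvalue_sum_le[OF this]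
  have "(\<Sum>j=1..n. frac_eigenvalue \<alpha> (L ` D) j) \<le> (\<Sum>i<n. LINT \<xi>|lebesgue. symbol \<xi> * (cmod (fourier (?v i) \<xi>))\<^sup>2)" .
  also have "\<dots> = (\<Sum>i<n. LINT \<eta>|lebesgue. symbol (adjoint K \<eta>) * (cmod (fourier (u i) \<eta>))\<^sup>2)"
  proof (intro sum.cong refl)
    fix i assume "i \<in> {..<n}"
    then have i: "i < n" by simp
    note m = in_HD(4)[OF V_in_H[OF uV[OF i]]]
    have F: "fourier (?v i) \<xi> = of_real ?c * fourier (pull (u i)) \<xi>" for \<xi>
      using fourier_lincomb[OF in_HD(1)[OF image.V_in_H[OF pV[OF i]]] in_HD(1)[OF image.V_in_H[OF pV[OF i]]], of ?c 0 \<xi>] by simp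
    have "(LINT \<xi>|lebesgue. symbol \<xi> * (cmod (fourier (?v i) \<xi>))\<^sup>2) = (LINT \<xi>|lebesgue. ?c\<^sup>2 * (symbol \<xi> * (cmod (fourier (pull (u i)) \<xi>))\<^sup>2))"
      unfolding F by (simp only: norm_mult power_mult_distrib norm_of_real power2_abs mult.left_commute)
    also have "\<dots> = ?c\<^sup>2 * (LINT \<xi>|lebesgue. symbol \<xi> * (cmod (fourier (pull (u i)) \<xi>))\<^sup>2)" by (rule integral_mult_right_zero)
    also have "(LINT \<xi>|lebesgue. symbol \<xi> * (cmod (fourier (pull (u i)) \<xi>))\<^sup>2) = jac K * (LINT \<eta>|lebesgue. symbol (adjoint K \<eta>) * (cmod (fourier (u i) \<eta>))\<^sup>2)"
      by (rule weighted_pull'[OF m]) measurable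
    finally show "(LINT \<xi>|lebesgue. symbol \<xi> * (cmod (fourier (?v i) \<xi>))\<^sup>2) = (LINT \<eta>|lebesgue. symbol (adjoint K \<eta>) * (cmod (fourier (u i) \<eta>))\<^sup>2)"
      using c2 by (simp only: mult.assoc[symmetric] mult_1)
  qed
  finally show ?thesis .
qed

end

section \<open>Averaging over an irreducible group\<close>

lemma norm_orthogonal_vec:
  fixes U :: "real^'n::finite^'n"
  assumes "orthogonal_matrix U" shows "norm (U *v x) = norm x"
proof -
  have "(U *v x) \<bullet> (U *v x) = x \<bullet> adjoint (\<lambda>x. U *v x) (U *v x)" by (simp add: adjoint_works)
  also have "\<dots> = x \<bullet> ((transpose U ** U) *v x)" by (simp only: adjoint_matrix matrix_vector_mul_assoc)
  also have "\<dots> = x \<bullet> x" using assms by (simp add: orthogonal_matrix_def)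
  finally show ?thesis by (simp add: norm_eq_sqrt_inner)
qed

text \<open>Schur's lemma for quadratic forms: the set where an invariant form attains its maximal ratio to
  \<open>|x|\<^sup>2\<close> is the kernel of a positive semidefinite form, hence an invariant subspace.\<close>

lemma invariant_quadratic_form_scalar:
  fixes F :: "real^'n::finite \<Rightarrow> real"
  assumes irr: "irreducible_group G" and orth: "\<And>U. U \<in> G \<Longrightarrow> orthogonal_matrix U"
    and par: "\<And>x y. F (x + y) + F (x - y) = 2 * F x + 2 * F y"
    and hom: "\<And>c x. F (c *\<^sub>R x) = c\<^sup>2 * F x"
    and cont: "continuous_on UNIV F"
    and inv: "\<And>U x. U \<in> G \<Longrightarrow> F (U *v x) = F x"
  obtains c where "\<And>x. F x = c * (norm x)\<^sup>2"
proof -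
  let ?S = "sphere (0::real^'n) 1"
  obtain e where e: "e \<in> ?S" "\<And>x. x \<in> ?S \<Longrightarrow> F x \<le> F e"
  proof -
    have "?S \<noteq> {}" by simp
    then show ?thesis
      using continuous_attains_sup[OF compact_sphere _ continuous_on_subset[OF cont subset_UNIV], of 0 1] that by blast
  qed
  define c where "c = F e"
  \<comment> \<open>The defect from the maximal ratio. It is nonnegative and satisfies the
    parallelogram law, so if \<open>p\<close> vanishes at \<open>x\<close> and \<open>y\<close>,
    then the two nonnegative values at \<open>x + y\<close> and \<open>x - y\<close> sum to
    0.\<close>
  define p where "p x = c * (norm x)\<^sup>2 - F x" for x
  have p0: "0 \<le> p x" for x
  proof (cases "x = 0")
    case True
    then show ?thesis using hom[of 0 0] by (simp add: p_def)
  next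
    case False
    have "F ((1 / norm x) *\<^sub>R x) \<le> c" unfolding c_def using False by (intro e) simp
    then show ?thesis using False hom[of "1 / norm x" x] by (simp add: p_def power_divide field_simps)
  qed
  have ppar: "p (x + y) + p (x - y) = 2 * p x + 2 * p y" for x y
  proof -
    have "(norm (x + y))\<^sup>2 + (norm (x - y))\<^sup>2 = 2 * (norm x)\<^sup>2 + 2 * (norm y)\<^sup>2"
      by (simp add: power2_norm_eq_inner inner_add_left inner_add_right inner_diff_left inner_diff_right inner_commute)
    then have "c * (norm (x + y))\<^sup>2 + c * (norm (x - y))\<^sup>2 = 2 * (c * (norm x)\<^sup>2) + 2 * (c * (norm y)\<^sup>2)"
      by (metis (no_types) distrib_left mult.left_commute)
    then show ?thesis using par[of x y] by (simp add: p_def right_diff_distrib)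
  qed
  have phom: "p (a *\<^sub>R x) = a\<^sup>2 * p x" for a x by (simp add: p_def hom power_mult_distrib algebra_simps)
  let ?Z = "{x. p x = 0}"
  have "subspace ?Z"
  proof (rule subspaceI)
    show "0 \<in> ?Z" using phom[of 0 0] by simp
    show "x + y \<in> ?Z" if "x \<in> ?Z" "y \<in> ?Z" for x y using ppar[of x y] p0[of "x + y"] p0[of "x - y"] that by simp
    show "a *\<^sub>R x \<in> ?Z" if "x \<in> ?Z" for a x using that by (simp add: phom)
  qed
  moreover have "(\<lambda>x. U *v x) ` ?Z \<subseteq> ?Z" if "U \<in> G" for U
  proof -
    have "norm (U *v x) = norm x" for x
      using orth[OF that] by (simp add: norm_orthogonal_vec)
    then show ?thesis using inv[OF that] by (auto simp: p_def)
  qed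
  ultimately have "?Z = {0} \<or> ?Z = UNIV" using irr unfolding irreducible_group_def by blast
  moreover have "e \<in> ?Z" "e \<noteq> 0" using e by (auto simp: p_def c_def)
  ultimately have "?Z = UNIV" by blast
  then have "p x = 0" for x by blast
  then have "F x = c * (norm x)\<^sup>2" for x unfolding p_def by (metis eq_iff_diff_eq_0)
  then show ?thesis by (rule that)
qed

lemma matrix_inner_eq_sum: "(A::real^'n::finite^'n) \<bullet> B = (\<Sum>i\<in>UNIV. \<Sum>j\<in>UNIV. A $ i $ j * B $ i $ j)"
  by (simp add: inner_vec_def)

text \<open>The norm of a matrix as a vector of rows is the Frobenius norm: a sum over columns,
  which left multiplication by \<open>U\<close> preserves, and invariant under transposition.
  Conjugation by a group element therefore keeps the norm of the least-norm point.\<close>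

lemma norm_orthogonal_mult:
  fixes A U :: "real^'n::finite^'n"
  assumes "orthogonal_matrix U"
  shows "norm (U ** A) = norm A" "norm (A ** U) = norm A"
proof -
  have col: "(norm B)\<^sup>2 = (\<Sum>j\<in>UNIV. (norm (column j B))\<^sup>2)" for B :: "real^'n^'n"
    unfolding power2_norm_eq_inner by (simp add: inner_vec_def column_def) (rule sum.swap)
  have row: "(norm B)\<^sup>2 = (\<Sum>i\<in>UNIV. (norm (row i B))\<^sup>2)" for B :: "real^'n^'n"
    unfolding power2_norm_eq_inner by (simp add: inner_vec_def row_def)
  have t: "norm (transpose B) = norm B" for B :: "real^'n^'n"
  proof -
    have "(norm (transpose B))\<^sup>2 = (norm B)\<^sup>2" unfolding col[of B] row[of "transpose B"] by simp
    then show ?thesis by simp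
  qed
  have l: "norm (W ** B) = norm B" if "orthogonal_matrix W" for W B :: "real^'n^'n"
  proof -
    have "column j (W ** B) = W *v column j B" for j
      by (simp add: vec_eq_iff column_def matrix_matrix_mult_def matrix_vector_mult_def)
    then have "(norm (W ** B))\<^sup>2 = (norm B)\<^sup>2" unfolding col using that by (simp add: norm_orthogonal_vec)
    then show ?thesis by simp
  qed
  show "norm (U ** A) = norm A" by (rule l[OF assms])
  have "norm (A ** U) = norm (transpose (A ** U))" by (simp add: t)
  also have "\<dots> = norm (transpose U ** transpose A)" by (simp add: matrix_transpose_mul)
  also have "\<dots> = norm (transpose A)" using assms by (intro l) (simp add: orthogonal_matrix_transpose)
  finally show "norm (A ** U) = norm A" by (simp add: t)
qed

text \<open>Averaging over the group without Haar measure: the point of least norm in the closed convex hull of the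
  orbit \<open>U\<^sup>T A U\<close> is unique, hence invariant, hence scalar.\<close>

lemma orbit_average:
  fixes A E :: "real^'n::finite^'n"
  assumes irr: "irreducible_group G" and orth: "\<And>U. U \<in> G \<Longrightarrow> orthogonal_matrix U"
    and mult: "\<And>U V. U \<in> G \<Longrightarrow> V \<in> G \<Longrightarrow> U ** V \<in> G" and ne: "G \<noteq> {}"
    and E: "transpose E = E" and low: "\<And>U. U \<in> G \<Longrightarrow> b \<le> (transpose U ** A ** U) \<bullet> E"
  shows "b \<le> (\<Sum>i\<in>UNIV. A $ i $ i) / real CARD('n) * (\<Sum>i\<in>UNIV. E $ i $ i)"
proof -
  let ?O = "(\<lambda>U. transpose U ** A ** U) ` G"
  let ?K = "closure (convex hull ?O)"
  have Kc: "convex ?K" "closed ?K" "?K \<noteq> {}" using ne by (auto intro: convex_closure)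
  have sub: "?K \<subseteq> H" if "?O \<subseteq> H" "convex H" "closed H" for H
    using that by (intro closure_minimal hull_minimal) auto
  define P where "P = closest_point ?K 0"
  have PK: "P \<in> ?K" unfolding P_def by (rule closest_point_in_set[OF Kc(2,3)])
  have uniq: "X = P" if "X \<in> ?K" "norm X \<le> norm P" for X
  proof -
    have "X = closest_point ?K 0"
    proof (rule closest_point_unique[OF Kc(1,2) that(1)])
      show "\<forall>z\<in>?K. dist 0 X \<le> dist 0 z"
        using closest_point_le[OF Kc(2), of _ 0] that(2) by (auto simp: P_def intro: order_trans)
    qed
    then show ?thesis by (simp add: P_def)
  qed
  have Pinv: "transpose V ** P ** V = P" if V: "V \<in> G" for V
  proof (rule uniq)
    let ?c = "\<lambda>X. transpose V ** X ** V"
    have lc: "linear ?c"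
      by (rule linearI) (simp_all add: vec_eq_iff matrix_matrix_mult_def sum.distrib sum_distrib_left distrib_left distrib_right mult_ac)
    \<comment> \<open>The preimage of the hull under conjugation is closed and convex, and it
      contains the orbit because the orbit is stable under the group; hence it contains the
      hull.\<close>
    have "?K \<subseteq> ?c -` ?K"
    proof (rule sub)
      show "?O \<subseteq> ?c -` ?K"
      proof
        fix X assume "X \<in> ?O"
        then obtain U where U: "U \<in> G" "X = transpose U ** A ** U" by auto
        have "?c X = transpose (U ** V) ** A ** (U ** V)" by (simp add: U matrix_transpose_mul matrix_mul_assoc)
        then have "?c X \<in> ?O" using mult[OF U(1) V] by auto
        then show "X \<in> ?c -` ?K" using hull_subset[of ?O convex] closure_subset by fast
      qed
      show "convex (?c -` ?K)" by (rule convex_linear_vimage[OF lc Kc(1)])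
      show "closed (?c -` ?K)"
        using lc by (intro continuous_closed_vimage Kc) (simp add: linear_continuous_at linear_conv_bounded_linear)
    qed
    then show "?c P \<in> ?K" using PK by auto
    show "norm (?c P) \<le> norm P"
      using norm_orthogonal_mult(2)[OF orth[OF V]] norm_orthogonal_mult(1)[of "transpose V" P] orth[OF V]
      by (simp add: orthogonal_matrix_transpose)
  qed
  \<comment> \<open>The trace is linear and constant on the orbit, so a closed hyperplane contains
    the whole hull.\<close>
  have Ptr: "(\<Sum>i\<in>UNIV. P $ i $ i) = (\<Sum>i\<in>UNIV. A $ i $ i)"
  proof -
    have tr: "(\<Sum>i\<in>UNIV. X $ i $ i) = X \<bullet> mat 1" for X :: "real^'n^'n"
      by (simp add: matrix_inner_eq_sum mat_def if_distrib cong: if_cong)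
    have "?K \<subseteq> {X :: real^'n^'n. X \<bullet> mat 1 = A \<bullet> mat 1}"
    proof (rule sub)
      show "?O \<subseteq> {X :: real^'n^'n. X \<bullet> mat 1 = A \<bullet> mat 1}"
      proof
        fix X assume "X \<in> ?O"
        then obtain U where U: "U \<in> G" "X = transpose U ** (A ** U)" by (auto simp: matrix_mul_assoc)
        have "trace X = trace ((A ** U) ** transpose U)" unfolding U(2) by (rule trace_mul_sym)
        also have "\<dots> = trace A" using orth[OF U(1)] by (simp add: matrix_mul_assoc[symmetric] orthogonal_matrix_def)
        finally show "X \<in> {X :: real^'n^'n. X \<bullet> mat 1 = A \<bullet> mat 1}" unfolding trace_def by (simp add: tr)
      qed
      show "convex {X :: real^'n^'n. X \<bullet> mat 1 = A \<bullet> mat 1}" using convex_hyperplane[of "mat 1 :: real^'n^'n"] by (simp add: inner_commute)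
      show "closed {X :: real^'n^'n. X \<bullet> mat 1 = A \<bullet> mat 1}" using closed_hyperplane[of "mat 1 :: real^'n^'n"] by (simp add: inner_commute)
    qed
    then show ?thesis using PK by (auto simp: tr)
  qed
  define F where "F x = x \<bullet> (P *v x)" for x
  obtain c where c: "\<And>x. F x = c * (norm x)\<^sup>2"
  proof (rule invariant_quadratic_form_scalar[OF irr orth, of F])
    show "F (x + y) + F (x - y) = 2 * F x + 2 * F y" for x y
      by (simp add: F_def matrix_vector_right_distrib matrix_vector_mult_diff_distrib inner_add_left inner_add_right inner_diff_left inner_diff_right)
    show "F (a *\<^sub>R x) = a\<^sup>2 * F x" for a x by (simp add: F_def matrix_vector_mult_scaleR power2_eq_square)
    show "continuous_on UNIV F" unfolding F_def by (intro continuous_intros matrix_vector_mult_linear_continuous_on)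
    show "F (U *v x) = F x" if "U \<in> G" for U x
    proof -
      have "F (U *v x) = adjoint (\<lambda>x. U *v x) (P *v (U *v x)) \<bullet> x"
        using adjoint_works[of "\<lambda>x. U *v x" x "P *v (U *v x)"] by (simp add: F_def inner_commute)
      also have "\<dots> = ((transpose U ** P ** U) *v x) \<bullet> x"
        by (simp only: adjoint_matrix matrix_vector_mul_assoc matrix_mul_assoc)
      finally show ?thesis by (simp add: Pinv[OF that] F_def inner_commute)
    qed
  next
    fix c assume c: "\<And>x. F x = c * (norm x)\<^sup>2"
    show thesis by (rule that[OF c])
  qed
  have Pij: "axis i 1 \<bullet> (P *v axis j 1) = P $ i $ j" for i j
    by (simp add: matrix_vector_mult_basis inner_axis' column_def)
  have diag: "P $ i $ i = c" for i using c[of "axis i 1"] by (simp add: F_def Pij)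
  \<comment> \<open>The form x . P x sees only the symmetric part of \<open>P\<close>; polarization
    on basis vectors identifies that part as \<open>c\<close> times the identity. Symmetry of
    \<open>E\<close> removes the antisymmetric part from \<open>P \<bullet> E\<close>.\<close>
  have off: "P $ i $ j + P $ j $ i = (if i = j then 2 * c else 0)" for i j
  proof (cases "i = j")
    case False
    have "F (axis i 1 + axis j 1) = P $ i $ i + P $ i $ j + P $ j $ i + P $ j $ j"
      by (simp add: F_def matrix_vector_right_distrib inner_add_left inner_add_right Pij)
    moreover have "(norm (axis i 1 + axis j 1 :: real^'n))\<^sup>2 = 2"
      using False by (simp add: power2_norm_eq_inner inner_add_left inner_add_right inner_axis_axis)
    ultimately show ?thesis using c[of "axis i 1 + axis j 1"] diag False by simp
  qed (simp add: diag)
  have Esym: "E $ i $ j = E $ j $ i" for i j using arg_cong[OF E, of "\<lambda>M. M $ j $ i"] by (simp add: transpose_def)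
  have swap: "(\<Sum>i\<in>UNIV. \<Sum>j\<in>UNIV. P $ i $ j * E $ i $ j) = (\<Sum>i\<in>UNIV. \<Sum>j\<in>UNIV. P $ j $ i * E $ i $ j)"
    by (subst sum.swap, rule sum.cong[OF refl], rule sum.cong[OF refl], subst Esym, rule refl)
  have "2 * (P \<bullet> E) = (\<Sum>i\<in>UNIV. \<Sum>j\<in>UNIV. P $ i $ j * E $ i $ j) + (\<Sum>i\<in>UNIV. \<Sum>j\<in>UNIV. P $ j $ i * E $ i $ j)"
    unfolding swap[symmetric] matrix_inner_eq_sum by simp
  also have "\<dots> = (\<Sum>i\<in>UNIV. \<Sum>j\<in>UNIV. (P $ i $ j + P $ j $ i) * E $ i $ j)"
    by (simp only: sum.distrib[symmetric] distrib_right)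
  also have "\<dots> = 2 * (c * (\<Sum>i\<in>UNIV. E $ i $ i))"
    unfolding off by (simp add: if_distrib[where f="\<lambda>t. t * _"] sum_distrib_left mult.assoc cong: if_cong)
  finally have PE: "P \<bullet> E = c * (\<Sum>i\<in>UNIV. E $ i $ i)" by simp
  have cA: "c = (\<Sum>i\<in>UNIV. A $ i $ i) / real CARD('n)" using Ptr diag by (simp add: eq_divide_eq mult.commute)
  \<comment> \<open>The half-space at level \<open>b\<close> contains the orbit, hence the hull and
    with it \<open>P\<close>; this carries the bound from every \<open>U\<close> to the
    average.\<close>
  have "?K \<subseteq> {X :: real^'n^'n. b \<le> X \<bullet> E}"
  proof (rule sub)
    show "?O \<subseteq> {X :: real^'n^'n. b \<le> X \<bullet> E}" using low by auto
    show "convex {X :: real^'n^'n. b \<le> X \<bullet> E}" using convex_halfspace_ge[of b E] by (simp add: inner_commute)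
    show "closed {X :: real^'n^'n. b \<le> X \<bullet> E}" using closed_halfspace_ge[of b E] by (simp add: inner_commute)
  qed
  then show ?thesis using PK PE cA by auto
qed

section \<open>Maximality\<close>

text \<open>Convexity of exp between 0 and ln y. The right side is the tangent of y^s at y =
  1.\<close>

lemma powr_tangent:
  fixes y :: real
  assumes "0 \<le> y" "0 < s" "s \<le> 1" shows "y powr s \<le> (1 - s) + s * y"
proof (cases "y = 0")
  case False
  then have y: "y > 0" using assms by simp
  have "exp ((1 - s) *\<^sub>R 0 + s *\<^sub>R ln y) \<le> (1 - s) * exp 0 + s * exp (ln y)"
    using assms by (intro convex_onD[OF exp_convex]) auto
  then show ?thesis using y by (simp add: powr_def)
qed (use assms in simp)

lemma invertible_matrix_inv:
  fixes T :: "real^'n::finite^'n"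
  assumes "invertible T" shows "T ** matrix_inv T = mat 1" "matrix_inv T ** T = mat 1"
  using someI_ex[of "\<lambda>B. T ** B = mat 1 \<and> B ** T = mat 1"] assms
  unfolding invertible_def matrix_inv_def by blast+

lemma matrix_inv_unique:
  fixes T B :: "real^'n::finite^'n"
  assumes "T ** B = mat 1" "B ** T = mat 1" shows "matrix_inv T = B"
proof -
  have "invertible T" using assms unfolding invertible_def by blast
  then have "matrix_inv T = matrix_inv T ** (T ** B)" "matrix_inv T ** T = mat 1"
    using assms invertible_matrix_inv by simp_all
  then show ?thesis by (simp add: matrix_mul_assoc)
qed

context transformed_domain
begin

lemma eigenvalue_sum_similarity_le:
  assumes a: "0 \<le> a" "\<And>\<eta>. norm (adjoint K \<eta>) = a * norm \<eta>"
  shows "(\<Sum>j=1..n. frac_eigenvalue \<alpha> (L ` D) j) \<le> a powr \<alpha> * (\<Sum>j=1..n. frac_eigenvalue \<alpha> D j)"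
proof -
  obtain u where u: "spectral.ON n u" "(\<Sum>j=1..n. frac_eigenvalue \<alpha> D j)
     = (\<Sum>i<n. LINT \<xi>|lebesgue. symbol \<xi> * (cmod (fourier (u i) \<xi>))\<^sup>2)"
    using frac_eigenvalue_sum_attained[of n] by blast
  have "symbol (adjoint K \<eta>) = a powr \<alpha> * symbol \<eta>" for \<eta>
    using a by (simp add: powr_mult[symmetric] mult_ac)
  then show ?thesis using eigenvalue_sum_image_le[OF u(1)] unfolding u(2) by (simp add: sum_distrib_left mult.assoc)
qed

end

text \<open>The transplantation bound is applied to \<open>T\<close> and to its inverse. The adjoint
  scales all norms by one factor and the symbol is homogeneous, so the two one-sided bounds
  match.\<close>

lemma similarity_eigenvalue_sum:
  fixes T :: "real^'n::finite^'n"
  assumes D: "fractional_domain \<alpha> D" and U: "orthogonal_matrix U" and c: "c \<noteq> 0" and T: "T = c *\<^sub>R U"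
  shows "(\<Sum>j=1..n. frac_eigenvalue \<alpha> ((\<lambda>x. T *v x) ` D) j)
    = (1 / \<bar>c\<bar>) powr \<alpha> * (\<Sum>j=1..n. frac_eigenvalue \<alpha> D j)"
proof (rule antisym)
  define L where "L = (\<lambda>x. T *v x)"
  define K where "K x = (1 / c) *\<^sub>R (transpose U *v x)" for x
  have o: "transpose U ** U = mat 1" "U ** transpose U = mat 1" using U by (simp_all add: orthogonal_matrix_def)
  have Lx: "L x = c *\<^sub>R (U *v x)" for x by (simp add: L_def T scaleR_matrix_vector_assoc)
  have KL: "K (L x) = x" for x
    unfolding K_def Lx matrix_vector_mult_scaleR matrix_vector_mul_assoc o using c by simp
  have LK: "L (K x) = x" for x
    unfolding K_def Lx matrix_vector_mult_scaleR matrix_vector_mul_assoc o using c by simp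
  have "K = (\<lambda>x. ((1 / c) *\<^sub>R transpose U) *v x)" by (rule ext) (simp only: K_def scaleR_matrix_vector_assoc)
  then have lin: "linear L" "linear K" by (simp_all only: L_def matrix_vector_mul_linear)
  have aK: "adjoint K \<eta> = (1 / c) *\<^sub>R (U *v \<eta>)" for \<eta>
  proof -
    have "adjoint K = (\<lambda>\<eta>. (1 / c) *\<^sub>R (U *v \<eta>))"
    proof (rule adjoint_unique, intro allI)
      fix x y
      have "(U *v y) \<bullet> x = y \<bullet> (transpose U *v x)"
        using adjoint_works[OF matrix_vector_mul_linear, of y U x] unfolding adjoint_matrix by (simp only: inner_commute)
      then show "K x \<bullet> y = x \<bullet> ((1 / c) *\<^sub>R (U *v y))" by (simp add: K_def inner_commute)
    qed
    then show ?thesis by simp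
  qed
  have aL: "adjoint L \<eta> = c *\<^sub>R (transpose U *v \<eta>)" for \<eta>
    unfolding L_def adjoint_matrix T by (simp add: transpose_scalar scaleR_matrix_vector_assoc[symmetric])
  interpret fractional_domain \<alpha> D by (rule D)
  interpret A: transformed_domain \<alpha> D K L
    by (intro transformed_domain.intro linear_iso.intro fractional_domain_axioms lin KL LK)
  interpret B: transformed_domain \<alpha> "L ` D" L K
    by (intro transformed_domain.intro linear_iso.intro A.image.fractional_domain_axioms lin KL LK)
  have "norm (adjoint K \<eta>) = (1 / \<bar>c\<bar>) * norm \<eta>" for \<eta> by (simp add: aK norm_orthogonal_vec[OF U])
  then show "(\<Sum>j=1..n. frac_eigenvalue \<alpha> ((\<lambda>x. T *v x) ` D) j) \<le> (1 / \<bar>c\<bar>) powr \<alpha> * (\<Sum>j=1..n. frac_eigenvalue \<alpha> D j)"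
    using A.eigenvalue_sum_similarity_le[of "1 / \<bar>c\<bar>" n] by (simp add: L_def)
  have "norm (transpose U *v \<eta>) = norm \<eta>" for \<eta> by (rule norm_orthogonal_vec) (simp add: U)
  then have "norm (adjoint L \<eta>) = \<bar>c\<bar> * norm \<eta>" for \<eta> by (simp only: aL norm_scaleR)
  moreover have "K ` L ` D = D" by (simp add: image_image KL)
  ultimately have "(\<Sum>j=1..n. frac_eigenvalue \<alpha> D j) \<le> \<bar>c\<bar> powr \<alpha> * (\<Sum>j=1..n. frac_eigenvalue \<alpha> (L ` D) j)"
    using B.eigenvalue_sum_similarity_le[of "\<bar>c\<bar>" n] by simp
  then have "(1 / \<bar>c\<bar>) powr \<alpha> * (\<Sum>j=1..n. frac_eigenvalue \<alpha> D j) \<le> (1 / \<bar>c\<bar>) powr \<alpha> * (\<bar>c\<bar> powr \<alpha> * (\<Sum>j=1..n. frac_eigenvalue \<alpha> (L ` D) j))"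
    by (rule mult_left_mono) simp
  also have "\<dots> = (\<Sum>j=1..n. frac_eigenvalue \<alpha> (L ` D) j)"
    using c by (simp add: powr_divide)
  finally show "(1 / \<bar>c\<bar>) powr \<alpha> * (\<Sum>j=1..n. frac_eigenvalue \<alpha> D j) \<le> (\<Sum>j=1..n. frac_eigenvalue \<alpha> ((\<lambda>x. T *v x) ` D) j)"
    by (simp add: L_def)
qed

section \<open>The bound for an arbitrary linear image\<close>

context fractional_domain
begin

text \<open>Records how the energy is distributed over directions: its Frobenius product with
  \<open>S\<close> is the energy weighted by (\<eta> . S \<eta>) / |\<eta>|^2, and its trace is the
  energy itself. At \<eta> = 0 the quotient is 0 by convention.\<close>

definition momentum_matrix :: "nat \<Rightarrow> (nat \<Rightarrow> real^'n \<Rightarrow> real) \<Rightarrow> real^'n^'n" where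
  "momentum_matrix n u = (\<chi> k l. \<Sum>i<n. LINT \<eta>|lebesgue. symbol \<eta> / (norm \<eta>)\<^sup>2 * (\<eta> $ k * \<eta> $ l) * (cmod (fourier (u i) \<eta>))\<^sup>2)"

lemma momentum_expand:
  "symbol \<eta> / (norm \<eta>)\<^sup>2 * (\<eta> \<bullet> (S *v \<eta>)) * t
    = (\<Sum>k\<in>UNIV. \<Sum>l\<in>UNIV. S $ k $ l * (symbol \<eta> / (norm \<eta>)\<^sup>2 * (\<eta> $ k * \<eta> $ l) * t))"
proof -
  have "\<eta> \<bullet> (S *v \<eta>) = (\<Sum>k\<in>UNIV. \<Sum>l\<in>UNIV. S $ k $ l * (\<eta> $ k * \<eta> $ l))"
    by (simp add: inner_vec_def matrix_vector_mult_def sum_distrib_left mult_ac)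
  then show ?thesis by (simp only: sum_distrib_left sum_distrib_right mult_ac)
qed

lemma momentum_integrable:
  assumes u: "u \<in> V"
  shows "integrable lebesgue (\<lambda>\<eta>. symbol \<eta> / (norm \<eta>)\<^sup>2 * (\<eta> $ k * \<eta> $ l) * (cmod (fourier u \<eta>))\<^sup>2)"
proof (rule Bochner_Integration.integrable_bound[OF symbol_square_integrable[OF u]])
  have [measurable]: "fourier u \<in> borel_measurable borel" by (rule fourier_measurable[OF in_HD(4)[OF V_in_H[OF u]]])
  have [measurable]: "(\<lambda>x::real^'n. x $ j) \<in> borel_measurable borel" for j
    by (intro borel_measurable_continuous_onI continuous_intros)
  have "(\<lambda>\<eta>. symbol \<eta> / (norm \<eta>)\<^sup>2 * (\<eta> $ k * \<eta> $ l) * (cmod (fourier u \<eta>))\<^sup>2) \<in> borel_measurable lborel"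
    by measurable
  then show "(\<lambda>\<eta>. symbol \<eta> / (norm \<eta>)\<^sup>2 * (\<eta> $ k * \<eta> $ l) * (cmod (fourier u \<eta>))\<^sup>2) \<in> borel_measurable lebesgue"
    by (rule measurable_completion)
  have "norm (symbol \<eta> / (norm \<eta>)\<^sup>2 * (\<eta> $ k * \<eta> $ l) * (cmod (fourier u \<eta>))\<^sup>2) \<le> symbol \<eta> * (cmod (fourier u \<eta>))\<^sup>2" for \<eta>
  proof (cases "\<eta> = 0")
    case False
    have "\<bar>\<eta> $ k * \<eta> $ l\<bar> \<le> norm \<eta> * norm \<eta>"
      unfolding abs_mult by (intro mult_mono component_le_norm_cart) auto
    then have "\<bar>\<eta> $ k * \<eta> $ l\<bar> / (norm \<eta>)\<^sup>2 \<le> 1" using False by (simp add: power2_eq_square)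
    then have "(symbol \<eta> * (cmod (fourier u \<eta>))\<^sup>2) * (\<bar>\<eta> $ k * \<eta> $ l\<bar> / (norm \<eta>)\<^sup>2) \<le> (symbol \<eta> * (cmod (fourier u \<eta>))\<^sup>2) * 1"
      by (rule mult_left_mono) simp
    then show ?thesis by (simp add: abs_mult mult_ac)
  qed simp
  then show "AE \<eta> in lebesgue. norm (symbol \<eta> / (norm \<eta>)\<^sup>2 * (\<eta> $ k * \<eta> $ l) * (cmod (fourier u \<eta>))\<^sup>2) \<le> norm (symbol \<eta> * (cmod (fourier u \<eta>))\<^sup>2)"
    by (intro AE_I2) simp
qed

lemma momentum_inner:
  assumes u: "\<And>i. i < n \<Longrightarrow> u i \<in> V"
  shows "S \<bullet> momentum_matrix n u = (\<Sum>i<n. LINT \<eta>|lebesgue. symbol \<eta> / (norm \<eta>)\<^sup>2 * (\<eta> \<bullet> (S *v \<eta>)) * (cmod (fourier (u i) \<eta>))\<^sup>2)"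
proof -
  let ?g = "\<lambda>i k l \<eta>. symbol \<eta> / (norm \<eta>)\<^sup>2 * (\<eta> $ k * \<eta> $ l) * (cmod (fourier (u i) \<eta>))\<^sup>2"
  have "(\<Sum>i<n. LINT \<eta>|lebesgue. symbol \<eta> / (norm \<eta>)\<^sup>2 * (\<eta> \<bullet> (S *v \<eta>)) * (cmod (fourier (u i) \<eta>))\<^sup>2)
     = (\<Sum>i<n. \<Sum>k\<in>UNIV. \<Sum>l\<in>UNIV. S $ k $ l * (LINT \<eta>|lebesgue. ?g i k l \<eta>))"
  proof (rule sum.cong[OF refl])
    fix i assume "i \<in> {..<n}"
    then have i: "integrable lebesgue (?g i k l)" for k l using momentum_integrable[OF u] by simp
    show "(LINT \<eta>|lebesgue. symbol \<eta> / (norm \<eta>)\<^sup>2 * (\<eta> \<bullet> (S *v \<eta>)) * (cmod (fourier (u i) \<eta>))\<^sup>2)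
      = (\<Sum>k\<in>UNIV. \<Sum>l\<in>UNIV. S $ k $ l * (LINT \<eta>|lebesgue. ?g i k l \<eta>))"
      unfolding momentum_expand
      by (subst Bochner_Integration.integral_sum, intro Bochner_Integration.integrable_sum integrable_mult_right i,
          subst Bochner_Integration.integral_sum, intro integrable_mult_right i, subst integral_mult_right_zero, rule refl)
  qed
  also have "\<dots> = (\<Sum>k\<in>UNIV. \<Sum>l\<in>UNIV. \<Sum>i<n. S $ k $ l * (LINT \<eta>|lebesgue. ?g i k l \<eta>))"
    by (subst sum.swap, rule sum.cong[OF refl], rule sum.swap)
  also have "\<dots> = S \<bullet> momentum_matrix n u"
    unfolding matrix_inner_eq_sum momentum_matrix_def by (simp add: sum_distrib_left)
  finally show ?thesis by simp
qed

lemma momentum_trace: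
  assumes u: "\<And>i. i < n \<Longrightarrow> u i \<in> V"
  shows "(\<Sum>k\<in>UNIV. momentum_matrix n u $ k $ k) = (\<Sum>i<n. LINT \<eta>|lebesgue. symbol \<eta> * (cmod (fourier (u i) \<eta>))\<^sup>2)"
proof -
  have "(\<Sum>k\<in>UNIV. momentum_matrix n u $ k $ k) = mat 1 \<bullet> momentum_matrix n u"
    by (simp add: matrix_inner_eq_sum mat_def if_distrib[where f="\<lambda>t. t * _"] cong: if_cong)
  also have "\<dots> = (\<Sum>i<n. LINT \<eta>|lebesgue. symbol \<eta> / (norm \<eta>)\<^sup>2 * (\<eta> \<bullet> (mat 1 *v \<eta>)) * (cmod (fourier (u i) \<eta>))\<^sup>2)"
    by (rule momentum_inner[OF u])
  also have "\<dots> = (\<Sum>i<n. LINT \<eta>|lebesgue. symbol \<eta> * (cmod (fourier (u i) \<eta>))\<^sup>2)"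
  proof -
    have "symbol \<eta> / (norm \<eta>)\<^sup>2 * (\<eta> \<bullet> (mat 1 *v \<eta>)) = symbol \<eta>" for \<eta> :: "real^'n"
      by (cases "\<eta> = 0") (simp_all add: power2_norm_eq_inner)
    then show ?thesis by simp
  qed
  finally show ?thesis .
qed

end

lemma isometry_group_mult: "U \<in> isometry_group \<Omega> \<Longrightarrow> W \<in> isometry_group \<Omega> \<Longrightarrow> U ** W \<in> isometry_group \<Omega>"
proof -
  assume a: "U \<in> isometry_group \<Omega>" "W \<in> isometry_group \<Omega>"
  have "(\<lambda>x. (U ** W) *v x) ` \<Omega> = (\<lambda>x. U *v x) ` ((\<lambda>x. W *v x) ` \<Omega>)"
    by (simp add: image_image matrix_vector_mul_assoc)
  then show ?thesis using a by (simp add: isometry_group_def orthogonal_matrix_mul)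
qed

lemma eigenvalue_sum_linear_image_le:
  fixes T :: "real^'n::finite^'n"
  assumes D: "fractional_domain \<alpha> \<Omega>" and irr: "irreducible_group (isometry_group \<Omega>)" and T: "invertible T"
  defines "\<kappa> \<equiv> (norm (matrix_inv T))\<^sup>2 / real CARD('n)"
  shows "(\<Sum>j=1..n. frac_eigenvalue \<alpha> ((\<lambda>x. T *v x) ` \<Omega>) j)
    \<le> \<kappa> powr (\<alpha> / 2) * (\<Sum>j=1..n. frac_eigenvalue \<alpha> \<Omega> j)"
proof -
  interpret fractional_domain \<alpha> \<Omega> by (rule D)
  let ?N = "matrix_inv T"
  note TN = invertible_matrix_inv[OF T]
  let ?G = "isometry_group \<Omega>"
  have orth: "orthogonal_matrix U" if "U \<in> ?G" for U using that by (simp add: isometry_group_def)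
  have "?N \<noteq> 0"
  proof
    assume "?N = 0"
    then have "(mat 1 :: real^'n^'n) = 0" using TN(1) by (simp add: matrix_matrix_mult_def vec_eq_iff)
    then have "(mat 1 :: real^'n^'n) $ i $ i = 0" for i by simp
    then show False by (simp add: mat_def)
  qed
  then have \<kappa>: "\<kappa> > 0" by (simp add: \<kappa>_def)
  have s: "0 < s" "s \<le> 1" using alpha by auto
  obtain u where u: "spectral.ON n u" "(\<Sum>j=1..n. frac_eigenvalue \<alpha> \<Omega> j)
     = (\<Sum>i<n. LINT \<xi>|lebesgue. symbol \<xi> * (cmod (fourier (u i) \<xi>))\<^sup>2)"
    using frac_eigenvalue_sum_attained[of n] by blast
  have uV: "u i \<in> V" if "i < n" for i using u that by (simp add: spectral.ON_def)
  define E0 where "E0 = (\<Sum>i<n. LINT \<xi>|lebesgue. symbol \<xi> * (cmod (fourier (u i) \<xi>))\<^sup>2)"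
  define E where "E = momentum_matrix n u"
  define A where "A = ?N ** transpose ?N"
  define X where "X = (\<Sum>j=1..n. frac_eigenvalue \<alpha> ((\<lambda>x. T *v x) ` \<Omega>) j)"
  \<comment> \<open>Tangent of t^s at t = \<kappa>, namely t^s \<le> \<open>?a + ?b * t\<close>,
    where \<open>s\<close> is \<open>\<alpha> / 2\<close>.\<close>
  let ?a = "(1 - s) * \<kappa> powr s" and ?b = "s * \<kappa> powr (s - 1)"
  have bpos: "?b > 0" using s \<kappa> by simp
  have k1: "\<kappa> powr (s - 1) = \<kappa> powr s / \<kappa>" using \<kappa> unfolding powr_diff by simp
  \<comment> \<open>The transplantation runs along \<open>T ** U\<close>, which maps \<Omega> to the
    same image for every \<open>U\<close>, and the eigenfunctions of \<Omega> are fixed; only the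
    matrix depends on \<open>U\<close>.\<close>
  have low: "X \<le> ?a * E0 + ?b * ((transpose U ** A ** U) \<bullet> E)" if U: "U \<in> ?G" for U
  proof -
    let ?S = "transpose U ** A ** U"
    have o: "transpose U ** U = mat 1" "U ** transpose U = mat 1" using orth[OF U] by (simp_all add: orthogonal_matrix_def)
    define L where "L = (\<lambda>x. (T ** U) *v x)"
    define K where "K = (\<lambda>x. (transpose U ** ?N) *v x)"
    have "(transpose U ** ?N) ** (T ** U) = transpose U ** (?N ** T) ** U" by (simp only: matrix_mul_assoc)
    then have KL: "K (L x) = x" for x unfolding K_def L_def by (simp add: matrix_vector_mul_assoc TN o)
    have "(T ** U) ** (transpose U ** ?N) = T ** (U ** transpose U) ** ?N" by (simp only: matrix_mul_assoc)
    then have LK: "L (K x) = x" for x unfolding K_def L_def by (simp add: matrix_vector_mul_assoc TN o)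
    have lin: "linear K" "linear L" unfolding K_def L_def by (rule matrix_vector_mul_linear)+
    interpret t: transformed_domain \<alpha> \<Omega> K L
      by (intro transformed_domain.intro linear_iso.intro fractional_domain_axioms lin KL LK)
    have "L ` \<Omega> = (\<lambda>x. T *v x) ` ((\<lambda>x. U *v x) ` \<Omega>)" by (simp add: L_def image_image matrix_vector_mul_assoc)
    then have im: "L ` \<Omega> = (\<lambda>x. T *v x) ` \<Omega>" using U by (simp add: isometry_group_def)
    have aK: "(norm (adjoint K \<eta>))\<^sup>2 = \<eta> \<bullet> (?S *v \<eta>)" for \<eta>
    proof -
      have "(norm (adjoint K \<eta>))\<^sup>2 = adjoint K \<eta> \<bullet> adjoint K \<eta>" by (rule power2_norm_eq_inner)
      also have "\<dots> = K (adjoint K \<eta>) \<bullet> \<eta>" by (rule adjoint_works[OF t.lin(1)])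
      also have "\<dots> = \<eta> \<bullet> K (adjoint K \<eta>)" by (rule inner_commute)
      also have "K (adjoint K \<eta>) = ?S *v \<eta>"
        unfolding K_def adjoint_matrix A_def by (simp only: matrix_vector_mul_assoc matrix_transpose_mul transpose_transpose matrix_mul_assoc)
      finally show ?thesis .
    qed
    have pt: "symbol (adjoint K \<eta>) \<le> ?a * symbol \<eta> + ?b * (symbol \<eta> / (norm \<eta>)\<^sup>2 * (\<eta> \<bullet> (?S *v \<eta>)))" for \<eta>
    proof (cases "\<eta> = 0")
      case True
      then show ?thesis using t.adj(1) by (simp add: linear_0)
    next
      case False
      \<comment> \<open>The ratio of the squared norm of \<open>adjoint K \<eta>\<close> to its
        averaged value \<kappa> |\<eta>|^2, which moves the point of tangency to 1 as in
        \<open>powr_tangent\<close>.\<close>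
      define y where "y = (\<eta> \<bullet> (?S *v \<eta>)) / (\<kappa> * (norm \<eta>)\<^sup>2)"
      have y0: "0 \<le> y" unfolding y_def aK[symmetric] using \<kappa> by simp
      have "(2 * pi * norm (adjoint K \<eta>))\<^sup>2 = (2 * pi * norm \<eta>)\<^sup>2 * (\<kappa> * y)"
        unfolding power_mult_distrib aK y_def using False \<kappa> by simp
      then have "symbol (adjoint K \<eta>) = symbol \<eta> * (\<kappa> powr s * y powr s)"
        unfolding symbol_eq using y0 \<kappa> by (simp add: powr_mult)
      also have "\<dots> \<le> symbol \<eta> * (\<kappa> powr s * ((1 - s) + s * y))"
        using powr_tangent[OF y0 s] by (intro mult_left_mono) auto
      also have "\<dots> = ?a * symbol \<eta> + symbol \<eta> * (\<kappa> powr s * s * y)" by (simp add: algebra_simps)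
      also have "symbol \<eta> * (\<kappa> powr s * s * y) = ?b * (symbol \<eta> / (norm \<eta>)\<^sup>2 * (\<eta> \<bullet> (?S *v \<eta>)))"
        unfolding k1 y_def by (simp add: mult_ac)
      finally show ?thesis .
    qed
    have "X \<le> (\<Sum>i<n. LINT \<eta>|lebesgue. symbol (adjoint K \<eta>) * (cmod (fourier (u i) \<eta>))\<^sup>2)"
      using t.eigenvalue_sum_image_le[OF u(1)] unfolding X_def im .
    also have "\<dots> \<le> (\<Sum>i<n. ?a * (LINT \<eta>|lebesgue. symbol \<eta> * (cmod (fourier (u i) \<eta>))\<^sup>2)
       + ?b * (LINT \<eta>|lebesgue. symbol \<eta> / (norm \<eta>)\<^sup>2 * (\<eta> \<bullet> (?S *v \<eta>)) * (cmod (fourier (u i) \<eta>))\<^sup>2))"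
    proof (rule sum_mono)
      fix i assume "i \<in> {..<n}"
      then have i: "u i \<in> V" using uV by simp
      let ?f = "\<lambda>\<eta>. (cmod (fourier (u i) \<eta>))\<^sup>2"
      note i1 = symbol_square_integrable[OF i]
      have i2: "integrable lebesgue (\<lambda>\<eta>. symbol \<eta> / (norm \<eta>)\<^sup>2 * (\<eta> \<bullet> (?S *v \<eta>)) * ?f \<eta>)"
      proof -
        have "integrable lebesgue (\<lambda>\<eta>. \<Sum>k\<in>UNIV. \<Sum>l\<in>UNIV. ?S $ k $ l * (symbol \<eta> / (norm \<eta>)\<^sup>2 * (\<eta> $ k * \<eta> $ l) * ?f \<eta>))"
          by (intro Bochner_Integration.integrable_sum integrable_mult_right momentum_integrable[OF i])
        then show ?thesis unfolding momentum_expand .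
      qed
      have i12: "integrable lebesgue (\<lambda>\<eta>. ?a * (symbol \<eta> * ?f \<eta>) + ?b * (symbol \<eta> / (norm \<eta>)\<^sup>2 * (\<eta> \<bullet> (?S *v \<eta>)) * ?f \<eta>))"
        by (intro Bochner_Integration.integrable_add integrable_mult_right i1 i2)
      have le: "symbol (adjoint K \<eta>) * ?f \<eta> \<le> ?a * (symbol \<eta> * ?f \<eta>) + ?b * (symbol \<eta> / (norm \<eta>)\<^sup>2 * (\<eta> \<bullet> (?S *v \<eta>)) * ?f \<eta>)" for \<eta>
        using mult_right_mono[OF pt[of \<eta>], of "?f \<eta>"] by (simp only: distrib_right mult.assoc) simp
      \<comment> \<open>\<open>integral_mono'\<close> works from an integrable nonnegative majorant;
        nonnegativity follows from \<open>le\<close>, whose left side is nonnegative.\<close>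
      have "(LINT \<eta>|lebesgue. symbol (adjoint K \<eta>) * ?f \<eta>) \<le> (LINT \<eta>|lebesgue. ?a * (symbol \<eta> * ?f \<eta>) + ?b * (symbol \<eta> / (norm \<eta>)\<^sup>2 * (\<eta> \<bullet> (?S *v \<eta>)) * ?f \<eta>))"
        by (rule integral_mono'[OF i12 le]) (use order_trans[OF _ le] in simp)
      also have "\<dots> = ?a * (LINT \<eta>|lebesgue. symbol \<eta> * ?f \<eta>) + ?b * (LINT \<eta>|lebesgue. symbol \<eta> / (norm \<eta>)\<^sup>2 * (\<eta> \<bullet> (?S *v \<eta>)) * ?f \<eta>)"
        by (subst Bochner_Integration.integral_add, intro integrable_mult_right i1, intro integrable_mult_right i2, simp only: integral_mult_right_zero)
      finally show "(LINT \<eta>|lebesgue. symbol (adjoint K \<eta>) * ?f \<eta>) \<le> ?a * (LINT \<eta>|lebesgue. symbol \<eta> * ?f \<eta>) + ?b * (LINT \<eta>|lebesgue. symbol \<eta> / (norm \<eta>)\<^sup>2 * (\<eta> \<bullet> (?S *v \<eta>)) * ?f \<eta>)" .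
    qed
    also have "\<dots> = ?a * E0 + ?b * (?S \<bullet> E)"
    proof -
      have "?S \<bullet> E = (\<Sum>i<n. LINT \<eta>|lebesgue. symbol \<eta> / (norm \<eta>)\<^sup>2 * (\<eta> \<bullet> (?S *v \<eta>)) * (cmod (fourier (u i) \<eta>))\<^sup>2)"
        unfolding E_def by (rule momentum_inner[OF uV])
      then show ?thesis unfolding E0_def by (simp only: sum.distrib sum_distrib_left)
    qed
    finally show ?thesis .
  qed
  \<comment> \<open>The inequality is solved for the matrix term, because
    \<open>orbit_average\<close> takes a lower bound on a linear functional over the orbit.\<close>
  have "(X - ?a * E0) / ?b \<le> (\<Sum>i\<in>UNIV. A $ i $ i) / real CARD('n) * (\<Sum>i\<in>UNIV. E $ i $ i)"
  proof (rule orbit_average[OF irr orth isometry_group_mult])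
    have "mat 1 \<in> ?G" by (simp add: isometry_group_def orthogonal_matrix_id)
    then show "?G \<noteq> {}" by blast
    show "transpose E = E" by (simp add: E_def momentum_matrix_def transpose_def vec_eq_iff mult_ac)
    show "(X - ?a * E0) / ?b \<le> (transpose U ** A ** U) \<bullet> E" if "U \<in> ?G" for U
      using low[OF that] bpos by (simp only: pos_divide_le_eq) (simp add: mult.commute)
  qed
  also have "(\<Sum>i\<in>UNIV. A $ i $ i) / real CARD('n) = \<kappa>"
    unfolding \<kappa>_def A_def power2_norm_eq_inner by (simp add: matrix_matrix_mult_def transpose_def matrix_inner_eq_sum)
  also have "(\<Sum>i\<in>UNIV. E $ i $ i) = E0" unfolding E_def E0_def by (rule momentum_trace[OF uV])
  finally have "X - ?a * E0 \<le> \<kappa> * E0 * ?b" using bpos by (simp only: pos_divide_le_eq)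
  \<comment> \<open>At the point of tangency the weights \<open>1 - s\<close> and \<open>s\<close>
    add up to 1.\<close>
  also have "\<kappa> * E0 * ?b = s * \<kappa> powr s * E0" unfolding k1 using \<kappa> by simp
  finally have "X \<le> \<kappa> powr s * E0" by (simp add: algebra_simps)
  then show ?thesis unfolding X_def u(2) E0_def .
qed

text \<open>The form sending y to the integral of (x . y)^2 over \<Omega> is invariant under the
  isometries of \<Omega>, hence a multiple of |y|^2. Summation over the rows of \<open>N\<close>
  gives the integral of |N x|^2.\<close>

lemma second_moment_scalar:
  fixes \<Omega> :: "(real^'n::finite) set"
  assumes O: "open \<Omega>" "bounded \<Omega>" and irr: "irreducible_group (isometry_group \<Omega>)"
  obtains m where "0 \<le> m" "\<And>N :: real^'n^'n. (LINT x|lebesgue. indicator \<Omega> x * (norm (N *v x))\<^sup>2) = m * (norm N)\<^sup>2"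
proof -
  have [measurable]: "\<Omega> \<in> sets borel" using O by simp
  obtain R where R: "\<And>x. x \<in> \<Omega> \<Longrightarrow> norm x \<le> R" using O(2) bounded_iff by metis
  have iO: "integrable lborel (indicator \<Omega> :: _ \<Rightarrow> real)" using emeasure_bounded_finite[OF O(2)] by simp
  have i: "integrable lebesgue (\<lambda>x. indicator \<Omega> x * (x \<bullet> y)\<^sup>2)" for y
  proof -
    have "integrable lborel (\<lambda>x. indicator \<Omega> x * (x \<bullet> y)\<^sup>2)"
    proof (rule Bochner_Integration.integrable_bound)
      show "integrable lborel (\<lambda>x. (R * norm y)\<^sup>2 * indicator \<Omega> x)" using iO by simp
      have "(x \<bullet> y)\<^sup>2 \<le> (R * norm y)\<^sup>2" if "x \<in> \<Omega>" for x
      proof -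
        have "\<bar>x \<bullet> y\<bar> \<le> norm x * norm y" by (rule Cauchy_Schwarz_ineq2)
        also have "\<dots> \<le> R * norm y" using R[OF that] by (rule mult_right_mono) simp
        finally have "\<bar>x \<bullet> y\<bar>\<^sup>2 \<le> (R * norm y)\<^sup>2" by (rule power_mono) simp
        then show ?thesis by simp
      qed
      then show "AE x in lborel. norm (indicator \<Omega> x * (x \<bullet> y)\<^sup>2) \<le> norm ((R * norm y)\<^sup>2 * indicator \<Omega> x :: real)"
        by (intro AE_I2) (auto simp: indicator_def)
    qed measurable
    then show ?thesis by (subst integrable_completion) simp_all
  qed
  define F where "F y = (LINT x|lebesgue. indicator \<Omega> x * (x \<bullet> y)\<^sup>2)" for y
  have hom: "F (c *\<^sub>R y) = c\<^sup>2 * F y" for c y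
    unfolding F_def by (simp add: power_mult_distrib mult.left_commute[of _ "c\<^sup>2"])
  have par: "F (y + z) + F (y - z) = 2 * F y + 2 * F z" for y z
  proof -
    have "F (y + z) + F (y - z) = (LINT x|lebesgue. indicator \<Omega> x * (x \<bullet> (y + z))\<^sup>2 + indicator \<Omega> x * (x \<bullet> (y - z))\<^sup>2)"
      unfolding F_def using i[of "y + z"] i[of "y - z"] by simp
    also have "\<dots> = (LINT x|lebesgue. 2 * (indicator \<Omega> x * (x \<bullet> y)\<^sup>2) + 2 * (indicator \<Omega> x * (x \<bullet> z)\<^sup>2))"
      by (intro Bochner_Integration.integral_cong refl) (simp add: inner_add_right inner_diff_right power2_sum power2_diff algebra_simps)
    also have "\<dots> = 2 * F y + 2 * F z" unfolding F_def using i[of y] i[of z] by simp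
    finally show ?thesis .
  qed
  define M where "M k l = (LINT x|lebesgue. indicator \<Omega> x * (x $ k * x $ l))" for k l
  have cont: "continuous_on UNIV F"
  proof -
    have pol: "F y = (\<Sum>k\<in>UNIV. \<Sum>l\<in>UNIV. y $ k * y $ l * M k l)" for y
    proof -
      \<comment> \<open>Integrability of the mixed moments, by polarization of the squares; the
        expansion of \<open>F\<close> as a polynomial in the coordinates of \<open>y\<close> then
        shows continuity.\<close>
      have ii: "integrable lebesgue (\<lambda>x. indicator \<Omega> x * (x $ k * x $ l))" for k l
      proof -
        have "integrable lebesgue (\<lambda>x. (indicator \<Omega> x * (x \<bullet> (axis k 1 + axis l 1))\<^sup>2 - indicator \<Omega> x * (x \<bullet> axis k 1)\<^sup>2 - indicator \<Omega> x * (x \<bullet> axis l 1)\<^sup>2) / 2)"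
          using i by simp
        moreover have "(indicator \<Omega> x * (x \<bullet> (axis k 1 + axis l 1))\<^sup>2 - indicator \<Omega> x * (x \<bullet> axis k 1)\<^sup>2 - indicator \<Omega> x * (x \<bullet> axis l 1)\<^sup>2) / 2 = indicator \<Omega> x * (x $ k * x $ l)" for x
          by (simp add: inner_add_right inner_axis power2_sum algebra_simps)
        ultimately show ?thesis by simp
      qed
      have "indicator \<Omega> x * (x \<bullet> y)\<^sup>2 = (\<Sum>k\<in>UNIV. \<Sum>l\<in>UNIV. y $ k * y $ l * (indicator \<Omega> x * (x $ k * x $ l)))" for x
        unfolding power2_eq_square inner_vec_def by (simp add: sum_product sum_distrib_left mult_ac)
      then show ?thesis unfolding F_def M_def
        by (simp add: Bochner_Integration.integral_sum Bochner_Integration.integrable_sum ii)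
    qed
    show ?thesis unfolding pol by (intro continuous_intros)
  qed
  have inv: "F (U *v y) = F y" if "U \<in> isometry_group \<Omega>" for U y
  proof -
    have o: "orthogonal_matrix U" and im: "(\<lambda>x. U *v x) ` \<Omega> = \<Omega>" using that by (auto simp: isometry_group_def)
    let ?L = "\<lambda>x. U *v x"
    have oo: "transpose U ** U = mat 1" "U ** transpose U = mat 1" using o by (simp_all add: orthogonal_matrix_def)
    have lin: "linear ?L" by simp
    have UU: "transpose U *v (U *v x) = x" "U *v (transpose U *v x) = x" for x
      by (simp_all only: matrix_vector_mul_assoc oo matrix_vector_mul_lid)
    have bij: "bij ?L" by (rule bij_betw_byWitness[where f'="\<lambda>x. transpose U *v x"]) (simp_all only: UU, auto)
    have mem: "U *v x \<in> \<Omega> \<longleftrightarrow> x \<in> \<Omega>" for x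
    proof
      assume "U *v x \<in> \<Omega>"
      then obtain z where "z \<in> \<Omega>" "U *v x = U *v z" using im by (metis (no_types, lifting) imageE)
      then show "x \<in> \<Omega>" by (metis UU(1))
    qed (use im in auto)
    \<comment> \<open>An orthogonal map preserves the unit ball, whose volume is positive.\<close>
    have j: "jac ?L = 1"
    proof -
      define B where "B = ball (0::real^'n) 1"
      have "(LINT x|lebesgue. indicator B (?L x)) = jac ?L *\<^sub>R (LINT x|lebesgue. indicator B x :: real)"
        by (rule integral_lebesgue_linear[OF lin bij]) (intro borel_measurable_indicator, simp add: B_def)
      moreover have "(indicator B (?L x) :: real) = indicator B x" for x
        by (simp add: B_def indicator_def norm_orthogonal_vec[OF o])
      moreover have "(LINT x|lebesgue. indicator B x :: real) \<noteq> 0"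
        using content_ball_pos[of 1 "0::real^'n"] by (simp add: B_def)
      ultimately show ?thesis by simp
    qed
    have "F (U *v y) = (LINT x|lebesgue. indicator \<Omega> x * (x \<bullet> (U *v y))\<^sup>2)" by (simp add: F_def)
    also have "\<dots> = (LINT x|lebesgue. (\<lambda>x. indicator \<Omega> x * (x \<bullet> (U *v y))\<^sup>2) (?L x))"
      using i[of "U *v y"] by (subst integral_lebesgue_linear[OF lin bij]) (auto simp: j)
    also have "\<dots> = F y"
      unfolding F_def
    proof (intro Bochner_Integration.integral_cong refl)
      fix x
      have "(U *v x) \<bullet> (U *v y) = x \<bullet> y"
        using adjoint_works[OF lin, of x "U *v y"] unfolding adjoint_matrix UU by (simp add: inner_commute)
      then show "indicator \<Omega> (U *v x) * ((U *v x) \<bullet> (U *v y))\<^sup>2 = indicator \<Omega> x * (x \<bullet> y)\<^sup>2"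
        by (simp add: indicator_def mem)
    qed
    finally show ?thesis .
  qed
  obtain m where m: "\<And>y. F y = m * (norm y)\<^sup>2"
    by (rule invariant_quadratic_form_scalar[OF irr _ par hom cont inv]) (auto simp: isometry_group_def)
  have "(LINT x|lebesgue. indicator \<Omega> x * (norm (N *v x))\<^sup>2) = m * (norm N)\<^sup>2" for N :: "real^'n^'n"
  proof -
    have "indicator \<Omega> x * (norm (N *v x))\<^sup>2 = (\<Sum>k\<in>UNIV. indicator \<Omega> x * (x \<bullet> (N $ k))\<^sup>2)" for x
      unfolding norm_square_cart
      by (simp add: sum_distrib_left matrix_vector_mult_def inner_vec_def mult.commute)
    then have "(LINT x|lebesgue. indicator \<Omega> x * (norm (N *v x))\<^sup>2) = (\<Sum>k\<in>UNIV. F (N $ k))"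
      unfolding F_def by (simp only: Bochner_Integration.integral_sum[OF i])
    also have "\<dots> = m * (norm N)\<^sup>2"
      unfolding m by (simp add: power2_norm_eq_inner inner_vec_def sum_distrib_left)
    finally show ?thesis .
  qed
  moreover have "0 \<le> m"
  proof -
    have "0 \<le> F (axis undefined 1)" unfolding F_def by (intro Bochner_Integration.integral_nonneg) simp
    then show ?thesis by (simp add: m)
  qed
  ultimately show ?thesis using that by blast
qed

text \<open>With J = \<open>jac L\<close>, passing to T(\<Omega>) divides the volume by J, and
  passing to the image under T^(-1) multiplies the volume by J and puts a factor J |N|^2 into the
  second moment, N = T^(-1). The exponents are balanced so that J^(-2/d) J^(1+2/d) / J = 1, and
  |N|^2 is all that remains besides the eigenvalues.\<close>

lemma Qfun_formula:
  fixes \<Omega> :: "(real^'n::finite) set"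
  assumes "domain \<Omega>" "bounded \<Omega>" "irreducible_group (isometry_group \<Omega>)"
  obtains C where "0 \<le> C" "\<And>\<alpha> n T. invertible T \<Longrightarrow> Qfun \<alpha> n \<Omega> T =
     (\<Sum>j=1..n. frac_eigenvalue \<alpha> ((\<lambda>x. T *v x) ` \<Omega>) j) powr (2 / \<alpha>) / (norm (matrix_inv T))\<^sup>2 * C"
proof -
  have O: "open \<Omega>" "\<Omega> \<noteq> {}" using assms by (auto simp: Defs.domain_def)
  have [measurable]: "\<Omega> \<in> sets lebesgue" using O by simp
  obtain m where m: "0 \<le> m" "\<And>N :: real^'n^'n. (LINT x|lebesgue. indicator \<Omega> x * (norm (N *v x))\<^sup>2) = m * (norm N)\<^sup>2"
    using second_moment_scalar[OF O(1) assms(2,3)] by metis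
  define d where "d = real CARD('n)"
  have vpos: "vol \<Omega> > 0"
  proof -
    have "\<not> negligible \<Omega>" by (rule open_not_negligible[OF O])
    moreover have "\<Omega> \<in> lmeasurable" by (rule bounded_set_imp_lmeasurable[OF assms(2)]) simp
    ultimately have "measure lebesgue \<Omega> \<noteq> 0" unfolding negligible_iff_measure by blast
    moreover have "0 \<le> measure lebesgue \<Omega>" by simp
    ultimately show ?thesis unfolding vol_def by linarith
  qed
  let ?C = "vol \<Omega> powr (2 / d) * vol \<Omega> powr (1 + 2 / d) / m"
  have "Qfun \<alpha> n \<Omega> T = (\<Sum>j=1..n. frac_eigenvalue \<alpha> ((\<lambda>x. T *v x) ` \<Omega>) j) powr (2 / \<alpha>) / (norm (matrix_inv T))\<^sup>2 * ?C"
    if T: "invertible T" for \<alpha> n and T :: "real^'n^'n"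
  proof -
    define L where "L = (\<lambda>x. T *v x)"
    define K where "K = (\<lambda>x. matrix_inv T *v x)"
    note TN = invertible_matrix_inv[OF T]
    have KL: "K (L x) = x" and LK: "L (K x) = x" for x
      by (simp_all add: K_def L_def matrix_vector_mul_assoc TN)
    have lin': "linear K" "linear L" unfolding K_def L_def by (rule matrix_vector_mul_linear)+
    interpret linear_iso K L by (intro linear_iso.intro lin' KL LK)
    note jL = jac(1)[OF lin(2) bij(2)]
    have iL: "indicator (L ` \<Omega>) x = (indicator \<Omega> (K x) :: real)" for x
      by (auto simp: indicator_def image_iff KL LK) (metis LK)
    have iK: "indicator (K ` \<Omega>) x = (indicator \<Omega> (L x) :: real)" for x
      by (auto simp: indicator_def image_iff KL LK) (metis KL)
    have sL: "L ` \<Omega> \<in> sets lebesgue" and sK: "K ` \<Omega> \<in> sets lebesgue"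
      using open_surjective_linear_image[OF O(1) lin(2) bij_is_surj[OF bij(2)]]
        open_surjective_linear_image[OF O(1) lin(1) bij_is_surj[OF bij(1)]] by simp_all
    have vol_int: "vol S = (LINT x|lebesgue. indicator S x)" if "S \<in> sets lebesgue" for S :: "(real^'n) set"
      using that by (simp add: vol_def)
    have mO: "(indicator \<Omega> :: _ \<Rightarrow> real) \<in> borel_measurable lebesgue" by simp
    have vL: "vol (L ` \<Omega>) = jac K * vol \<Omega>"
      unfolding vol_int[OF sL] iL using integral_lebesgue_linear[OF lin(1) bij(1) mO] by (simp add: vol_def)
    have vK: "vol (K ` \<Omega>) = jac L * vol \<Omega>"
      unfolding vol_int[OF sK] iK using integral_lebesgue_linear[OF lin(2) bij(2) mO] by (simp add: vol_def)
    \<comment> \<open>Substituting along \<open>L\<close> in the indicator of the image returns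
      \<Omega> itself; dividing by its positive volume leaves the product of the two
      factors.\<close>
    have jj: "jac K * jac L = 1"
    proof -
      have "vol \<Omega> = (LINT x|lebesgue. indicator (L ` \<Omega>) (L x))" unfolding iL KL by (simp add: vol_def)
      also have "\<dots> = jac L * vol (L ` \<Omega>)"
        using integral_lebesgue_linear[OF lin(2) bij(2), of "indicator (L ` \<Omega>) :: _ \<Rightarrow> real"] sL by (simp add: vol_def)
      finally have "(jac K * jac L) * vol \<Omega> = 1 * vol \<Omega>" by (simp add: vL mult_ac)
      then show ?thesis using vpos by (metis less_irrefl mult_right_cancel)
    qed
    have I2K: "I2 (K ` \<Omega>) = jac L * (m * (norm (matrix_inv T))\<^sup>2)"
    proof -
      have "I2 (K ` \<Omega>) = (LINT x|lebesgue. (\<lambda>y. indicator \<Omega> y * (norm (K y))\<^sup>2) (L x))"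
        unfolding I2_def set_lebesgue_integral_def by (simp add: iK KL)
      also have "\<dots> = jac L *\<^sub>R (LINT y|lebesgue. indicator \<Omega> y * (norm (K y))\<^sup>2)"
      proof (rule integral_lebesgue_linear[OF lin(2) bij(2)])
        have [measurable]: "K \<in> borel_measurable borel"
          using lin(1) by (intro borel_measurable_continuous_onI linear_continuous_on) (simp add: linear_conv_bounded_linear)
        have "(\<lambda>y. (norm (K y))\<^sup>2) \<in> borel_measurable lebesgue" by (rule measurable_completion) measurable
        then show "(\<lambda>y. indicator \<Omega> y * (norm (K y))\<^sup>2) \<in> borel_measurable lebesgue" using mO by simp
      qed
      finally show ?thesis using m(2)[of "matrix_inv T"] by (simp add: K_def)
    qed
    have jK1: "jac K = 1 / jac L" using jj jL by (simp add: field_simps)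
    have e: "(jac K * vol \<Omega>) powr (2 / d) * ((jac L * vol \<Omega>) powr (1 + 2 / d) / (jac L * (m * (norm (matrix_inv T))\<^sup>2)))
       = ?C / (norm (matrix_inv T))\<^sup>2"
    proof -
      have "(jac K * vol \<Omega>) powr (2 / d) * (jac L * vol \<Omega>) powr (1 + 2 / d)
         = (jac K powr (2 / d) * jac L powr (1 + 2 / d)) * (vol \<Omega> powr (2 / d) * vol \<Omega> powr (1 + 2 / d))"
        by (simp add: powr_mult)
      also have "jac K powr (2 / d) * jac L powr (1 + 2 / d) = jac L"
        unfolding jK1 using jL by (simp add: powr_add powr_divide)
      finally show ?thesis using jL by simp
    qed
    show ?thesis
      unfolding Qfun_def L_def[symmetric] K_def[symmetric] vL vK I2K d_def[symmetric] mult.assoc e by simp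
  qed
  then show ?thesis using m(1) by (intro that[of ?C]) auto
qed

theorem theorem1p7:
  fixes \<Omega> :: "(real^'n::finite) set" and \<alpha> :: real and n :: nat
  assumes "domain \<Omega>" and "bounded \<Omega>"
    and "irreducible_group (isometry_group \<Omega>)"
    and "0 < \<alpha>" and "\<alpha> \<le> 2" and "1 \<le> n"
  shows "(\<forall>T::real^'n^'n. invertible T \<longrightarrow> Qfun \<alpha> n \<Omega> T \<le> Qfun \<alpha> n \<Omega> (mat 1))
       \<and> (\<forall>T::real^'n^'n. (\<exists>c U. c \<noteq> 0 \<and> orthogonal_matrix U \<and> T = c *\<^sub>R U)
              \<longrightarrow> Qfun \<alpha> n \<Omega> T = Qfun \<alpha> n \<Omega> (mat 1))"
proof -
  have D: "fractional_domain \<alpha> \<Omega>" using assms by unfold_locales (auto simp: Defs.domain_def)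
  obtain C where C: "0 \<le> C" "\<And>T. invertible T \<Longrightarrow> Qfun \<alpha> n \<Omega> T =
     (\<Sum>j=1..n. frac_eigenvalue \<alpha> ((\<lambda>x. T *v x) ` \<Omega>) j) powr (2 / \<alpha>) / (norm (matrix_inv T))\<^sup>2 * C"
    using Qfun_formula[OF assms(1-3)] by metis
  define d where "d = real CARD('n)"
  have d0: "d > 0" by (simp add: d_def)
  define X where "X = (\<Sum>j=1..n. frac_eigenvalue \<alpha> \<Omega> j)"
  \<comment> \<open>Squared Frobenius norm of the identity; it is what makes \<kappa> equal to 1 at
    the identity.\<close>
  have nI: "(norm (mat 1 :: real^'n^'n))\<^sup>2 = d"
    unfolding power2_norm_eq_inner matrix_inner_eq_sum d_def by (simp add: mat_def if_distrib[where f="\<lambda>t. t * _"] cong: if_cong)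
  have inv1: "matrix_inv (mat 1 :: real^'n^'n) = mat 1" by (rule matrix_inv_unique) simp_all
  have Q1: "Qfun \<alpha> n \<Omega> (mat 1) = X powr (2 / \<alpha>) / d * C"
  proof -
    have "invertible (mat 1 :: real^'n^'n)" unfolding invertible_def by (intro exI[of _ "mat 1"]) simp
    then show ?thesis using C(2)[of "mat 1"] by (simp add: inv1 nI X_def)
  qed
  \<comment> \<open>Needed for \<open>powr_mono2\<close>, which requires a nonnegative base on the
    smaller side.\<close>
  have X0: "0 \<le> Y" if "Y = (\<Sum>j=1..n. frac_eigenvalue \<alpha> (L ` \<Omega>) j)" "linear_iso K L" for Y K L
  proof -
    interpret t: transformed_domain \<alpha> \<Omega> K L using D that(2) by (simp add: transformed_domain_def)
    show ?thesis unfolding that(1) by (rule t.image.eigenvalue_sum_nonneg)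
  qed
  have pp: "(y powr (\<alpha> / 2)) powr (2 / \<alpha>) = y" if "y \<ge> 0" for y :: real
    using that assms(4) by (simp add: powr_powr)
  show ?thesis
  proof (intro conjI allI impI)
    fix T :: "real^'n^'n" assume T: "invertible T"
    note TN = invertible_matrix_inv[OF T]
    define \<kappa> where "\<kappa> = (norm (matrix_inv T))\<^sup>2 / d"
    define Y where "Y = (\<Sum>j=1..n. frac_eigenvalue \<alpha> ((\<lambda>x. T *v x) ` \<Omega>) j)"
    have "linear_iso (\<lambda>x. matrix_inv T *v x) (\<lambda>x. T *v x)"
      by (intro linear_iso.intro matrix_vector_mul_linear) (simp_all add: matrix_vector_mul_assoc TN)
    then have Y0: "0 \<le> Y" using X0 Y_def by blast
    have k0: "0 \<le> \<kappa>" using d0 by (simp add: \<kappa>_def)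
    have "Y \<le> \<kappa> powr (\<alpha> / 2) * X"
      unfolding Y_def X_def \<kappa>_def d_def by (rule eigenvalue_sum_linear_image_le[OF D assms(3) T])
    then have "Y powr (2 / \<alpha>) \<le> (\<kappa> powr (\<alpha> / 2) * X) powr (2 / \<alpha>)"
      using Y0 assms(4) by (intro powr_mono2) auto
    also have "\<dots> = \<kappa> * X powr (2 / \<alpha>)" by (simp add: powr_mult pp[OF k0])
    finally have le: "Y powr (2 / \<alpha>) \<le> \<kappa> * X powr (2 / \<alpha>)" .
    have "Y powr (2 / \<alpha>) / (norm (matrix_inv T))\<^sup>2 \<le> X powr (2 / \<alpha>) / d"
    \<comment> \<open>If the norm were 0, the left quotient would be 0 by convention, so the bound
      holds in either case.\<close>
    proof (cases "norm (matrix_inv T) = 0")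
      case False
      then show ?thesis using le d0 by (simp add: \<kappa>_def field_simps)
    qed (use d0 in simp)
    then show "Qfun \<alpha> n \<Omega> T \<le> Qfun \<alpha> n \<Omega> (mat 1)"
      unfolding Q1 C(2)[OF T] Y_def[symmetric] by (rule mult_right_mono[OF _ C(1)])
  next
    fix T :: "real^'n^'n" assume "\<exists>c U. c \<noteq> 0 \<and> orthogonal_matrix U \<and> T = c *\<^sub>R U"
    then obtain c U where c: "c \<noteq> 0" and U: "orthogonal_matrix U" and T: "T = c *\<^sub>R U" by blast
    have o: "transpose U ** U = mat 1" "U ** transpose U = mat 1" using U by (simp_all add: orthogonal_matrix_def)
    have sc: "(a *\<^sub>R A) ** (b *\<^sub>R B) = (a * b) *\<^sub>R (A ** B)" for a b :: real and A B :: "real^'n^'n"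
      by (simp add: vec_eq_iff matrix_matrix_mult_def sum_distrib_left mult_ac)
    have TB: "T ** ((1 / c) *\<^sub>R transpose U) = mat 1" "((1 / c) *\<^sub>R transpose U) ** T = mat 1"
      unfolding T sc o using c by simp_all
    have inv: "matrix_inv T = (1 / c) *\<^sub>R transpose U" by (rule matrix_inv_unique[OF TB])
    have Ti: "invertible T" unfolding invertible_def using TB by blast
    have "norm (transpose U) = norm (transpose U ** mat 1)" by simp
    also have "\<dots> = norm (mat 1 :: real^'n^'n)" using U by (intro norm_orthogonal_mult) simp
    finally have "(norm (matrix_inv T))\<^sup>2 = (1 / c)\<^sup>2 * d" using nI by (simp add: inv power_mult_distrib power_divide)
    \<comment> \<open>The eigenvalue sum scales by |c|^(-\<alpha>), and the power 2/\<alpha> turns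
      this into c^(-2), the factor by which the squared norm of the inverse scales; the quotient
      does not change.\<close>
    moreover have "(\<Sum>j=1..n. frac_eigenvalue \<alpha> ((\<lambda>x. T *v x) ` \<Omega>) j) powr (2 / \<alpha>) = (1 / c)\<^sup>2 * X powr (2 / \<alpha>)"
    proof -
      have "((1 / \<bar>c\<bar>) powr \<alpha>) powr (2 / \<alpha>) = (1 / c)\<^sup>2"
        using assms(4) c by (simp add: powr_powr power_divide powr_divide)
      then show ?thesis
        unfolding similarity_eigenvalue_sum[OF D U c T] X_def[symmetric] by (simp add: powr_mult)
    qed
    ultimately show "Qfun \<alpha> n \<Omega> T = Qfun \<alpha> n \<Omega> (mat 1)"
      unfolding Q1 C(2)[OF Ti] using c d0 by simp
  qed
qed

end
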